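(* Let $\mathcal{C}\subset\mathbb{S}^2$ be a convex cone with vertex at the pole $p$ and let $\Omega$ be an admissible exterior domain in $\mathbb{S}^2\setminus\overline{\mathcal{C}}$, with $\Gamma_0=\partial\Omega\setminus\partial\mathcal{C}$ and $\Gamma_1=\partial\Omega\setminus\overline{\Gamma_0}$. Assume $\Omega$ is star-shaped with respect to $p$. Suppose there exists $u\in C^2(\overline\Omega)$ satisfying $$\Delta u+2u=-2\ \text{ in }\Omega,\qquad u=0,\ \ \frac{\partial u}{\partial\nu}=c\ \text{ on }\Gamma_0,\qquad \frac{\partial u}{\partial\nu}=0\ \text{ on }\Gamma_1\setminus\{p\},$$ with $c$ a constant and $\nu$ the outward unit normal to $\Gamma_0\cup\Gamma_1\setminus\{p\}$. Then there exist a point $p_0$ and $R>0$ such that $\Omega=B_R(p_0)\setminus\overline{\mathcal{C}}$, where $B_R(p_0)$ is the geodesic ball of radius $R$ centered at $p_0$, and $$u(x)=\frac{1}{\cos R}\big(\cos r(x)-\cos R\big),\qquad r(x)=\operatorname{dist}(p_0,x).$$ Moreover, either (I) $p_0=p$, or (II) $p_0\in\partial\mathcal{C}$ and $\partial\Omega\cap\partial\mathcal{C}$ is totally geodesic.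
   Context: $\mathbb{S}^2$ is the round unit sphere, written in polar coordinates about $p$ as $[0,\pi)\times\mathbb{S}^1$ with metric $dr^2+\sin^2r\,g_{\mathbb{S}^1}$. For a convex arc $\omega\subset\mathbb{S}^1$, the convex cone with vertex $p$ is $\mathcal{C}=\{tx:x\in\omega,\ t\in[0,\pi)\}$. A connected bounded open set $\Omega\subset\mathbb{S}^2\setminus\overline{\mathcal{C}}$ is an admissible exterior domain if: $p\in\partial\Omega$; $\Gamma_0:=\partial\Omega\setminus\partial\mathcal{C}\ne\emptyset$ is a $1$-dimensional smooth manifold; $\Gamma_1:=\partial\Omega\setminus\overline{\Gamma_0}\ne\emptyset$ and $\partial\Gamma_0=\partial\Gamma_1\subset\partial\mathcal{C}\setminus\{p\}$ is a $0$-dimensional smooth manifold; and $\mathcal{H}^1(\Gamma_i)>0$ for $i=0,1$. $\Omega$ is star-shaped with respect to $p$ if each component of $\partial\Omega$ can be written as a graph over a geodesic circle centered at $p$ (in particular $\langle\nabla r,\nu\rangle>0$ on $\Gamma_0$, where $r=\operatorname{dist}(p,\cdot)$). *)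

theory Defs
  imports "HOL-Analysis.Analysis"
begin

definition S2 :: "(real^3) set" where
  "S2 = sphere 0 1"

definition sdist :: "real^3 \<Rightarrow> real^3 \<Rightarrow> real" where
  "sdist x y = arccos (x \<bullet> y)"

definition sball :: "real^3 \<Rightarrow> real \<Rightarrow> (real^3) set" where
  "sball q R = {x \<in> S2. sdist q x < R}"

text \<open>Unit speed geodesic starting at x with unit initial velocity n (n orthogonal to x).\<close>
definition geo :: "real^3 \<Rightarrow> real^3 \<Rightarrow> real \<Rightarrow> real^3" where
  "geo x n t = cos t *\<^sub>R x + sin t *\<^sub>R n"

definition s_interior :: "(real^3) set \<Rightarrow> (real^3) set" where
  "s_interior A = {x \<in> A. \<exists>e>0. \<forall>y\<in>S2. dist y x < e \<longrightarrow> y \<in> A}"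

definition sbd :: "(real^3) set \<Rightarrow> (real^3) set" where
  "sbd A = closure A - s_interior A"

text \<open>The arc omega of the unit circle of the tangent plane at p, described by an
  orthonormal frame e1, e2 of that tangent plane and an opening angle alpha.\<close>
definition tarc :: "real^3 \<Rightarrow> real^3 \<Rightarrow> real \<Rightarrow> (real^3) set" where
  "tarc e1 e2 \<alpha> = {cos \<theta> *\<^sub>R e1 + sin \<theta> *\<^sub>R e2 | \<theta>. \<theta> \<in> {0..\<alpha>}}"

definition convex_arc :: "real^3 \<Rightarrow> real^3 \<Rightarrow> real^3 \<Rightarrow> real \<Rightarrow> bool" where
  "convex_arc p e1 e2 \<alpha> \<longleftrightarrow> p \<in> S2 \<and> norm e1 = 1 \<and> norm e2 = 1 \<and>
     e1 \<bullet> e2 = 0 \<and> e1 \<bullet> p = 0 \<and> e2 \<bullet> p = 0 \<and> 0 < \<alpha> \<and> \<alpha> \<le> pi"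

definition scone :: "real^3 \<Rightarrow> (real^3) set \<Rightarrow> (real^3) set" where
  "scone p \<omega> = {geo p v t | t v. t \<in> {0..<pi} \<and> v \<in> \<omega>}"

definition smooth_curve_on :: "real set \<Rightarrow> (real \<Rightarrow> real^3) \<Rightarrow> bool" where
  "smooth_curve_on S \<gamma> \<longleftrightarrow>
     (\<forall>k i. \<forall>t\<in>S. ((deriv ^^ k) (\<lambda>s. \<gamma> s $ i)) field_differentiable (at t))"

definition smooth_1_manifold :: "(real^3) set \<Rightarrow> bool" where
  "smooth_1_manifold \<Gamma> \<longleftrightarrow>
     (\<forall>x\<in>\<Gamma>. \<exists>U \<gamma> g a b. open U \<and> x \<in> U \<and> a < b \<and>
        homeomorphism {a<..<b} (\<Gamma> \<inter> U) \<gamma> g \<and>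
        smooth_curve_on {a<..<b} \<gamma> \<and>
        (\<forall>t\<in>{a<..<b}. \<exists>v. v \<noteq> 0 \<and> (\<gamma> has_vector_derivative v) (at t)))"

definition smooth_0_manifold :: "(real^3) set \<Rightarrow> bool" where
  "smooth_0_manifold E \<longleftrightarrow> (\<forall>x\<in>E. \<exists>e>0. \<forall>y\<in>E. dist y x < e \<longrightarrow> y = x)"

definition hausdorff1 :: "(real^3) set \<Rightarrow> ennreal" where
  "hausdorff1 A = (SUP \<delta>\<in>{0<..}. INF C\<in>{C :: nat \<Rightarrow> (real^3) set.
       A \<subseteq> \<Union>(range C) \<and> (\<forall>i. bounded (C i) \<and> diameter (C i) \<le> \<delta>)}.
       (\<Sum>i. ennreal (diameter (C i))))"

definition Gamma0 :: "(real^3) set \<Rightarrow> (real^3) set \<Rightarrow> (real^3) set" where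
  "Gamma0 C \<Omega> = sbd \<Omega> - sbd C"

definition Gamma1 :: "(real^3) set \<Rightarrow> (real^3) set \<Rightarrow> (real^3) set" where
  "Gamma1 C \<Omega> = sbd \<Omega> - closure (Gamma0 C \<Omega>)"

definition admissible_exterior :: "real^3 \<Rightarrow> (real^3) set \<Rightarrow> (real^3) set \<Rightarrow> bool" where
  "admissible_exterior p C \<Omega> \<longleftrightarrow>
     openin (top_of_set S2) \<Omega> \<and> connected \<Omega> \<and> bounded \<Omega> \<and> \<Omega> \<subseteq> S2 - closure C \<and>
     p \<in> sbd \<Omega> \<and>
     Gamma0 C \<Omega> \<noteq> {} \<and> smooth_1_manifold (Gamma0 C \<Omega>) \<and>
     Gamma1 C \<Omega> \<noteq> {} \<and>
     closure (Gamma0 C \<Omega>) - Gamma0 C \<Omega> = closure (Gamma1 C \<Omega>) - Gamma1 C \<Omega> \<and>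
     closure (Gamma0 C \<Omega>) - Gamma0 C \<Omega> \<subseteq> sbd C - {p} \<and>
     smooth_0_manifold (closure (Gamma0 C \<Omega>) - Gamma0 C \<Omega>) \<and>
     hausdorff1 (Gamma0 C \<Omega>) > 0 \<and> hausdorff1 (Gamma1 C \<Omega>) > 0"

text \<open>n is the outward unit normal of Omega at the boundary point x: a unit tangent
  vector of the sphere at x, orthogonal to the boundary at x (to its tangent cone),
  such that the geodesic in direction n leaves the closure of Omega and the one in
  direction -n enters Omega.\<close>
definition outward_normal :: "(real^3) set \<Rightarrow> real^3 \<Rightarrow> real^3 \<Rightarrow> bool" where
  "outward_normal \<Omega> x n \<longleftrightarrow> norm n = 1 \<and> n \<bullet> x = 0 \<and>
     (\<forall>e>0. \<exists>d>0. \<forall>y\<in>sbd \<Omega>. norm (y - x) < d \<longrightarrow> \<bar>(y - x) \<bullet> n\<bar> \<le> e * norm (y - x)) \<and>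
     (\<exists>\<epsilon>>0. \<forall>t. 0 < t \<and> t < \<epsilon> \<longrightarrow> geo x n t \<notin> closure \<Omega> \<and> geo x n (- t) \<in> \<Omega>)"

text \<open>Spherical gradient of r = dist(p, .) at x (x different from p and -p).\<close>
definition grad_r :: "real^3 \<Rightarrow> real^3 \<Rightarrow> real^3" where
  "grad_r p x = (1 / sqrt (1 - (p \<bullet> x)^2)) *\<^sub>R ((p \<bullet> x) *\<^sub>R x - p)"

definition rad_dir :: "real^3 \<Rightarrow> real^3 \<Rightarrow> real^3" where
  "rad_dir p x = sgn (x - (x \<bullet> p) *\<^sub>R p)"

text \<open>Star-shapedness with respect to p: each connected component of Gamma0 is a
  radial graph over (an arc of) a geodesic circle centred at p, and
  (grad r, nu) > 0 on Gamma0.\<close>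
definition star_shaped_wrt :: "real^3 \<Rightarrow> (real^3) set \<Rightarrow> (real^3) set \<Rightarrow> (real^3 \<Rightarrow> real^3) \<Rightarrow> bool" where
  "star_shaped_wrt p C \<Omega> \<nu> \<longleftrightarrow>
     (\<forall>x\<in>Gamma0 C \<Omega>. inj_on (rad_dir p) (connected_component_set (Gamma0 C \<Omega>) x)) \<and>
     (\<forall>x\<in>Gamma0 C \<Omega>. grad_r p x \<bullet> \<nu> x > 0)"

definition totally_geodesic :: "(real^3) set \<Rightarrow> bool" where
  "totally_geodesic A \<longleftrightarrow> (\<exists>n. n \<noteq> 0 \<and> (\<forall>x\<in>A. x \<bullet> n = 0))"

end

theory Submission
  imports Defs "HOL-Complex_Analysis.Complex_Analysis"
begin

text \<open>The vector field \<open>X = \<nabla>u + (u + 1) x\<close> on \<open>\<Omega>\<close> is the minimal surface with Gauss map \<open>x\<close>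
  and support function \<open>w = u + 1\<close>. Its differential \<open>E = \<nabla>\<^sup>2w + w g\<close> is traceless and divergence free, so in
  the conformal coordinate \<open>z = s + i t\<close>, where \<open>t\<close> is the polar angle about \<open>p\<close> and \<open>s = log tan(r/2)\<close>,
  \<open>\<phi> - i \<psi> = E(\<partial>\<^sub>s,\<partial>\<^sub>s) - i E(\<partial>\<^sub>s,\<partial>\<^sub>t)\<close> is holomorphic; let \<open>G = a + i b\<close> be its primitive that
  vanishes at \<open>p\<close>. Star-shapedness makes \<open>\<Omega>\<close> the region below a graph \<open>s = \<sigma>(t)\<close> in the strip
  \<open>\<alpha> < t < 2\<pi>\<close>.

  The function \<open>|X|\<^sup>2 = w\<^sup>2 + |\<nabla>u|\<^sup>2\<close> is subharmonic, has vanishing normal derivative on \<open>\<Gamma>\<^sub>1\<close> and equals \<open>1 + c\<^sup>2\<close> on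
  \<open>\<Gamma>\<^sub>0\<close>, so it is maximal on \<open>\<Gamma>\<^sub>0\<close>. The sign of its radial derivative there says exactly that \<open>b\<close> is monotone
  along \<open>\<Gamma>\<^sub>0\<close> (for \<open>c = 0\<close> it is strictly monotone for a different reason). As \<open>\<psi> = 0\<close> on \<open>\<Gamma>\<^sub>1\<close>, \<open>b\<close> vanishes on the
  two boundary lines of the strip, in particular at both ends of \<open>\<Gamma>\<^sub>0\<close>; hence \<open>b = 0\<close> on the
  whole boundary and \<open>E = 0\<close>. Thus \<open>X\<close> is a constant vector \<open>a\<close> and \<open>u + 1 = a \<bullet> x\<close>, after which the boundary
  conditions determine \<open>a\<close> and \<open>\<Omega>\<close>.\<close>

section \<open>Domains below a graph in a strip\<close>

text \<open>The coordinate \<open>z\<close> turns both faces of the cone into horizontal lines.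
  There the Neumann condition gives \<open>wt = 0\<close>, hence \<open>psi = 0\<close>, so
  \<open>b\<close> keeps its value at the vertex along each line. The maximum of
  \<open>|X|\<^sup>2\<close> is linked to \<open>b\<close> by
  \<open>\<nabla>|X|\<^sup>2 = 2 E(\<nabla>u, .)\<close>: on Gamma_0 the gradient is
  \<open>c\<close> times the normal, so the radial derivative is \<open>c\<close> times the
  derivative of \<open>b\<close> along the graph, up to a factor that star-shapedness makes
  positive.

  Three obstacles shape the proof. As \<open>u\<close> is only C^2, the third derivatives behind
  subharmonicity come from holomorphy, and only in the interior. Gamma_0 enters through its tangent
  cone, so first-order expansions and one-sided quotients replace chain rules along it. Finally, the
  strip has two infinite ends. Since \<open>E\<close> is bounded and the coordinate vectors have
  length \<open>sech s\<close>, \<open>phi\<close> and \<open>psi\<close> are integrable there: the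
  end at \<open>p\<close> fixes the constant of \<open>b\<close>, and the end at \<open>-p\<close>
  is cut off at \<open>s = S\<close> with an error of order \<open>sech\<^sup>2 S\<close>.\<close>

lemma connected_fill:
  assumes "connected V" "open T" "\<And>x. x \<in> V \<Longrightarrow> x \<in> closure (V \<inter> T) \<Longrightarrow> x \<in> T" "V \<inter> T \<noteq> {}"
  shows "V \<subseteq> T"
\<comment> \<open>The third assumption makes \<open>V \<inter> T\<close> closed in \<open>V\<close>,
  so the part of \<open>V\<close> outside \<open>T\<close> lies in an open set disjoint from
  \<open>V \<inter> T\<close>. Later arguments that a domain fills a region are instances of this
  one.\<close>
proof (rule ccontr)
  assume "\<not> V \<subseteq> T"
  then have "V \<inter> - closure (V \<inter> T) \<noteq> {}" using assms(3) by blast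
  moreover have "V \<subseteq> T \<union> - closure (V \<inter> T)" using assms(3) by blast
  moreover have "T \<inter> - closure (V \<inter> T) \<inter> V = {}" using closure_subset[of "V \<inter> T"] by blast
  ultimately show False
    using connectedD[OF assms(1), of T "- closure (V \<inter> T)"] assms(2,4) by blast
qed

text \<open>\<open>D\<close> is the domain, \<open>N\<close> its boundary part inside the strip (the image of \<open>\<Gamma>\<^sub>0\<close>), and \<open>(ns, nt)\<close> are the
  components of the outward normal; \<open>s \<longrightarrow> -\<infinity>\<close> corresponds to the vertex of the cone. Nothing but the tangent cone
  of \<open>N\<close> is needed, no regularity of the curve.\<close>

locale planar_strip =
  fixes A B L :: real and D N :: "complex set" and ns nt :: "complex \<Rightarrow> real"
  assumes AB: "A < B"
    and D_open: "open D"
    and D_strip: "z \<in> D \<Longrightarrow> A < Im z \<and> Im z < B"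
    and N_strip: "z \<in> N \<Longrightarrow> A < Im z \<and> Im z < B"
    and N_closure: "N \<subseteq> closure D"
    and DN: "D \<inter> N = {}"
    and D_cl: "z \<in> closure D \<Longrightarrow> A < Im z \<Longrightarrow> Im z < B \<Longrightarrow> z \<in> D \<union> N"
    and D_low: "Re z < L \<Longrightarrow> A < Im z \<Longrightarrow> Im z < B \<Longrightarrow> z \<in> D"
    and N_up: "z \<in> N \<Longrightarrow> \<exists>d>0. \<forall>h. 0 < h \<and> h < d \<longrightarrow> Complex (Re z + h) (Im z) \<notin> closure D"
    and ns_pos: "z \<in> N \<Longrightarrow> ns z > 0"
    and N_cone: "z \<in> N \<Longrightarrow> e > 0 \<Longrightarrow> \<exists>d>0. \<forall>y\<in>N. cmod (y - z) < d \<longrightarrow>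
        \<bar>ns z * (Re y - Re z) + nt z * (Im y - Im z)\<bar> \<le> e * cmod (y - z)"
begin

lemma fill:
  assumes "connected V" "V \<inter> N = {}" "V \<inter> D \<noteq> {}" "\<And>z. z \<in> V \<Longrightarrow> A < Im z \<and> Im z < B"
  shows "V \<subseteq> D"
proof (rule connected_fill[OF assms(1) D_open _ assms(3)])
  fix z assume z: "z \<in> V" "z \<in> closure (V \<inter> D)"
  then have "z \<in> closure D" using closure_mono[of "V \<inter> D" D] by blast
  then show "z \<in> D" using D_cl assms(2,4) z(1) by blast
qed

lemma D_near:
  assumes "z \<in> D" obtains d where "d > 0" "\<And>y. cmod (y - z) < d \<Longrightarrow> y \<in> D"
  using D_open assms unfolding open_dist dist_norm by metis

lemma cmod_Complex_same_Im: "cmod (Complex a t - Complex b t) = \<bar>a - b\<bar>"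
  by (simp add: cmod_def)

lemma cmod_Complex_same_Re: "cmod (Complex a t - Complex a u) = \<bar>t - u\<bar>"
  by (simp add: cmod_def)

text \<open>The highest missing point \<open>m\<close> of the column below \<open>s\<close> would
  lie in \<open>N\<close> and be approached from above by points of \<open>D\<close>, which
  \<open>N_up\<close> forbids.\<close>

lemma D_down:
  assumes "Complex s t \<in> D" "s' < s" shows "Complex s' t \<in> D"
proof (rule ccontr)
  assume n: "Complex s' t \<notin> D"
  define X where "X = {x. x \<le> s \<and> Complex x t \<notin> D}"
  have X: "s' \<in> X" "bdd_above X" using n assms(2) by (auto simp: X_def bdd_above_def)
  define m where "m = Sup X"
  have st: "A < t" "t < B" using D_strip[OF assms(1)] by auto
  have ms: "m \<le> s" unfolding m_def using X by (intro cSup_least) (auto simp: X_def)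
  have above: "Complex x t \<in> D" if "m < x" "x \<le> s" for x
    using that X cSup_upper[of x X] unfolding m_def X_def by force
  have mD: "Complex m t \<notin> D"
  proof
    assume "Complex m t \<in> D"
    then obtain d where d: "d > 0" "\<And>y. cmod (y - Complex m t) < d \<Longrightarrow> y \<in> D" using D_near by metis
    obtain x where "x \<in> X" "m - d < x" using less_cSup_iff[of X "m - d"] X d(1) unfolding m_def by force
    moreover have "x \<le> m" unfolding m_def using calculation X by (intro cSup_upper)
    moreover have "Complex x t \<in> D" using d(2)[of "Complex x t"] calculation cmod_Complex_same_Im by simp
    ultimately show False by (simp add: X_def)
  qed
  have ms': "m < s" using mD ms assms(1) by (cases "m = s") auto
  have "Complex m t \<in> closure D"
  proof (unfold closure_approachable, intro allI impI)
    fix e :: real assume "e > 0"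
    define x where "x = min s (m + e/2)"
    have "Complex x t \<in> D" by (rule above) (use \<open>e > 0\<close> ms' in \<open>auto simp: x_def\<close>)
    moreover have "dist (Complex x t) (Complex m t) < e"
      unfolding dist_norm cmod_Complex_same_Im using \<open>e > 0\<close> ms' by (auto simp: x_def)
    ultimately show "\<exists>y\<in>D. dist y (Complex m t) < e" by blast
  qed
  then have "Complex m t \<in> N" using D_cl[of "Complex m t"] mD st by auto
  then obtain d where d: "d > 0" "\<And>h. 0 < h \<Longrightarrow> h < d \<Longrightarrow> Complex (m + h) t \<notin> closure D"
    using N_up[of "Complex m t"] by auto
  define h where "h = min (d/2) (s - m)"
  have "Complex (m + h) t \<in> D" by (rule above) (use d ms' in \<open>auto simp: h_def\<close>)
  moreover have "Complex (m + h) t \<notin> closure D" by (rule d(2)) (use d ms' in \<open>auto simp: h_def\<close>)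
  ultimately show False using closure_subset by blast
qed

text \<open>Nearby points of \<open>D\<close> can be moved down by \<open>D_down\<close>, so the
  column below lies in \<open>closure D\<close>. A point of \<open>N\<close> on it would have points
  outside \<open>closure D\<close> just above it.\<close>

lemma N_down:
  assumes "Complex s t \<in> N" "s' < s" shows "Complex s' t \<in> D"
proof -
  have st: "A < t" "t < B" using N_strip[OF assms(1)] by auto
  have cl: "Complex x t \<in> closure D" if "x < s" for x
  proof (unfold closure_approachable, intro allI impI)
    fix e :: real assume "e > 0"
    define d where "d = min e (s - x)"
    have "d > 0" using \<open>e > 0\<close> that by (simp add: d_def)
    have "Complex s t \<in> closure D" using assms N_closure by blast
    then obtain y where y: "y \<in> D" "dist y (Complex s t) < d"
      using \<open>d > 0\<close> unfolding closure_approachable by blast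
    have r: "\<bar>Re y - s\<bar> < d" "\<bar>Im y - t\<bar> < d"
      using y(2) abs_Re_le_cmod[of "y - Complex s t"] abs_Im_le_cmod[of "y - Complex s t"]
      unfolding dist_norm by auto
    have "Complex x (Im y) \<in> D" by (rule D_down[of "Re y"]) (use y r in \<open>auto simp: d_def\<close>)
    moreover have "dist (Complex x (Im y)) (Complex x t) < e"
      unfolding dist_norm cmod_Complex_same_Re using r by (auto simp: d_def)
    ultimately show "\<exists>y\<in>D. dist y (Complex x t) < e" by blast
  qed
  show ?thesis
  proof (rule ccontr)
    assume "Complex s' t \<notin> D"
    then have "Complex s' t \<in> N" using D_cl[OF cl[OF assms(2)]] st by auto
    then obtain d where d: "d > 0" "\<And>h. 0 < h \<Longrightarrow> h < d \<Longrightarrow> Complex (s' + h) t \<notin> closure D"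
      using N_up[of "Complex s' t"] by auto
    define h where "h = min (d/2) ((s - s')/2)"
    have "0 < h" "h < d" "s' + h < s" using d(1) assms(2) by (auto simp: h_def min_def field_simps)
    then show False using d(2) cl by blast
  qed
qed

lemma down: "z \<in> D \<union> N \<Longrightarrow> s < Re z \<Longrightarrow> Complex s (Im z) \<in> D"
  using D_down[of "Re z" "Im z"] N_down[of "Re z" "Im z"] by auto

text \<open>The height of the graph, truncated at \<open>S\<close> because the column over \<open>t\<close> may be unbounded
  (when \<open>-p\<close> is a corner of the domain).\<close>

definition top :: "real \<Rightarrow> real \<Rightarrow> real" where
  "top S t = Sup {s. s \<le> S \<and> Complex s t \<in> D}"

lemma top_set: assumes "A < t" "t < B"
  shows "{s. s \<le> S \<and> Complex s t \<in> D} \<noteq> {}" "bdd_above {s. s \<le> S \<and> Complex s t \<in> D}"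
  using D_low[of "Complex (min S (L - 1)) t"] assms by (force simp: bdd_above_def)+

lemma top_le: "A < t \<Longrightarrow> t < B \<Longrightarrow> top S t \<le> S"
  unfolding top_def using top_set by (intro cSup_least) auto

lemma le_top: 
  assumes "A < t" "t < B" "Complex s t \<in> D \<union> N" "s \<le> S" shows "s \<le> top S t"
proof (rule dense_le)
  fix x assume "x < s"
  then have "Complex x t \<in> D" using down[OF assms(3)] by auto
  then show "x \<le> top S t" unfolding top_def using \<open>x < s\<close> assms top_set by (intro cSup_upper) auto
qed

lemma top_below: 
  assumes "A < t" "t < B" "s < top S t" shows "Complex s t \<in> D"
proof -
  obtain x where "x \<le> S" "Complex x t \<in> D" "s < x"
    using assms less_cSup_iff[OF top_set[OF assms(1,2)], of s S] unfolding top_def by auto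
  then show ?thesis using D_down by blast
qed

text \<open>The top point is a limit of points of \<open>D\<close>. If it lies in \<open>D\<close>
  itself, openness lets the column continue, so only the truncation at \<open>S\<close> can have
  stopped it.\<close>

lemma top_cases:
  assumes "A < t" "t < B"
  shows "top S t = S \<and> Complex S t \<in> D \<or> Complex (top S t) t \<in> N"
proof -
  have "Complex (top S t) t \<in> closure D"
  proof (unfold closure_approachable, intro allI impI)
    fix e :: real assume "e > 0"
    then have "Complex (top S t - e/2) t \<in> D" by (intro top_below[OF assms, of _ S]) auto
    then show "\<exists>y\<in>D. dist y (Complex (top S t) t) < e" using \<open>e > 0\<close>
      by (intro bexI[of _ "Complex (top S t - e/2) t"]) (auto simp: dist_norm cmod_Complex_same_Im)
  qed
  then consider "Complex (top S t) t \<in> N" | "Complex (top S t) t \<in> D" using D_cl assms by fastforce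
  then show ?thesis
  proof cases
    case 2
    then obtain d where d: "d > 0" "\<And>y. cmod (y - Complex (top S t) t) < d \<Longrightarrow> y \<in> D" using D_near by metis
    have "top S t = S"
    proof (rule ccontr)
      assume "top S t \<noteq> S"
      then have l: "top S t < S" using top_le assms by (simp add: order_less_le)
      define x where "x = min S (top S t + d/2)"
      have "Complex x t \<in> D" by (rule d(2), subst cmod_Complex_same_Im) (use d(1) l in \<open>auto simp: x_def\<close>)
      then have "x \<le> top S t" using assms by (intro le_top) (auto simp: x_def)
      then show False using d(1) l by (auto simp: x_def)
    qed
    then show ?thesis using 2 by auto
  qed auto
qed

text \<open>A point of \<open>D\<close> just below the top persists in the neighbouring columns
  because \<open>D\<close> is open. A point just above it is outside \<open>closure D\<close> by
  \<open>N_up\<close>, and so is a neighbourhood, which bounds those columns from above; on the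
  truncation level the bound \<open>S\<close> does this.\<close>

lemma top_cont: 
  assumes "A < t" "t < B" shows "isCont (top S) t"
proof (unfold isCont_def LIM_def dist_norm, intro allI impI)
  fix e :: real assume e: "e > 0"
  have "Complex (top S t - e/2) t \<in> D" using e by (intro top_below[OF assms, of _ S]) auto
  then obtain d1 where d1: "d1 > 0" "\<And>y. cmod (y - Complex (top S t - e/2) t) < d1 \<Longrightarrow> y \<in> D" using D_near by metis
  have lo: "top S t - e < top S x" if "\<bar>x - t\<bar> < d1" "A < x" "x < B" for x
  proof -
    have "Complex (top S t - e/2) x \<in> D" by (rule d1(2)) (use that in \<open>simp add: cmod_Complex_same_Re\<close>)
    then have "top S t - e/2 \<le> top S x" using top_le[OF assms, of S] e that by (intro le_top) auto
    then show ?thesis using e by simp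
  qed
  have "\<exists>d2>0. \<forall>x. \<bar>x - t\<bar> < d2 \<and> A < x \<and> x < B \<longrightarrow> top S x < top S t + e"
    using top_cases[OF assms, of S]
  proof
    assume "top S t = S \<and> Complex S t \<in> D"
    then show ?thesis using e top_le[of _ S] by (intro exI[of _ 1]) force
  next
    assume "Complex (top S t) t \<in> N"
    then obtain d where d: "d > 0" "\<And>h. 0 < h \<Longrightarrow> h < d \<Longrightarrow> Complex (top S t + h) t \<notin> closure D"
      using N_up[of "Complex (top S t) t"] by auto
    define h where "h = min (d/2) (e/2)"
    have "Complex (top S t + h) t \<in> - closure D" using d(2)[of h] d(1) e by (auto simp: h_def)
    moreover have "open (- closure D)" by auto
    ultimately obtain d2 where d2: "d2 > 0" "\<And>y. dist y (Complex (top S t + h) t) < d2 \<Longrightarrow> y \<in> - closure D"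
      unfolding open_dist by metis
    have "top S x < top S t + e" if "\<bar>x - t\<bar> < d2" "A < x" "x < B" for x
    proof (rule ccontr)
      assume "\<not> ?thesis"
      then have "Complex (top S t + h) x \<in> D" using e that by (intro top_below[of _ _ S]) (auto simp: h_def min_def)
      moreover have "Complex (top S t + h) x \<in> - closure D"
        by (rule d2(2)) (use that in \<open>simp add: dist_norm cmod_Complex_same_Re\<close>)
      ultimately show False using closure_subset by blast
    qed
    then show ?thesis using d2(1) by blast
  qed
  then obtain d2 where d2: "d2 > 0" "\<And>x. \<bar>x - t\<bar> < d2 \<Longrightarrow> A < x \<Longrightarrow> x < B \<Longrightarrow> top S x < top S t + e" by blast
  define d where "d = Min {d1, d2, t - A, B - t}"
  have "d > 0" using d1 d2 assms by (auto simp: d_def)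
  moreover have "norm (top S x - top S t) < e" if "x \<noteq> t \<and> norm (x - t) < d" for x
  proof -
    have "\<bar>x - t\<bar> < d1" "\<bar>x - t\<bar> < d2" "A < x" "x < B" using that assms by (auto simp: d_def)
    then show ?thesis using lo d2(2) by (simp add: abs_less_iff) (smt (verit))
  qed
  ultimately show "\<exists>s>0. \<forall>x. x \<noteq> t \<and> norm (x - t) < s \<longrightarrow> norm (top S x - top S t) < e" by blast
qed

text \<open>The boundary is a graph over \<open>Im\<close>, so this is the derivative of
  \<open>Re\<close> with respect to \<open>Im\<close> along it.\<close>

definition slope :: "complex \<Rightarrow> real" where "slope z = - nt z / ns z"

lemma N_slope:
  assumes "z \<in> N" "e > 0"
  shows "\<exists>d>0. \<forall>y\<in>N. cmod (y - z) < d \<longrightarrow> \<bar>Re y - Re z - slope z * (Im y - Im z)\<bar> \<le> e * \<bar>Im y - Im z\<bar>"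
proof -
  define m where "m = slope z"
  \<comment> \<open>With \<open>e1 \<le> 1/2\<close> the part of the error proportional to
    \<open>a - m * b\<close> is absorbed on the left; the second bound makes the remaining part at
    most \<open>e / 2\<close> times \<open>\<bar>b\<bar>\<close>.\<close>
  define e1 where "e1 = min (1/2) (e / (2 * (1 + \<bar>m\<bar>)))"
  have e1: "e1 > 0" "e1 \<le> 1/2" "e1 * (1 + \<bar>m\<bar>) \<le> e / 2"
  proof -
    have "0 < e / (2 * (1 + \<bar>m\<bar>))" using assms(2) by (intro divide_pos_pos) auto
    then show "e1 > 0" "e1 \<le> 1/2" unfolding e1_def by linarith+
    have "e1 * (1 + \<bar>m\<bar>) \<le> e / (2 * (1 + \<bar>m\<bar>)) * (1 + \<bar>m\<bar>)"
      by (intro mult_right_mono) (auto simp: e1_def)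
    also have "\<dots> = e / 2"
    proof -
      have "1 + \<bar>m\<bar> \<noteq> 0" by linarith
      then show ?thesis by (simp add: divide_simps)
    qed
    finally show "e1 * (1 + \<bar>m\<bar>) \<le> e / 2" .
  qed
  have n: "ns z > 0" using ns_pos assms by simp
  have "ns z * e1 > 0" using n e1 by simp
  then obtain d where d: "d > 0" "\<And>y. y \<in> N \<Longrightarrow> cmod (y - z) < d \<Longrightarrow>
        \<bar>ns z * (Re y - Re z) + nt z * (Im y - Im z)\<bar> \<le> (ns z * e1) * cmod (y - z)"
    using N_cone[OF assms(1)] by meson
  have "\<bar>Re y - Re z - m * (Im y - Im z)\<bar> \<le> e * \<bar>Im y - Im z\<bar>" if "y \<in> N" "cmod (y - z) < d" for y
  proof -
    define a b where "a = Re y - Re z" and "b = Im y - Im z"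
    have c: "cmod (y - z) \<le> \<bar>a\<bar> + \<bar>b\<bar>" using cmod_le[of "y - z"] by (simp add: a_def b_def)
    have "ns z * a + nt z * b = ns z * (a - m * b)" using n by (simp add: m_def slope_def field_simps)
    then have "ns z * \<bar>a - m * b\<bar> \<le> (ns z * e1) * cmod (y - z)"
      using d(2)[OF that] n by (simp add: a_def b_def abs_mult)
    then have "\<bar>a - m * b\<bar> \<le> e1 * cmod (y - z)" using n by simp
    also have "\<dots> \<le> e1 * (\<bar>a\<bar> + \<bar>b\<bar>)" using c e1 by simp
    also have "\<dots> \<le> e1 * (\<bar>a - m * b\<bar> + \<bar>m\<bar> * \<bar>b\<bar> + \<bar>b\<bar>)"
      using e1 abs_triangle_ineq[of "a - m*b" "m * b"] by (simp add: abs_mult)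
    also have "\<dots> = e1 * \<bar>a - m * b\<bar> + e1 * (1 + \<bar>m\<bar>) * \<bar>b\<bar>" by (simp add: algebra_simps)
    also have "\<dots> \<le> 1/2 * \<bar>a - m * b\<bar> + e/2 * \<bar>b\<bar>"
      using e1 by (intro add_mono mult_right_mono) auto
    finally show ?thesis by (simp add: a_def b_def)
  qed
  then show ?thesis using d(1) unfolding m_def by blast
qed

lemma top_near_N:
  assumes "z \<in> N" "Re z \<le> S" "e > 0"
  shows "\<exists>d>0. \<forall>t. \<bar>t - Im z\<bar> < d \<longrightarrow> A < t \<and> t < B \<and> cmod (Complex (top S t) t - z) < e"
proof -
  have st: "A < Im z" "Im z < B" using N_strip assms by auto
  have "top S (Im z) = Re z"
  proof (rule antisym)
    show "Re z \<le> top S (Im z)" using le_top[of "Im z" "Re z"] assms st by auto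
    show "top S (Im z) \<le> Re z"
      using top_below[OF st, of "Re z" S] assms DN by (metis Complex_eq complex_surj disjoint_iff not_le)
  qed
  then obtain d where d: "d > 0" "\<And>t. \<bar>t - Im z\<bar> < d \<Longrightarrow> \<bar>top S t - Re z\<bar> < e/2"
    using top_cont[OF st, of S] \<open>e > 0\<close> unfolding isCont_def LIM_def dist_norm real_norm_def
    by (metis diff_self abs_zero half_gt_zero)
  define d' where "d' = Min {d, e/2, Im z - A, B - Im z}"
  have "d' > 0" using d st \<open>e > 0\<close> by (auto simp: d'_def)
  moreover have "A < t \<and> t < B \<and> cmod (Complex (top S t) t - z) < e" if "\<bar>t - Im z\<bar> < d'" for t
  proof -
    have t: "\<bar>t - Im z\<bar> < d" "\<bar>t - Im z\<bar> < e/2" "A < t" "t < B" using that by (auto simp: d'_def)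
    have "cmod (Complex (top S t) t - z) \<le> \<bar>top S t - Re z\<bar> + \<bar>t - Im z\<bar>"
      using cmod_le[of "Complex (top S t) t - z"] by simp
    then show ?thesis using t d(2)[of t] by simp
  qed
  ultimately show ?thesis by blast
qed

text \<open>Near \<open>z\<close> the graph differs from its tangent line by at most
  \<open>\<bar>Im y - Im z\<bar>\<close>, so it stays above a cone with
  \<open>K = \<bar>slope z\<bar> + 1\<close>. The cone gives room to pass from one column to another
  inside \<open>D\<close>.\<close>

lemma lower_cone:
  assumes "z \<in> N"
  shows "\<exists>K\<ge>0. \<exists>d>0. \<forall>y. \<bar>Im y - Im z\<bar> < d \<and> Re y < Re z - K * \<bar>Im y - Im z\<bar> \<longrightarrow> y \<in> D"
proof -
  obtain d where d: "d > 0" "\<And>y. y \<in> N \<Longrightarrow> cmod (y - z) < d \<Longrightarrow>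
    \<bar>Re y - Re z - slope z * (Im y - Im z)\<bar> \<le> 1 * \<bar>Im y - Im z\<bar>" using N_slope[OF assms zero_less_one] by blast
  obtain d2 where d2: "d2 > 0" "\<And>t. \<bar>t - Im z\<bar> < d2 \<Longrightarrow> A < t \<and> t < B \<and> cmod (Complex (top (Re z + 1) t) t - z) < min d 1"
    using top_near_N[OF assms, of "Re z + 1" "min d 1"] d(1) by auto
  have "y \<in> D" if "\<bar>Im y - Im z\<bar> < d2" "Re y < Re z - (\<bar>slope z\<bar> + 1) * \<bar>Im y - Im z\<bar>" for y
  proof -
    \<comment> \<open>A truncation one unit above \<open>Re z\<close> is not reached near
      \<open>z\<close>, so the truncated top is a genuine point of \<open>N\<close>.\<close>
    define x where "x = top (Re z + 1) (Im y)"
    have t: "A < Im y" "Im y < B" "cmod (Complex x (Im y) - z) < min d 1" using d2(2)[OF that(1)] by (auto simp: x_def)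
    have "\<bar>x - Re z\<bar> < 1" using t(3) abs_Re_le_cmod[of "Complex x (Im y) - z"] by simp
    then have "Complex x (Im y) \<in> N" using top_cases[OF t(1,2), of "Re z + 1"] by (auto simp: x_def)
    define M where "M = slope z * (Im y - Im z)"
    have "\<bar>x - Re z - M\<bar> \<le> \<bar>Im y - Im z\<bar>"
      using d(2)[of "Complex x (Im y)"] t \<open>Complex x (Im y) \<in> N\<close> by (simp add: M_def)
    then have "Re z - \<bar>M\<bar> - \<bar>Im y - Im z\<bar> \<le> x" by linarith
    moreover have "\<bar>M\<bar> = \<bar>slope z\<bar> * \<bar>Im y - Im z\<bar>" by (simp add: M_def abs_mult)
    ultimately have "Re y < x" using that(2) by (simp add: distrib_right)
    then show ?thesis using top_below[OF t(1,2), of "Re y" "Re z + 1"] by (simp add: x_def)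
  qed
  then have "\<forall>y. \<bar>Im y - Im z\<bar> < d2 \<and> Re y < Re z - (\<bar>slope z\<bar> + 1) * \<bar>Im y - Im z\<bar> \<longrightarrow> y \<in> D" by blast
  moreover have "\<bar>slope z\<bar> + 1 \<ge> 0" by simp
  ultimately show ?thesis using d2(1) by blast
qed

end

section \<open>Calculus along lines and first-order expansions at the boundary\<close>

lemma mean_value_bound:
  fixes f :: "real \<Rightarrow> real"
  assumes "a \<le> b" "continuous_on {a..b} f"
    and "\<And>x. a < x \<Longrightarrow> x < b \<Longrightarrow> (f has_real_derivative f' x) (at x)"
    and "\<And>x. a < x \<Longrightarrow> x < b \<Longrightarrow> \<bar>f' x\<bar> \<le> M"
  shows "\<bar>f b - f a\<bar> \<le> M * (b - a)"
proof (cases "a = b")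
  case False
  then have "a < b" using assms by simp
  then obtain x where "a < x" "x < b" "f b - f a = f' x * (b - a)"
    using mvt[of a b f "\<lambda>x h. f' x * h"] assms(2,3) unfolding has_field_derivative_def by auto
  then show ?thesis using assms(4)[of x] \<open>a < b\<close> by (simp add: abs_mult)
qed simp

lemma DERIV_continuous_on_Icc:
  fixes f :: "real \<Rightarrow> real"
  assumes "\<And>x. a \<le> x \<Longrightarrow> x \<le> b \<Longrightarrow> (f has_real_derivative f' x) (at x)"
  shows "continuous_on {a..b} f"
  by (intro continuous_at_imp_continuous_on ballI DERIV_isCont[OF assms]) auto

lemma has_derivative_Re_line:
  assumes "(f has_derivative (\<lambda>h. a * Re h + b * Im h)) (at (Complex s t))"
  shows "((\<lambda>s. f (Complex s t)) has_real_derivative a) (at s)"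
proof -
  have "((\<lambda>s. Complex s t) has_derivative (\<lambda>h. Complex h 0)) (at s)"
    unfolding Complex_eq by (auto intro!: derivative_eq_intros)
  from has_derivative_compose[OF this assms]
  show ?thesis by (simp add: has_field_derivative_def mult.commute[of _ a])
qed

lemma has_derivative_Im_line:
  assumes "(f has_derivative (\<lambda>h. a * Re h + b * Im h)) (at (Complex s t))"
  shows "((\<lambda>t. f (Complex s t)) has_real_derivative b) (at t)"
proof -
  have "((\<lambda>t. Complex s t) has_derivative (\<lambda>h. Complex 0 h)) (at t)"
    unfolding Complex_eq by (auto intro!: derivative_eq_intros)
  from has_derivative_compose[OF this assms]
  show ?thesis by (simp add: has_field_derivative_def mult.commute[of _ b])
qed

context planar_strip
begin

text \<open>The points \<open>z\<close> and \<open>y\<close> are joined inside \<open>D\<close> by going down from \<open>z\<close>, across, and up to \<open>y\<close>.\<close>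

lemma boundary_expansion:
  assumes z: "z \<in> N"
    and der: "\<And>y. y \<in> D \<Longrightarrow> (f has_derivative (\<lambda>h. fs y * Re h + ft y * Im h)) (at y)"
    and cont: "\<And>y. y \<in> N \<Longrightarrow> ((\<lambda>s. f (Complex s (Im y))) \<longlongrightarrow> f y) (at_left (Re y))"
    and lim: "(fs \<longlongrightarrow> a) (at z within D)" "(ft \<longlongrightarrow> b) (at z within D)"
    and e: "e > 0"
  shows "\<exists>d>0. \<forall>y\<in>D \<union> N. cmod (y - z) < d \<longrightarrow>
     \<bar>f y - f z - a * (Re y - Re z) - b * (Im y - Im z)\<bar> \<le> e * cmod (y - z)"
proof -
  obtain K d1 where K: "K \<ge> 0" "d1 > 0"
    "\<And>y. \<bar>Im y - Im z\<bar> < d1 \<Longrightarrow> Re y < Re z - K * \<bar>Im y - Im z\<bar> \<Longrightarrow> y \<in> D"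
    using lower_cone[OF z] by blast
  \<comment> \<open>\<open>2 * K + 5\<close> bounds the length of the path in units of
    \<open>cmod (y - z)\<close>: two columns of length at most \<open>K + 2\<close> each and a row
    of length at most \<open>1\<close>.\<close>
  define e1 where "e1 = e / (2 * K + 5)"
  have e1: "e1 > 0" using e K by (simp add: e1_def)
  have zD: "z \<notin> D" using z DN by blast
  obtain d2 where d2: "d2 > 0" "\<And>y. y \<in> D \<Longrightarrow> cmod (y - z) < d2 \<Longrightarrow> \<bar>fs y - a\<bar> \<le> e1 \<and> \<bar>ft y - b\<bar> \<le> e1"
  proof -
    have "\<forall>\<^sub>F y in at z within D. dist (fs y) a < e1 \<and> dist (ft y) b < e1"
      using lim e1 by (auto simp: tendsto_iff eventually_conj)
    then show thesis using that zD unfolding eventually_at dist_norm real_norm_def by (metis less_imp_le)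
  qed
  define d where "d = min d1 (d2 / (K + 3))"
  have d: "d > 0" using K d2 by (simp add: d_def)
  have column: "\<bar>f y - f (Complex l (Im y)) - a * (Re y - l)\<bar> \<le> e1 * (Re y - l)"
    if y: "y \<in> D \<union> N" and l: "l < Re y" and near: "\<And>x. l < x \<Longrightarrow> x < Re y \<Longrightarrow> cmod (Complex x (Im y) - z) < d2" for y l
  proof -
    define F where "F = (\<lambda>s. f (Complex s (Im y)) - a * s)"
    have inD: "Complex x (Im y) \<in> D" if "x < Re y" for x using down y that by blast
    have dF: "(F has_real_derivative fs (Complex x (Im y)) - a) (at x)" if "Complex x (Im y) \<in> D" for x
      unfolding F_def by (auto intro!: derivative_eq_intros has_derivative_Re_line der that)
    have cy: "(F \<longlongrightarrow> F (Re y)) (at_left (Re y))"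
    proof (cases "y \<in> D")
      case True
      then have "isCont F (Re y)" using dF[of "Re y"] by (simp add: DERIV_isCont)
      then show ?thesis unfolding isCont_def by (rule filterlim_mono) (auto simp: at_within_le_at)
    next
      case False
      then show ?thesis using y unfolding F_def by (auto intro!: tendsto_intros cont)
    qed
    have "continuous_on {l..Re y} F"
    proof (unfold continuous_on_eq_continuous_within, intro ballI)
      fix x assume x: "x \<in> {l..Re y}"
      show "continuous (at x within {l..Re y}) F"
      proof (cases "x = Re y")
        case True
        then show ?thesis using cy l by (simp add: continuous_within at_within_Icc_at_left)
      next
        case False
        then have "isCont F x" using x by (intro DERIV_isCont[OF dF[OF inD]]) auto
        then show ?thesis by (rule continuous_at_imp_continuous_at_within)
      qed
    qed
    then have "\<bar>F (Re y) - F l\<bar> \<le> e1 * (Re y - l)"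
    proof (rule mean_value_bound[rotated])
      show "(F has_real_derivative fs (Complex x (Im y)) - a) (at x)" if "x < Re y" for x using dF[OF inD[OF that]] .
      show "\<bar>fs (Complex x (Im y)) - a\<bar> \<le> e1" if "l < x" "x < Re y" for x
        using d2(2)[OF inD[OF that(2)] near[OF that]] by simp
    qed (use l in simp)
    then show ?thesis by (simp add: F_def algebra_simps)
  qed
  have "\<bar>f y - f z - a * (Re y - Re z) - b * (Im y - Im z)\<bar> \<le> e * cmod (y - z)"
    if y: "y \<in> D \<union> N" "cmod (y - z) < d" for y
  proof (cases "y = z")
    case False
    define r where "r = cmod (y - z)"
    have r: "r > 0" "\<bar>Re y - Re z\<bar> \<le> r" "\<bar>Im y - Im z\<bar> \<le> r" "r < d1"
      using False abs_Re_le_cmod[of "y - z"] abs_Im_le_cmod[of "y - z"] y by (auto simp: r_def d_def)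
    have r2: "(K + 3) * r < d2" using y(2) K by (simp add: r_def d_def field_simps)
    \<comment> \<open>The depth \<open>(K + 1) * r\<close> puts the whole row at
      \<open>Re = l\<close> inside the cone of \<open>lower_cone\<close>.\<close>
    define l where "l = min (Re y) (Re z) - (K + 1) * r"
    have Kr: "K * r \<ge> 0" using K r by simp
    have l: "l < Re y" "l < Re z" "Re z - l \<le> (K + 2) * r" "Re y - l \<le> (K + 2) * r"
      using r Kr by (auto simp: l_def algebra_simps min_def)
    have near: "cmod (Complex x t - z) < d2" if "l \<le> x" "x \<le> max (Re y) (Re z)" "\<bar>t - Im z\<bar> \<le> r" for x t
    proof -
      have "cmod (Complex x t - z) \<le> \<bar>x - Re z\<bar> + \<bar>t - Im z\<bar>" using cmod_le[of "Complex x t - z"] by simp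
      also have "\<bar>x - Re z\<bar> \<le> (K + 2) * r"
        using that l r Kr by (auto simp: abs_le_iff max_def algebra_simps split: if_splits)
      also have "(K + 2) * r + \<bar>t - Im z\<bar> \<le> (K + 3) * r" using that by (simp add: algebra_simps)
      finally show ?thesis using r2 by simp
    qed
    have 1: "\<bar>f z - f (Complex l (Im z)) - a * (Re z - l)\<bar> \<le> e1 * (Re z - l)"
      using z l r by (intro column near) auto
    have 2: "\<bar>f y - f (Complex l (Im y)) - a * (Re y - l)\<bar> \<le> e1 * (Re y - l)"
      using y l r by (intro column near) auto
    define G where "G = (\<lambda>t. f (Complex l t) - b * t)"
    have lD: "Complex l t \<in> D" if "\<bar>t - Im z\<bar> \<le> r" for t
    proof (rule K(3))
      show "\<bar>Im (Complex l t) - Im z\<bar> < d1" using that r by simp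
      have "K * \<bar>t - Im z\<bar> \<le> K * r" using K that by (intro mult_left_mono) auto
      then show "Re (Complex l t) < Re z - K * \<bar>Im (Complex l t) - Im z\<bar>"
        using r by (simp add: l_def algebra_simps min_def)
    qed
    have dG: "(G has_real_derivative ft (Complex l t) - b) (at t)" if "\<bar>t - Im z\<bar> \<le> r" for t
      unfolding G_def by (auto intro!: derivative_eq_intros has_derivative_Im_line der lD that)
    have G: "\<bar>G v - G u\<bar> \<le> e1 * (v - u)" if "u \<le> v" "\<bar>u - Im z\<bar> \<le> r" "\<bar>v - Im z\<bar> \<le> r" for u v
    proof (rule mean_value_bound[OF that(1)])
      have *: "\<bar>x - Im z\<bar> \<le> r" if "u \<le> x" "x \<le> v" for x using that \<open>\<bar>u - Im z\<bar> \<le> r\<close> \<open>\<bar>v - Im z\<bar> \<le> r\<close> by linarith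
      show "continuous_on {u..v} G" by (rule DERIV_continuous_on_Icc, rule dG, rule *)
      show "(G has_real_derivative ft (Complex l x) - b) (at x)" if "u < x" "x < v" for x using dG * that by auto
      show "\<bar>ft (Complex l x) - b\<bar> \<le> e1" if "u < x" "x < v" for x
        using d2(2)[OF lD near] * that l by auto
    qed
    have 3: "\<bar>G (Im y) - G (Im z)\<bar> \<le> e1 * \<bar>Im y - Im z\<bar>"
      using G[of "Im y" "Im z"] G[of "Im z" "Im y"] r by (cases "Im y \<le> Im z") (auto simp: abs_minus_commute)
    have "f y - f z - a * (Re y - Re z) - b * (Im y - Im z) =
      (f y - f (Complex l (Im y)) - a * (Re y - l)) - (f z - f (Complex l (Im z)) - a * (Re z - l)) + (G (Im y) - G (Im z))"
      by (simp add: G_def algebra_simps)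
    also have "\<bar>\<dots>\<bar> \<le> e1 * (Re y - l) + e1 * (Re z - l) + e1 * \<bar>Im y - Im z\<bar>" using 1 2 3 by linarith
    also have "\<dots> = e1 * ((Re y - l) + (Re z - l) + \<bar>Im y - Im z\<bar>)" by (simp add: algebra_simps)
    also have "\<dots> \<le> e1 * ((2 * K + 5) * r)"
      using e1 l r by (intro mult_left_mono) (auto simp: algebra_simps)
    also have "\<dots> = e * r" using K by (simp add: e1_def)
    finally show ?thesis by (simp add: r_def)
  qed simp
  then show ?thesis using d by blast
qed

end

text \<open>The last point up to which the estimate with \<open>m + e\<close> holds can always be
  pushed further. A bound on right quotients is what the application offers: there the graph may
  enter and leave the truncation level.\<close>

lemma monotone_of_lower_quotient:
  fixes g :: "real \<Rightarrow> real"
  assumes "u \<le> v"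
    and cont: "\<And>t. u \<le> t \<Longrightarrow> t \<le> v \<Longrightarrow> isCont g t"
    and q: "\<And>t e. u \<le> t \<Longrightarrow> t < v \<Longrightarrow> e > 0 \<Longrightarrow> \<exists>d>0. \<forall>x. t < x \<and> x < t + d \<longrightarrow> g x - g t \<ge> - (m + e) * (x - t)"
  shows "g v - g u \<ge> - m * (v - u)"
proof -
  have main: "g v - g u \<ge> - (m + e) * (v - u)" if e: "e > 0" for e
  proof -
    define X where "X = {t. u \<le> t \<and> t \<le> v \<and> g t - g u \<ge> - (m + e) * (t - u)}"
    have X: "u \<in> X" "bdd_above X" using assms(1) by (auto simp: X_def bdd_above_def)
    define s where "s = Sup X"
    have s: "u \<le> s" "s \<le> v" unfolding s_def using X
      by (auto intro!: cSup_upper cSup_least simp: X_def)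
    have "closed X"
    proof -
      have "X = {u..v} \<inter> {t \<in> {u..v}. - (m + e) * (t - u) \<le> g t - g u}" by (auto simp: X_def)
      moreover have "closed {t \<in> {u..v}. - (m + e) * (t - u) \<le> g t - g u}"
        using cont by (intro continuous_closed_preimage_constant continuous_on_closed_Collect_le continuous_intros continuous_at_imp_continuous_on) auto
      ultimately show ?thesis by auto
    qed
    then have sX: "s \<in> X" unfolding s_def using X by (intro closed_contains_Sup) auto
    have "s = v"
    proof (rule ccontr)
      assume "s \<noteq> v"
      then have sv: "s < v" using s by simp
      obtain d where d: "d > 0" "\<And>x. s < x \<Longrightarrow> x < s + d \<Longrightarrow> g x - g s \<ge> - (m + e) * (x - s)"
        using q[OF s(1) sv e] by blast
      define x where "x = min v (s + d/2)"
      have x: "s < x" "x < s + d" "x \<le> v" using d(1) sv by (auto simp: x_def)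
      have "g x - g u \<ge> - (m + e) * (x - s) + - (m + e) * (s - u)" using d(2)[OF x(1,2)] sX by (simp add: X_def)
      then have "x \<in> X" using x s by (simp add: X_def algebra_simps)
      then have "x \<le> s" unfolding s_def using X by (intro cSup_upper)
      then show False using x by simp
    qed
    then show ?thesis using sX by (simp add: X_def)
  qed
  show ?thesis
  proof (rule field_le_epsilon)
    fix e :: real assume e: "e > 0"
    define k where "k = e / (v - u + 1)"
    have k: "k > 0" "k * (v - u) \<le> e" using e assms(1) by (auto simp: k_def field_simps)
    then show "- m * (v - u) \<le> g v - g u + e" using main[of k] by (simp add: algebra_simps)
  qed
qed

lemma second_derivative_local_max:
  fixes f :: "real \<Rightarrow> real"
  assumes "d > 0" and "\<And>y. \<bar>y - x\<bar> < d \<Longrightarrow> (f has_real_derivative f' y) (at y)"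
    and "(f' has_real_derivative m) (at x)" and "\<And>y. \<bar>y - x\<bar> < d \<Longrightarrow> f y \<le> f x"
  shows "m \<le> 0"
proof (rule ccontr)
  assume "\<not> m \<le> 0"
  then have m: "m > 0" by simp
  have "f' x = 0" by (rule DERIV_local_max[OF assms(2)[of x] assms(1)]) (use assms in \<open>auto simp: abs_minus_commute\<close>)
  obtain e where e: "e > 0" "\<And>h. h > 0 \<Longrightarrow> h < e \<Longrightarrow> f' x < f' (x + h)"
    using DERIV_pos_inc_right[OF assms(3) m] by blast
  define h where "h = min e d / 2"
  have h: "h > 0" "h < e" "h < d" using e assms(1) by (auto simp: h_def)
  have "f x < f (x + h)"
  proof (rule DERIV_pos_imp_increasing_open[of x "x + h" f])
    show "x < x + h" using h by simp
    show "\<exists>y. (f has_real_derivative y) (at z) \<and> 0 < y" if "x < z" "z < x + h" for z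
      using assms(2)[of z] e(2)[of "z - x"] that h \<open>f' x = 0\<close> by auto
    show "continuous_on {x..x + h} f"
      by (rule DERIV_continuous_on_Icc[of _ _ _ f'], rule assms(2)) (use h in auto)
  qed
  then show False using assms(4)[of "x + h"] h by simp
qed

lemma no_interior_max_of_pos_laplacian:
  assumes "d > 0" 
    and d1: "\<And>y. cmod (y - z) < d \<Longrightarrow> (f has_derivative (\<lambda>h. fs y * Re h + ft y * Im h)) (at y)"
    and d2: "(fs has_derivative (\<lambda>h. f11 * Re h + f12 * Im h)) (at z)"
      "(ft has_derivative (\<lambda>h. f21 * Re h + f22 * Im h)) (at z)"
    and max: "\<And>y. cmod (y - z) < d \<Longrightarrow> f y \<le> f z"
  shows "f11 + f22 \<le> 0"
proof -
  have n: "cmod (Complex s (Im z) - z) = \<bar>s - Re z\<bar>" "cmod (Complex (Re z) t - z) = \<bar>t - Im z\<bar>" for s t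
    by (simp_all add: cmod_def)
  have s1: "((\<lambda>s. f (Complex s (Im z))) has_real_derivative fs (Complex x (Im z))) (at x)" if "\<bar>x - Re z\<bar> < d" for x
    by (rule has_derivative_Re_line[OF d1]) (use that n in simp)
  have t1: "((\<lambda>t. f (Complex (Re z) t)) has_real_derivative ft (Complex (Re z) x)) (at x)" if "\<bar>x - Im z\<bar> < d" for x
    by (rule has_derivative_Im_line[OF d1]) (use that n in simp)
  have "f11 \<le> 0"
    by (rule second_derivative_local_max[OF assms(1) s1 has_derivative_Re_line]) (use d2(1) max n in auto)
  moreover have "f22 \<le> 0"
    by (rule second_derivative_local_max[OF assms(1) t1 has_derivative_Im_line]) (use d2(2) max n in auto)
  ultimately show ?thesis by simp
qed

section \<open>Mixed partial derivatives and closed forms\<close>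

text \<open>The second difference over a small square, evaluated by the mean value theorem in both
  orders, gives the two mixed partials a common value near \<open>z\<close>. It is applied in the
  chart, where the matrix \<open>D2u\<close> is not known to be symmetric beforehand.\<close>

lemma mixed_partials_eq:
  fixes f :: "complex \<Rightarrow> real"
  assumes S: "open S" "z \<in> S"
    and d: "\<And>y. y \<in> S \<Longrightarrow> (f has_derivative (\<lambda>h. f1 y * Re h + f2 y * Im h)) (at y)"
    and d1: "\<And>y. y \<in> S \<Longrightarrow> (f1 has_derivative (\<lambda>h. f11 y * Re h + f12 y * Im h)) (at y)"
    and d2: "\<And>y. y \<in> S \<Longrightarrow> (f2 has_derivative (\<lambda>h. f21 y * Re h + f22 y * Im h)) (at y)"
    and c: "continuous (at z) f12" "continuous (at z) f21"
  shows "f12 z = f21 z"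
proof (rule ccontr)
  assume ne: "f12 z \<noteq> f21 z"
  define e where "e = \<bar>f12 z - f21 z\<bar> / 2"
  have e: "e > 0" using ne by (simp add: e_def)
  obtain r where r: "r > 0" "\<And>y. cmod (y - z) < r \<Longrightarrow> y \<in> S"
    using S unfolding open_dist dist_norm by metis
  obtain r1 where r1: "r1 > 0" "\<And>y. cmod (y - z) < r1 \<Longrightarrow> \<bar>f12 y - f12 z\<bar> < e"
    using c(1) e unfolding continuous_at_eps_delta dist_norm real_norm_def by metis
  obtain r2 where r2: "r2 > 0" "\<And>y. cmod (y - z) < r2 \<Longrightarrow> \<bar>f21 y - f21 z\<bar> < e"
    using c(2) e unfolding continuous_at_eps_delta dist_norm real_norm_def by metis
  define h where "h = Min {r, r1, r2} / 3"
  have h: "h > 0" "3 * h \<le> r" "3 * h \<le> r1" "3 * h \<le> r2" using r r1 r2 by (auto simp: h_def)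
  define s t where "s = Re z" and "t = Im z"
  have near: "cmod (Complex x y - z) < 3 * h" if "s \<le> x" "x \<le> s + h" "t \<le> y" "y \<le> t + h" for x y
    using cmod_le[of "Complex x y - z"] that h(1) unfolding s_def t_def by simp
  have inS: "Complex x y \<in> S" if "s \<le> x" "x \<le> s + h" "t \<le> y" "y \<le> t + h" for x y
    using near[OF that] r(2) h by simp
  have "\<exists>x>s. x < s + h \<and> (f (Complex (s + h) (t + h)) - f (Complex (s + h) t)) - (f (Complex s (t + h)) - f (Complex s t))
      = (s + h - s) * (f1 (Complex x (t + h)) - f1 (Complex x t))"
    by (rule MVT2) (use h inS in \<open>auto intro!: derivative_eq_intros has_derivative_Re_line[OF d]\<close>)
  then obtain x where x: "s < x" "x < s + h"
    "(f (Complex (s + h) (t + h)) - f (Complex (s + h) t)) - (f (Complex s (t + h)) - f (Complex s t))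
      = h * (f1 (Complex x (t + h)) - f1 (Complex x t))" by auto
  have "\<exists>y>t. y < t + h \<and> f1 (Complex x (t + h)) - f1 (Complex x t) = (t + h - t) * f12 (Complex x y)"
    by (rule MVT2) (use h inS x in \<open>auto intro!: has_derivative_Im_line[OF d1]\<close>)
  then obtain y where y: "t < y" "y < t + h" "f1 (Complex x (t + h)) - f1 (Complex x t) = h * f12 (Complex x y)" by auto
  have "\<exists>y>t. y < t + h \<and> (f (Complex (s + h) (t + h)) - f (Complex s (t + h))) - (f (Complex (s + h) t) - f (Complex s t))
      = (t + h - t) * (f2 (Complex (s + h) y) - f2 (Complex s y))"
    by (rule MVT2) (use h inS in \<open>auto intro!: derivative_eq_intros has_derivative_Im_line[OF d]\<close>)
  then obtain y' where y': "t < y'" "y' < t + h"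
    "(f (Complex (s + h) (t + h)) - f (Complex s (t + h))) - (f (Complex (s + h) t) - f (Complex s t))
      = h * (f2 (Complex (s + h) y') - f2 (Complex s y'))" by auto
  have "\<exists>x>s. x < s + h \<and> f2 (Complex (s + h) y') - f2 (Complex s y') = (s + h - s) * f21 (Complex x y')"
    by (rule MVT2) (use h inS y' in \<open>auto intro!: has_derivative_Re_line[OF d2]\<close>)
  then obtain x' where x': "s < x'" "x' < s + h" "f2 (Complex (s + h) y') - f2 (Complex s y') = h * f21 (Complex x' y')" by auto
  have "h * (h * f12 (Complex x y)) = h * (h * f21 (Complex x' y'))"
    using x(3) y(3) y'(3) x'(3) by (simp add: algebra_simps)
  then have eq: "f12 (Complex x y) = f21 (Complex x' y')" using h by simp
  have "\<bar>f12 (Complex x y) - f12 z\<bar> < e" using r1(2) near[of x y] h x y by auto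
  moreover have "\<bar>f21 (Complex x' y') - f21 z\<bar> < e" using r2(2) near[of x' y'] h x' y' by auto
  ultimately show False using eq unfolding e_def by (simp add: abs_if split: if_splits)
qed

text \<open>The increment is split into a step in \<open>Im\<close> at abscissa \<open>Re y\<close>,
  controlled by continuity of \<open>n\<close>, and a step in \<open>Re\<close> at ordinate
  \<open>Im z\<close>, where differentiability at one point is enough. This fits a primitive
  obtained by integrating in \<open>Re\<close>.\<close>

lemma has_derivative_of_partials:
  fixes f :: "complex \<Rightarrow> real"
  assumes S: "open S" "z \<in> S"
    and d1: "((\<lambda>s. f (Complex s (Im z))) has_real_derivative m) (at (Re z))"
    and d2: "\<And>y. y \<in> S \<Longrightarrow> ((\<lambda>t. f (Complex (Re y) t)) has_real_derivative n y) (at (Im y))"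
    and c: "continuous (at z) n"
  shows "(f has_derivative (\<lambda>h. m * Re h + n z * Im h)) (at z)"
proof (unfold has_derivative_at_alt, intro conjI allI impI)
  show "bounded_linear (\<lambda>h. m * Re h + n z * Im h)"
    by (auto intro!: bounded_linear_intros bounded_linear_Re bounded_linear_Im)
  fix e :: real assume e: "e > 0"
  obtain r where r: "r > 0" "\<And>y. cmod (y - z) < r \<Longrightarrow> y \<in> S"
    using S unfolding open_dist dist_norm by metis
  obtain r1 where r1: "r1 > 0" "\<And>y. cmod (y - z) < r1 \<Longrightarrow> \<bar>n y - n z\<bar> < e/2"
    using c e unfolding continuous_at_eps_delta dist_norm real_norm_def by (metis half_gt_zero)
  have "((\<lambda>s. f (Complex s (Im z))) has_derivative (\<lambda>h. m * h)) (at (Re z))"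
    using d1 by (simp add: has_field_derivative_def)
  then obtain r2 where r2: "r2 > 0" "\<And>x. \<bar>x - Re z\<bar> < r2 \<Longrightarrow>
      \<bar>f (Complex x (Im z)) - f (Complex (Re z) (Im z)) - m * (x - Re z)\<bar> \<le> e/2 * \<bar>x - Re z\<bar>"
    using e unfolding has_derivative_at_alt real_norm_def by (metis half_gt_zero)
  define d where "d = Min {r, r1, r2}"
  have "d > 0" using r r1 r2 by (auto simp: d_def)
  moreover have "norm (f y - f z - (m * Re (y - z) + n z * Im (y - z))) \<le> e * norm (y - z)" if y: "norm (y - z) < d" for y
  proof -
    have yd: "cmod (y - z) < r" "cmod (y - z) < r1" "\<bar>Re y - Re z\<bar> < r2"
      using y abs_Re_le_cmod[of "y - z"] by (auto simp: d_def)
    define F where "F = (\<lambda>t. f (Complex (Re y) t) - n z * t)"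
    have near: "cmod (Complex (Re y) t - z) \<le> cmod (y - z)" if "\<bar>t - Im z\<bar> \<le> \<bar>Im y - Im z\<bar>" for t
      unfolding cmod_def using that by (auto intro!: real_sqrt_le_mono simp: abs_le_square_iff)
    have dF: "(F has_real_derivative n (Complex (Re y) t) - n z) (at t)" if "\<bar>t - Im z\<bar> \<le> \<bar>Im y - Im z\<bar>" for t
    proof -
      have "Complex (Re y) t \<in> S" using near[OF that] yd r(2) by simp
      from d2[OF this] show ?thesis unfolding F_def by (auto intro!: derivative_eq_intros)
    qed
    have bd: "\<bar>F v - F u\<bar> \<le> e/2 * (v - u)" if "u \<le> v" "\<And>t. u \<le> t \<Longrightarrow> t \<le> v \<Longrightarrow> \<bar>t - Im z\<bar> \<le> \<bar>Im y - Im z\<bar>" for u v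
    proof (rule mean_value_bound[OF that(1)])
      show "continuous_on {u..v} F" by (rule DERIV_continuous_on_Icc, rule dF, rule that(2))
      show "(F has_real_derivative n (Complex (Re y) x) - n z) (at x)" if "u < x" "x < v" for x using dF that \<open>\<And>t. u \<le> t \<Longrightarrow> t \<le> v \<Longrightarrow> _\<close> by auto
      show "\<bar>n (Complex (Re y) x) - n z\<bar> \<le> e/2" if "u < x" "x < v" for x
        using r1(2)[of "Complex (Re y) x"] near[of x] yd that \<open>\<And>t. u \<le> t \<Longrightarrow> t \<le> v \<Longrightarrow> _\<close> by fastforce
    qed
    have 1: "\<bar>F (Im y) - F (Im z)\<bar> \<le> e/2 * \<bar>Im y - Im z\<bar>"
    proof (cases "Im z \<le> Im y")
      case True then show ?thesis using bd[of "Im z" "Im y"] by auto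
    next
      case False
      then have "\<bar>F (Im z) - F (Im y)\<bar> \<le> e/2 * (Im z - Im y)" by (intro bd) auto
      then show ?thesis using False by (simp add: abs_minus_commute)
    qed
    have 2: "\<bar>f (Complex (Re y) (Im z)) - f z - m * (Re y - Re z)\<bar> \<le> e/2 * \<bar>Re y - Re z\<bar>"
      using r2(2)[OF yd(3)] by simp
    have "f y - f z - (m * Re (y - z) + n z * Im (y - z)) =
      (F (Im y) - F (Im z)) + (f (Complex (Re y) (Im z)) - f z - m * (Re y - Re z))"
      by (simp add: F_def algebra_simps)
    also have "norm \<dots> \<le> e/2 * \<bar>Im y - Im z\<bar> + e/2 * \<bar>Re y - Re z\<bar>"
      unfolding real_norm_def using 1 2 by (rule order.trans[OF abs_triangle_ineq add_mono])
    also have "\<dots> \<le> e/2 * cmod (y - z) + e/2 * cmod (y - z)"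
      using e abs_Re_le_cmod[of "y - z"] abs_Im_le_cmod[of "y - z"] by (intro add_mono mult_left_mono) auto
    finally show ?thesis by simp
  qed
  ultimately show "\<exists>d>0. \<forall>y. norm (y - z) < d \<longrightarrow> norm (f y - f z - (m * Re (y - z) + n z * Im (y - z))) \<le> e * norm (y - z)" by blast
qed

text \<open>The oriented integral: the base abscissa of the primitive below may lie on either side
  of the point.\<close>

definition oint :: "real \<Rightarrow> real \<Rightarrow> (real \<Rightarrow> real) \<Rightarrow> real" where
  "oint a b f = (if a \<le> b then integral {a..b} f else - integral {b..a} f)"

lemma oint_eq:
  assumes "l \<le> a" "l \<le> b" "continuous_on {l..max a b} f"
  shows "oint a b f = integral {l..b} f - integral {l..a} f"
proof -
  have i: "f integrable_on {l..x}" if "x \<le> max a b" for x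
    using that assms(3) by (intro integrable_continuous_real continuous_on_subset[OF assms(3)]) auto
  have "integral {l..a} f + integral {a..b} f = integral {l..b} f" if "a \<le> b"
    using that assms i by (intro Henstock_Kurzweil_Integration.integral_combine) auto
  moreover have "integral {l..b} f + integral {b..a} f = integral {l..a} f" if "b \<le> a"
    using that assms i by (intro Henstock_Kurzweil_Integration.integral_combine) auto
  ultimately show ?thesis unfolding oint_def by auto
qed

context planar_strip
begin

text \<open>The common coefficient \<open>m2\<close> expresses closedness. The primitive is
  integrated along the line \<open>Re = s1\<close>, which lies in \<open>D\<close> across the whole
  strip, and then along the column, which stays in \<open>D\<close> by
  \<open>D_down\<close>.\<close>

lemma closed_form_primitive:
  fixes m n :: "complex \<Rightarrow> real"
  assumes dm: "\<And>z. z \<in> D \<Longrightarrow> (m has_derivative (\<lambda>h. m1 z * Re h + m2 z * Im h)) (at z)"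
    and dn: "\<And>z. z \<in> D \<Longrightarrow> (n has_derivative (\<lambda>h. m2 z * Re h + n2 z * Im h)) (at z)"
    and c: "continuous_on D m2"
  shows "\<exists>k. \<forall>z\<in>D. (k has_derivative (\<lambda>h. m z * Re h + n z * Im h)) (at z)"
proof -
  define s1 where "s1 = L - 1"
  have s1: "Complex s t \<in> D" if "A < t" "t < B" "s \<le> s1" for s t using that D_low by (simp add: s1_def)
  have cm: "continuous_on D m" and cn: "continuous_on D n"
    using dm dn by (auto intro!: continuous_at_imp_continuous_on has_derivative_continuous)
  have comp: "continuous_on X (\<lambda>x. g (Complex (a x) (b x)))"
    if "continuous_on D g" "continuous_on X a" "continuous_on X b" "\<And>x. x \<in> X \<Longrightarrow> Complex (a x) (b x) \<in> D"
    for X :: "'b::topological_space set" and g :: "complex \<Rightarrow> real" and a b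
    by (rule continuous_on_compose2[OF that(1)]) (use that in \<open>auto intro!: continuous_on_Complex\<close>)
  have "\<exists>F. \<forall>x::real. ereal A < ereal x \<longrightarrow> ereal x < ereal B \<longrightarrow> (F has_vector_derivative n (Complex s1 x)) (at x)"
  proof (rule einterval_antiderivative)
    show "ereal A < ereal B" using AB by simp
    fix x assume x: "ereal A < ereal x" "ereal x < ereal B"
    have "continuous_on {A<..<B} (\<lambda>x. n (Complex s1 x))"
      by (rule comp[OF cn]) (use s1 in auto)
    then show "isCont (\<lambda>x. n (Complex s1 x)) x" using x
      unfolding continuous_on_eq_continuous_at[OF open_greaterThanLessThan] by simp
  qed
  then obtain F where F: "\<And>x. A < x \<Longrightarrow> x < B \<Longrightarrow> (F has_real_derivative n (Complex s1 x)) (at x)"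
    by (auto simp: has_real_derivative_iff_has_vector_derivative)
  define k where "k = (\<lambda>z. oint s1 (Re z) (\<lambda>s. m (Complex s (Im z))) + F (Im z))"
  have col: "continuous_on {l..u} (\<lambda>s. m (Complex s t))" if "Complex u t \<in> D" for l u t
  proof (rule comp[OF cm])
    show "Complex x t \<in> D" if "x \<in> {l..u}" for x
      using D_down[OF \<open>Complex u t \<in> D\<close>, of x] that \<open>Complex u t \<in> D\<close> by (cases "x = u") auto
  qed auto
  \<comment> \<open>Differentiation under the integral sign turns \<open>m\<close> into
    \<open>m2\<close>, which by closedness is the \<open>Re\<close>-derivative of \<open>n\<close>;
    so only end values of \<open>n\<close> remain.\<close>
  have P2: "((\<lambda>t. integral {l..s} (\<lambda>x. m (Complex x t))) has_real_derivative n (Complex s t) - n (Complex l t)) (at t)"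
    if st: "Complex s t \<in> D" "l \<le> s" for l s t
  proof -
    obtain d where d: "d > 0" "\<And>y. cmod (y - Complex s t) < d \<Longrightarrow> y \<in> D" using D_near[OF st(1)] by metis
    define U where "U = {t - d<..<t + d}"
    have U: "Complex x y \<in> D" if "x \<in> {l..s}" "y \<in> U" for x y
    proof -
      have "Complex s y \<in> D" by (rule d(2)) (use that in \<open>auto simp: cmod_Complex_same_Re U_def abs_less_iff\<close>)
      then show ?thesis using D_down[of s y x] that by (cases "x = s") auto
    qed
    have "((\<lambda>t. integral (cbox l s) (\<lambda>x. m (Complex x t))) has_field_derivative integral (cbox l s) (\<lambda>x. m2 (Complex x t))) (at t within U)"
    proof (rule leibniz_rule_field_derivative[where f = "\<lambda>t x. m (Complex x t)" and fx = "\<lambda>t x. m2 (Complex x t)" and U = U and a = l and b = s and ?x0.0 = t])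
      show "((\<lambda>t. m (Complex x t)) has_real_derivative m2 (Complex x y)) (at y within U)" if "y \<in> U" "x \<in> cbox l s" for x y
        by (rule has_field_derivative_at_within, rule has_derivative_Im_line[OF dm], rule U) (use that in auto)
      show "(\<lambda>x. m (Complex x y)) integrable_on cbox l s" if "y \<in> U" for y
        unfolding cbox_interval by (rule integrable_continuous_real, rule comp[OF cm]) (use that U in auto)
      show "continuous_on (U \<times> cbox l s) (\<lambda>(t, x). m2 (Complex x t))"
        unfolding case_prod_beta by (rule comp[OF c]) (use U in \<open>auto intro!: continuous_intros\<close>)
      show "t \<in> U" "convex U" using d by (auto simp: U_def)
    qed
    moreover have "((\<lambda>x. m2 (Complex x t)) has_integral n (Complex s t) - n (Complex l t)) {l..s}"
    proof (rule fundamental_theorem_of_calculus[OF st(2)])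
      fix x assume x: "x \<in> {l..s}"
      have "Complex x t \<in> D" using U[OF x] d(1) by (simp add: U_def)
      from has_derivative_Re_line[OF dn[OF this]]
      show "((\<lambda>x. n (Complex x t)) has_vector_derivative m2 (Complex x t)) (at x within {l..s})"
        unfolding has_real_derivative_iff_has_vector_derivative[symmetric] by (rule has_field_derivative_at_within)
    qed
    moreover have "at t within U = at t" using d by (intro at_within_open) (auto simp: U_def)
    ultimately show ?thesis by (simp add: integral_unique)
  qed
  have "(k has_derivative (\<lambda>h. m z * Re h + n z * Im h)) (at z)" if z: "z \<in> D" for z
  proof (rule has_derivative_of_partials[OF D_open z])
    show "continuous (at z) n" using dn[OF z] by (rule has_derivative_continuous)
    show "((\<lambda>s. k (Complex s (Im z))) has_real_derivative m z) (at (Re z))"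
    proof -
      obtain d where d: "d > 0" "\<And>y. cmod (y - z) < d \<Longrightarrow> y \<in> D" using D_near[OF z] by metis
      define u where "u = Re z + d/2"
      \<comment> \<open>Starting all integrals at \<open>l\<close>, to the left of both
        \<open>s1\<close> and \<open>Re z\<close>, removes the two orientations of
        \<open>oint\<close>.\<close>
      define l where "l = min s1 (Re z - 1)"
      have u: "Complex u (Im z) \<in> D" by (rule d(2)) (use d in \<open>simp add: u_def cmod_def\<close>)
      have c: "continuous_on {l..u} (\<lambda>s. m (Complex s (Im z)))" by (rule col[OF u])
      have "((\<lambda>s. integral {l..s} (\<lambda>s. m (Complex s (Im z)))) has_real_derivative m (Complex (Re z) (Im z))) (at (Re z) within {l..u})"
        using c d by (intro integral_has_real_derivative) (auto simp: l_def u_def)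
      then have "((\<lambda>s. integral {l..s} (\<lambda>s. m (Complex s (Im z)))) has_real_derivative m z) (at (Re z))"
        using d by (subst (asm) at_within_interior) (auto simp: l_def u_def)
      then have "((\<lambda>s. integral {l..s} (\<lambda>s. m (Complex s (Im z))) - integral {l..s1} (\<lambda>s. m (Complex s (Im z))) + F (Im z)) has_real_derivative m z) (at (Re z))"
        by (auto intro!: derivative_eq_intros)
      moreover have "\<forall>\<^sub>F s in nhds (Re z). integral {l..s} (\<lambda>s. m (Complex s (Im z))) - integral {l..s1} (\<lambda>s. m (Complex s (Im z))) + F (Im z) = k (Complex s (Im z))"
      proof -
        have "\<forall>\<^sub>F s in nhds (Re z). s \<in> {l<..<u}" using d by (intro eventually_nhds_in_open) (auto simp: l_def u_def)
        then show ?thesis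
        proof eventually_elim
          case (elim s)
          have "continuous_on {l..max s1 s} (\<lambda>s. m (Complex s (Im z)))"
            using elim u s1[of "Im z" s1] D_strip[OF z] D_down[OF u, of s] by (intro col) (auto simp: max_def)
          moreover have "l \<le> s1" "l \<le> s" using elim by (auto simp: l_def)
          ultimately have "oint s1 s (\<lambda>s. m (Complex s (Im z))) = integral {l..s} (\<lambda>s. m (Complex s (Im z))) - integral {l..s1} (\<lambda>s. m (Complex s (Im z)))"
            by (intro oint_eq)
          then show ?case by (simp add: k_def)
        qed
      qed
      ultimately show ?thesis by (rule DERIV_cong_ev[OF refl _ refl, THEN iffD1, rotated])
    qed
    show "((\<lambda>t. k (Complex (Re y) t)) has_real_derivative n y) (at (Im y))" if y: "y \<in> D" for y
    proof -
      define l where "l = min s1 (Re y)"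
      have st: "A < Im y" "Im y < B" using D_strip y by auto
      have lD: "l \<le> Re y" "l \<le> s1" by (auto simp: l_def)
      have yD: "Complex (Re y) (Im y) \<in> D" using y by simp
      have "((\<lambda>t. integral {l..Re y} (\<lambda>x. m (Complex x t)) - integral {l..s1} (\<lambda>x. m (Complex x t)) + F t) has_real_derivative
         (n (Complex (Re y) (Im y)) - n (Complex l (Im y))) - (n (Complex s1 (Im y)) - n (Complex l (Im y))) + n (Complex s1 (Im y))) (at (Im y))"
        by (rule DERIV_add[OF DERIV_diff[OF P2[OF yD lD(1)] P2[OF s1[OF st order_refl] lD(2)]] F[OF st]])
      then have "((\<lambda>t. integral {l..Re y} (\<lambda>x. m (Complex x t)) - integral {l..s1} (\<lambda>x. m (Complex x t)) + F t) has_real_derivative n y) (at (Im y))"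
        by simp
      moreover have "\<forall>\<^sub>F t in nhds (Im y). integral {l..Re y} (\<lambda>x. m (Complex x t)) - integral {l..s1} (\<lambda>x. m (Complex x t)) + F t = k (Complex (Re y) t)"
      proof -
        obtain d where d: "d > 0" "\<And>x. cmod (x - y) < d \<Longrightarrow> x \<in> D" using D_near[OF y] by metis
        have "\<forall>\<^sub>F t in nhds (Im y). t \<in> {Im y - d<..<Im y + d} \<inter> {A<..<B}" using d st by (intro eventually_nhds_in_open) auto
        then show ?thesis
        proof eventually_elim
          case (elim t)
          have "Complex (Re y) t \<in> D" by (rule d(2)) (use elim in \<open>auto simp: cmod_def\<close>)
          moreover have "A < t" "t < B" using elim by auto
          ultimately have "continuous_on {l..max s1 (Re y)} (\<lambda>s. m (Complex s t))"
            using s1[of t s1] by (intro col) (auto simp: max_def)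
          from oint_eq[OF lD(2,1) this] show ?case by (simp add: k_def)
        qed
      qed
      ultimately show ?thesis by (rule DERIV_cong_ev[OF refl _ refl, THEN iffD1, rotated])
    qed
  qed
  then show ?thesis by blast
qed

end

section \<open>The overdetermined problem in conformal coordinates\<close>

text \<open>With \<open>s = log tan(r/2)\<close> one has \<open>sin r = sech s\<close> and
  \<open>cos r = - tanh s\<close>.\<close>

definition sech :: "real \<Rightarrow> real" where "sech s = 1 / cosh s"

lemma sech_pos [simp]: "sech s > 0" by (simp add: sech_def)

lemma sech_nonzero [simp]: "sech s \<noteq> 0" using sech_pos[of s] by linarith

lemma cosh_sech: "(cosh s)^2 * (sech s)^2 = 1" "cosh s * sech s = 1"
  by (simp_all add: sech_def power_divide)

lemma sech_sq: "(sech s)^2 = 1 - (tanh s)^2"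
proof -
  have "1 - (tanh s)^2 = ((cosh s)^2 - (sinh s)^2) / (cosh s)^2"
    by (simp add: tanh_def power_divide diff_divide_distrib)
  then show ?thesis by (simp add: sech_def power_divide hyperbolic_pythagoras)
qed

lemma DERIV_sech [THEN DERIV_chain2, derivative_intros]:
  "(sech has_real_derivative - (sech s * tanh s)) (at s within X)"
  unfolding sech_def[abs_def] by (auto intro!: derivative_eq_intros simp: tanh_def power2_eq_square)

lemma continuous_on_sech [continuous_intros]:
  "continuous_on X f \<Longrightarrow> continuous_on X (\<lambda>x. sech (f x))"
  unfolding sech_def by (intro continuous_intros) auto

lemma has_derivative_sech_sq:
  "((\<lambda>z. (sech (Re z))^2) has_derivative (\<lambda>h. - 2 * (sech (Re z))^2 * tanh (Re z) * Re h)) (at z)"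
  by (rule DERIV_compose_FDERIV[of "\<lambda>s. (sech s)^2", THEN has_derivative_eq_rhs])
    (auto intro!: derivative_eq_intros has_derivative_Re has_derivative_ident simp: power2_eq_square)

lemma has_derivative_tanh_Re:
  "((\<lambda>z. tanh (Re z)) has_derivative (\<lambda>h. (sech (Re z))^2 * Re h)) (at z)"
  by (rule DERIV_compose_FDERIV[of tanh, THEN has_derivative_eq_rhs])
    (auto intro!: derivative_eq_intros has_derivative_Re has_derivative_ident simp: sech_sq)

lemma has_derivative_cosh_sq:
  "((\<lambda>z. (cosh (Re z))^2) has_derivative (\<lambda>h. 2 * (cosh (Re z))^2 * tanh (Re z) * Re h)) (at z)"
  by (rule DERIV_compose_FDERIV[of "\<lambda>s::real. (cosh s)^2", THEN has_derivative_eq_rhs])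
    (auto intro!: derivative_eq_intros has_derivative_Re has_derivative_ident simp: power2_eq_square tanh_def)

context planar_strip
begin

lemma N_line_approach:
  assumes "z \<in> D \<union> N" "continuous_on (closure D) f"
  shows "((\<lambda>s. f (Complex s (Im z))) \<longlongrightarrow> f z) (at_left (Re z))"
proof -
  have z: "z \<in> closure D" using assms(1) N_closure closure_subset by blast
  have t: "((\<lambda>s. Complex s (Im z)) \<longlongrightarrow> z) (at_left (Re z))"
  proof -
    have "((\<lambda>s. Complex s (Im z)) \<longlongrightarrow> Complex (Re z) (Im z)) (at_left (Re z))"
      by (intro tendsto_Complex tendsto_intros)
    then show ?thesis by simp
  qed
  have ev: "\<forall>\<^sub>F s in at_left (Re z). Complex s (Im z) \<in> closure D"
    unfolding eventually_at_filter using down[OF assms(1)] closure_subset by (auto intro!: always_eventually)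
  show ?thesis
    using continuous_on_tendsto_compose[OF assms(2) t z ev] .
qed

lemma closure_down:
  assumes "z \<in> closure D" "s < Re z" shows "Complex s (Im z) \<in> closure D"
proof (unfold closure_approachable, intro allI impI)
  fix e :: real assume "e > 0"
  define d where "d = min e (Re z - s)"
  have "d > 0" using \<open>e > 0\<close> assms by (simp add: d_def)
  then obtain y where y: "y \<in> D" "dist y z < d"
    using assms(1) unfolding closure_approachable by blast
  have r: "\<bar>Re y - Re z\<bar> < d" "\<bar>Im y - Im z\<bar> < d"
    using y(2) abs_Re_le_cmod[of "y - z"] abs_Im_le_cmod[of "y - z"] unfolding dist_norm by auto
  have "Complex s (Im y) \<in> D" by (rule D_down[of "Re y"]) (use y r in \<open>auto simp: d_def\<close>)
  moreover have "dist (Complex s (Im y)) (Complex s (Im z)) < e"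
    unfolding dist_norm cmod_Complex_same_Re using r by (auto simp: d_def)
  ultimately show "\<exists>y\<in>D. dist y (Complex s (Im z)) < e" by blast
qed

lemma closure_strip: "z \<in> closure D \<Longrightarrow> A \<le> Im z \<and> Im z \<le> B"
proof -
  have "closed {z. A \<le> Im z \<and> Im z \<le> B}"
    by (intro closed_Collect_conj closed_Collect_le continuous_intros)
  moreover have "D \<subseteq> {z. A \<le> Im z \<and> Im z \<le> B}" using D_strip less_imp_le by blast
  ultimately show "z \<in> closure D \<Longrightarrow> A \<le> Im z \<and> Im z \<le> B" using closure_minimal by blast
qed

text \<open>Meant for \<open>z\<close> on a boundary line: the part of a small ball inside the strip
  is convex, misses \<open>N\<close> and meets \<open>D\<close>, so \<open>fill\<close>
  applies.\<close>

lemma line_fill: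
  assumes z: "z \<in> closure D" "z \<notin> closure N"
  obtains d where "d > 0" "\<And>y. cmod (y - z) < d \<Longrightarrow> A < Im y \<Longrightarrow> Im y < B \<Longrightarrow> y \<in> D"
    "\<And>y. cmod (y - z) < d \<Longrightarrow> y \<notin> closure N"
proof -
  have "z \<in> - closure N" "open (- closure N)" using z by auto
  then obtain d where d: "d > 0" "\<And>y. cmod (y - z) < d \<Longrightarrow> y \<in> - closure N"
    unfolding open_dist dist_norm by metis
  define V where "V = ball z d \<inter> {y. Im y > A} \<inter> {y. Im y < B}"
  have "V \<subseteq> D"
  proof (rule fill)
    show "connected V" unfolding V_def
      by (intro convex_connected convex_Int convex_ball convex_halfspace_Im_gt convex_halfspace_Im_lt)
    show "V \<inter> N = {}"
    proof -
      have "y \<notin> N" if "y \<in> V" for y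
        using d(2)[of y] that closure_subset[of N] by (auto simp: V_def dist_norm norm_minus_commute)
      then show ?thesis by blast
    qed
    obtain y where "y \<in> D" "dist y z < d" using z(1) d(1) unfolding closure_approachable by blast
    then have "y \<in> V \<inter> D" using D_strip[of y] by (simp add: V_def dist_commute)
    then show "V \<inter> D \<noteq> {}" by blast
  qed (auto simp: V_def)
  then have "y \<in> D" if "cmod (y - z) < d" "A < Im y" "Im y < B" for y
    using that by (auto simp: V_def dist_norm norm_minus_commute)
  then show thesis using that[of d] d by blast
qed

end

text \<open>The sphere metric is \<open>sech\<^sup>2 s (ds\<^sup>2 + dt\<^sup>2)\<close>, and \<open>w\<close> stands for \<open>u + 1\<close>. The two quantities bounded by
  \<open>M sech\<^sup>2 s\<close> are the components \<open>\<phi>\<close> and \<open>\<psi>\<close> of \<open>\<nabla>\<^sup>2w + w g\<close>.\<close>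

locale planar_problem = planar_strip +
  fixes w ws wt wss wst wtt :: "complex \<Rightarrow> real" and c M :: real
  assumes width: "B - A < 2 * pi"
    and der_w: "z \<in> D \<Longrightarrow> (w has_derivative (\<lambda>h. ws z * Re h + wt z * Im h)) (at z)"
    and der_ws: "z \<in> D \<Longrightarrow> (ws has_derivative (\<lambda>h. wss z * Re h + wst z * Im h)) (at z)"
    and der_wt: "z \<in> D \<Longrightarrow> (wt has_derivative (\<lambda>h. wst z * Re h + wtt z * Im h)) (at z)"
    and cont: "continuous_on (closure D) w" "continuous_on (closure D) ws" "continuous_on (closure D) wt"
      "continuous_on (closure D) wss" "continuous_on (closure D) wst" "continuous_on (closure D) wtt"
    and pde: "z \<in> closure D \<Longrightarrow> wss z + wtt z + 2 * (sech (Re z))^2 * w z = 0"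
    and phi_bound: "z \<in> closure D \<Longrightarrow> \<bar>wss z + tanh (Re z) * ws z + (sech (Re z))^2 * w z\<bar> \<le> M * (sech (Re z))^2"
    and psi_bound: "z \<in> closure D \<Longrightarrow> \<bar>wst z + tanh (Re z) * wt z\<bar> \<le> M * (sech (Re z))^2"
    and Q_bound: "z \<in> closure D \<Longrightarrow> (w z)^2 + (cosh (Re z))^2 * ((ws z)^2 + (wt z)^2) \<le> M"
    and w_N: "z \<in> N \<Longrightarrow> w z = 1"
    and normal_N: "z \<in> N \<Longrightarrow> (ns z)^2 + (nt z)^2 = (sech (Re z))^2"
    and neumann_N: "z \<in> N \<Longrightarrow> ns z * ws z + nt z * wt z = c * (sech (Re z))^2"
    and neumann_line: "z \<in> closure D \<Longrightarrow> Im z = A \<or> Im z = B \<Longrightarrow> z \<notin> closure N \<Longrightarrow> wt z = 0"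
    and corner_isolated: "z \<in> closure N \<Longrightarrow> Im z = A \<or> Im z = B \<Longrightarrow>
       \<exists>d>0. \<forall>y\<in>closure N. (Im y = A \<or> Im y = B) \<longrightarrow> cmod (y - z) < d \<longrightarrow> y = z"
    and N_nonempty: "N \<noteq> {}"
begin

definition phi :: "complex \<Rightarrow> real" where "phi z = wss z + tanh (Re z) * ws z + (sech (Re z))^2 * w z"
definition psi :: "complex \<Rightarrow> real" where "psi z = wst z + tanh (Re z) * wt z"
text \<open>This is \<open>|X|\<^sup>2\<close> of the overview; \<open>cosh\<^sup>2\<close> is the
  reciprocal of the conformal factor.\<close>

definition Q :: "complex \<Rightarrow> real" where "Q z = (w z)^2 + (cosh (Re z))^2 * ((ws z)^2 + (wt z)^2)"

lemma cont_phi: "continuous_on (closure D) phi" and cont_psi: "continuous_on (closure D) psi"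
  and cont_Q: "continuous_on (closure D) Q"
  unfolding phi_def psi_def Q_def by (intro continuous_intros cont; simp)+

lemma cont_lim: "continuous_on (closure D) f \<Longrightarrow> z \<in> N \<Longrightarrow> (f \<longlongrightarrow> f z) (at z within D)"
  using N_closure closure_subset unfolding continuous_on_def by (blast intro: tendsto_within_subset)

text \<open>The tangential derivative along \<open>N\<close> of a function that is constant there.
  In place of a chain rule, the expansion of \<open>f\<close> and the slope of \<open>N\<close> are
  compared at one boundary point close to \<open>z\<close>.\<close>

lemma graph_derivative_zero:
  assumes z: "z \<in> N" and f: "\<And>y. y \<in> N \<Longrightarrow> f y = f z"
    and der: "\<And>y. y \<in> D \<Longrightarrow> (f has_derivative (\<lambda>h. fs y * Re h + ft y * Im h)) (at y)"
    and c: "continuous_on (closure D) f" "continuous_on (closure D) fs" "continuous_on (closure D) ft"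
  shows "fs z * slope z + ft z = 0"
proof (rule ccontr)
  assume ne: "fs z * slope z + ft z \<noteq> 0"
  define m where "m = \<bar>fs z * slope z + ft z\<bar>"
  \<comment> \<open>Collects the errors per unit of \<open>b = Im y - Im z\<close>:
    \<open>\<bar>slope z\<bar> + 2\<close> from \<open>cmod (y - z)\<close> and
    \<open>\<bar>fs z\<bar>\<close> from the slope.\<close>
  define k where "k = 2 + \<bar>slope z\<bar> + \<bar>fs z\<bar>"
  define e where "e = min 1 (m / (2 * k))"
  have k: "k > 0" and m: "m > 0" using ne by (auto simp: k_def m_def)
  have e: "e > 0" "e \<le> 1" "e * k \<le> m / 2" using k m by (auto simp: e_def min_def field_simps)
  obtain d1 where d1: "d1 > 0" "\<And>y. y \<in> D \<union> N \<Longrightarrow> cmod (y - z) < d1 \<Longrightarrow>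
     \<bar>f y - f z - fs z * (Re y - Re z) - ft z * (Im y - Im z)\<bar> \<le> e * cmod (y - z)"
    using boundary_expansion[OF z der N_line_approach[OF _ c(1)] cont_lim[OF c(2) z] cont_lim[OF c(3) z] e(1)]
    by (metis UnI2)
  obtain d2 where d2: "d2 > 0" "\<And>y. y \<in> N \<Longrightarrow> cmod (y - z) < d2 \<Longrightarrow> \<bar>Re y - Re z - slope z * (Im y - Im z)\<bar> \<le> e * \<bar>Im y - Im z\<bar>"
    using N_slope[OF z e(1)] by blast
  define d where "d = Min {d1, d2, 1}"
  have d: "d > 0" using d1 d2 by (simp add: d_def)
  obtain d3 where d3: "d3 > 0" "\<And>t. \<bar>t - Im z\<bar> < d3 \<Longrightarrow> A < t \<and> t < B \<and> cmod (Complex (top (Re z + 1) t) t - z) < d"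
    using top_near_N[OF z _ d, of "Re z + 1"] by auto
  define t where "t = Im z + d3 / 2"
  define y where "y = Complex (top (Re z + 1) t) t"
  have t: "A < t" "t < B" "cmod (y - z) < d" using d3 by (auto simp: t_def y_def)
  have "\<bar>top (Re z + 1) t - Re z\<bar> < 1" using t(3) abs_Re_le_cmod[of "y - z"] by (simp add: y_def d_def)
  then have yN: "y \<in> N" using top_cases[OF t(1,2), of "Re z + 1"] by (auto simp: y_def)
  define a b where "a = Re y - Re z" and "b = Im y - Im z"
  have b: "b > 0" using d3 by (simp add: b_def y_def t_def)
  have 1: "\<bar>fs z * a + ft z * b\<bar> \<le> e * cmod (y - z)"
    using d1(2)[of y] yN t(3) f[OF yN] by (simp add: a_def b_def d_def algebra_simps abs_minus_commute) 
  have 2: "\<bar>a - slope z * b\<bar> \<le> e * b"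
    using d2(2)[OF yN] t(3) b by (simp add: a_def b_def d_def)
  have "\<bar>a\<bar> \<le> \<bar>slope z\<bar> * b + e * b"
    using 2 abs_triangle_ineq[of "a - slope z * b" "slope z * b"] b by (simp add: abs_mult)
  also have "\<dots> \<le> (\<bar>slope z\<bar> + 1) * b" using e b by (simp add: distrib_right)
  finally have 3: "cmod (y - z) \<le> (\<bar>slope z\<bar> + 2) * b"
    using cmod_le[of "y - z"] b by (simp add: a_def b_def distrib_right)
  have "m * b = \<bar>(fs z * a + ft z * b) - fs z * (a - slope z * b)\<bar>"
  proof -
    have "m * b = \<bar>(fs z * slope z + ft z) * b\<bar>" using b by (simp add: m_def abs_mult)
    also have "(fs z * slope z + ft z) * b = (fs z * a + ft z * b) - fs z * (a - slope z * b)" by (simp add: algebra_simps)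
    finally show ?thesis .
  qed
  also have "\<dots> \<le> \<bar>fs z * a + ft z * b\<bar> + \<bar>fs z\<bar> * \<bar>a - slope z * b\<bar>"
    using abs_triangle_ineq4[of "fs z * a + ft z * b" "fs z * (a - slope z * b)"] by (simp add: abs_mult)
  also have "\<dots> \<le> e * ((\<bar>slope z\<bar> + 2) * b) + \<bar>fs z\<bar> * (e * b)"
    using 1 2 3 e by (intro add_mono mult_left_mono order.trans[OF 1]) auto
  also have "\<dots> = (e * k) * b" by (simp add: k_def algebra_simps)
  also have "\<dots> \<le> m / 2 * b" using e b by (intro mult_right_mono) auto
  finally show False using m b by simp
qed

text \<open>Constancy of \<open>w\<close> along \<open>N\<close> makes the gradient parallel to the
  normal; the Neumann datum and the length of the normal fix the factor.\<close>

lemma gradient_N: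
  assumes z: "z \<in> N" shows "ws z = c * ns z" "wt z = c * nt z"
proof -
  have "ws z * slope z + wt z = 0"
    by (rule graph_derivative_zero[OF z _ der_w cont(1,2,3)]) (use w_N z in auto)
  then have 1: "ws z * nt z = wt z * ns z" using ns_pos[OF z] by (simp add: slope_def field_simps)
  have q: "(sech (Re z))^2 \<noteq> 0" by simp
  have "ws z * (sech (Re z))^2 = ns z * (ns z * ws z) + nt z * (ws z * nt z)"
    unfolding normal_N[OF z, symmetric] by (simp add: power2_eq_square algebra_simps)
  also have "\<dots> = ns z * (ns z * ws z + nt z * wt z)" unfolding 1 by (simp add: algebra_simps)
  finally have "ws z * (sech (Re z))^2 = (c * ns z) * (sech (Re z))^2" by (simp add: neumann_N[OF z])
  then show "ws z = c * ns z" using q by simp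
  then show "wt z = c * nt z" using 1 ns_pos[OF z] by simp
qed

lemma Q_N: assumes "z \<in> closure N" shows "Q z = 1 + c^2"
proof -
  have "Q z = 1 + c^2" if z: "z \<in> N" for z
  proof -
    have "Q z = 1 + (cosh (Re z))^2 * (c^2 * ((ns z)^2 + (nt z)^2))"
      by (simp add: Q_def w_N[OF z] gradient_N[OF z] algebra_simps power_mult_distrib)
    also have "\<dots> = 1 + c^2 * ((cosh (Re z))^2 * (sech (Re z))^2)" by (simp add: normal_N[OF z])
    finally show ?thesis by (simp add: cosh_sech)
  qed
  moreover have "closure N \<subseteq> closure D" using N_closure closure_minimal by blast
  ultimately show ?thesis
    using continuous_constant_on_closure[of N Q "1 + c^2"] continuous_on_subset[OF cont_Q] assms by blast
qed

lemma wtt_eq: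
  assumes "z \<in> D" shows "wtt z = - wss z - 2 * (sech (Re z))^2 * w z"
proof -
  have "z \<in> closure D" using assms closure_subset by blast
  from pde[OF this] show ?thesis by linarith
qed

text \<open>The function is the real part \<open>a\<close> of \<open>G\<close>. On the sphere it
  equals \<open>- X \<bullet> p\<close>, a coordinate function of the minimal surface.\<close>

lemma der_a: 
  assumes z: "z \<in> D"
  shows "((\<lambda>z. ws z + tanh (Re z) * w z) has_derivative (\<lambda>h. phi z * Re h + psi z * Im h)) (at z)"
  by (rule has_derivative_eq_rhs, rule has_derivative_add[OF der_ws[OF z] has_derivative_mult[OF has_derivative_tanh_Re der_w[OF z]]])
    (auto simp: phi_def psi_def algebra_simps)

text \<open>The second derivatives of \<open>w\<close> are only continuous, so \<open>\<psi> ds - \<phi> dt\<close> cannot be differentiated directly; adding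
  \<open>d(wt)\<close> turns it into a form with continuously differentiable coefficients, closed by the equation.\<close>

lemma conjugate_exists:
  "\<exists>b. \<forall>z\<in>D. (b has_derivative (\<lambda>h. - psi z * Re h + phi z * Im h)) (at z)"
proof -
  have "\<exists>k. \<forall>z\<in>D. (k has_derivative (\<lambda>h. (- (tanh (Re z) * wt z)) * Re h + (tanh (Re z) * ws z - (sech (Re z))^2 * w z) * Im h)) (at z)"
  proof (rule closed_form_primitive)
    fix z assume z: "z \<in> D"
    show "((\<lambda>z. - (tanh (Re z) * wt z)) has_derivative (\<lambda>h. (- ((sech (Re z))^2 * wt z) - tanh (Re z) * wst z) * Re h + (- tanh (Re z) * wtt z) * Im h)) (at z)"
      by (rule has_derivative_eq_rhs, rule has_derivative_minus[OF has_derivative_mult[OF has_derivative_tanh_Re der_wt[OF z]]])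
        (auto simp: algebra_simps)
    have p: "- tanh (Re z) * wtt z = tanh (Re z) * wss z + 2 * (sech (Re z))^2 * tanh (Re z) * w z"
      unfolding wtt_eq[OF z] by (simp add: algebra_simps)
    show "((\<lambda>z. tanh (Re z) * ws z - (sech (Re z))^2 * w z) has_derivative (\<lambda>h. (- tanh (Re z) * wtt z) * Re h + (tanh (Re z) * wst z - (sech (Re z))^2 * wt z) * Im h)) (at z)"
      unfolding p
      by (rule has_derivative_eq_rhs, rule has_derivative_diff[OF has_derivative_mult[OF has_derivative_tanh_Re der_ws[OF z]] has_derivative_mult[OF has_derivative_sech_sq der_w[OF z]]])
        (auto simp: algebra_simps)
  next
    show "continuous_on D (\<lambda>z. - tanh (Re z) * wtt z)"
      by (intro continuous_intros continuous_on_subset[OF cont(6) closure_subset]) auto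
  qed
  then obtain k where k: "\<And>z. z \<in> D \<Longrightarrow> (k has_derivative (\<lambda>h. (- (tanh (Re z) * wt z)) * Re h + (tanh (Re z) * ws z - (sech (Re z))^2 * w z) * Im h)) (at z)"
    by blast
  have "((\<lambda>z. k z - wt z) has_derivative (\<lambda>h. - psi z * Re h + phi z * Im h)) (at z)" if z: "z \<in> D" for z
  proof (rule has_derivative_eq_rhs[OF has_derivative_diff[OF k[OF z] der_wt[OF z]]], rule ext)
    fix h
    show "- (tanh (Re z) * wt z) * Re h + (tanh (Re z) * ws z - (sech (Re z))^2 * w z) * Im h - (wst z * Re h + wtt z * Im h) =
       - psi z * Re h + phi z * Im h"
      unfolding wtt_eq[OF z] phi_def psi_def by (simp add: algebra_simps)
  qed
  then show ?thesis by blast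
qed

text \<open>By definition \<open>phi\<close> and \<open>psi\<close> are merely continuous. They
  become differentiable because \<open>phi - i psi\<close> is the derivative of the holomorphic
  function \<open>G\<close>; the pattern of \<open>f1\<close> and \<open>f2\<close> is the
  Cauchy-Riemann system.\<close>

lemma phi_psi_derivative:
  assumes z: "z \<in> D"
  shows "\<exists>f1 f2. (phi has_derivative (\<lambda>h. f1 * Re h + f2 * Im h)) (at z) \<and> (psi has_derivative (\<lambda>h. f2 * Re h + (- f1) * Im h)) (at z)"
proof -
  obtain b where b: "\<And>z. z \<in> D \<Longrightarrow> (b has_derivative (\<lambda>h. - psi z * Re h + phi z * Im h)) (at z)"
    using conjugate_exists by blast
  define G where "G = (\<lambda>z. complex_of_real (ws z + tanh (Re z) * w z) + \<i> * complex_of_real (b z))"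
  have dG: "(G has_field_derivative (Complex (phi z) (- psi z))) (at z)" if z: "z \<in> D" for z
    unfolding has_field_derivative_def G_def
    by (rule has_derivative_eq_rhs, rule has_derivative_add[OF has_derivative_of_real[OF der_a[OF z]] has_derivative_mult_right[OF has_derivative_of_real[OF b[OF z]]]])
      (auto simp: complex_eq_iff algebra_simps)
  have hol: "G holomorphic_on D" unfolding holomorphic_on_open[OF D_open] using dG by blast
  have "deriv G holomorphic_on D" by (rule holomorphic_deriv[OF hol D_open])
  then obtain F where F: "(deriv G has_field_derivative F) (at z)"
    unfolding holomorphic_on_open[OF D_open] using z by blast
  have dG': "deriv G y = Complex (phi y) (- psi y)" if "y \<in> D" for y using DERIV_imp_deriv[OF dG[OF that]] .
  have F': "(deriv G has_derivative (\<lambda>h. F * h)) (at z)" using F by (simp add: has_field_derivative_def)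
  have "((\<lambda>z. Re (deriv G z)) has_derivative (\<lambda>h. Re (F * h))) (at z)" by (rule has_derivative_Re[OF F'])
  then have p1: "(phi has_derivative (\<lambda>h. Re (F * h))) (at z)"
    by (rule has_derivative_transform_within_open[OF _ D_open z]) (simp add: dG')
  have "((\<lambda>z. - Im (deriv G z)) has_derivative (\<lambda>h. - Im (F * h))) (at z)" by (rule has_derivative_minus[OF has_derivative_Im[OF F']])
  then have p2: "(psi has_derivative (\<lambda>h. - Im (F * h))) (at z)"
    by (rule has_derivative_transform_within_open[OF _ D_open z]) (simp add: dG')
  show ?thesis
  proof (intro exI conjI)
    show "(phi has_derivative (\<lambda>h. Re F * Re h + (- Im F) * Im h)) (at z)" using p1 by simp
    show "(psi has_derivative (\<lambda>h. (- Im F) * Re h + (- Re F) * Im h)) (at z)" using p2 by (simp add: algebra_simps)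
  qed
qed

definition Qs :: "complex \<Rightarrow> real" where "Qs z = 2 * (cosh (Re z))^2 * (phi z * ws z + psi z * wt z)"
definition Qt :: "complex \<Rightarrow> real" where "Qt z = 2 * (cosh (Re z))^2 * (psi z * ws z - phi z * wt z)"

text \<open>The coordinate form of \<open>\<nabla>|X|\<^sup>2 = 2 E(\<nabla>w, .)\<close>. The
  equation eliminates \<open>wtt\<close>, after which the second derivatives occur only through
  \<open>phi\<close> and \<open>psi\<close>.\<close>

lemma der_Q: 
  assumes z: "z \<in> D"
  shows "(Q has_derivative (\<lambda>h. Qs z * Re h + Qt z * Im h)) (at z)"
proof -
  have c: "(cosh (Re z))^2 * (x * (sech (Re z))^2) = x" for x using cosh_sech(1)[of "Re z"] by (simp add: algebra_simps)
  have cs: "(sech (Re z))^2 * (cosh (Re z))^2 = 1" using cosh_sech(1)[of "Re z"] by (simp add: mult.commute)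
  have c': "(cosh (Re z))^2 * (x * (y * (sech (Re z))^2)) = x * y" for x y using c[of "x * y"] by (simp add: algebra_simps)
  show ?thesis
    unfolding Q_def[abs_def]
    apply (rule has_derivative_eq_rhs, rule has_derivative_add[OF has_derivative_power[OF der_w[OF z]]
        has_derivative_mult[OF has_derivative_cosh_sq has_derivative_add[OF has_derivative_power[OF der_ws[OF z]] has_derivative_power[OF der_wt[OF z]]]]])
    apply (rule ext)
    apply (simp add: Qs_def Qt_def phi_def psi_def wtt_eq[OF z] power2_eq_square[of "ws z"] power2_eq_square[of "wt z"] algebra_simps c c' cs)
    done
qed

end

context planar_strip
begin

lemma line_in_closure:
  assumes "d > 0" "\<And>y. cmod (y - z) < d \<Longrightarrow> A < Im y \<Longrightarrow> Im y < B \<Longrightarrow> y \<in> D"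
    and "Im z = A \<or> Im z = B" "\<bar>s - Re z\<bar> < d"
  shows "Complex s (Im z) \<in> closure D"
proof (unfold closure_approachable, intro allI impI)
  fix e :: real assume e: "e > 0"
  define t where "t = Min {e / 2, (d - \<bar>s - Re z\<bar>) / 2, (B - A) / 2}"
  have t: "t > 0" "t < e" "t < d - \<bar>s - Re z\<bar>" "t < B - A" 
    using e assms(4) AB by (auto simp: t_def min_def)
  define u where "u = (if Im z = A then A + t else B - t)"
  have u: "A < u" "u < B" "\<bar>u - Im z\<bar> = t" using t assms(3) by (auto simp: u_def)
  have "cmod (Complex s u - z) \<le> \<bar>s - Re z\<bar> + t" using cmod_le[of "Complex s u - z"] u by simp
  then have "Complex s u \<in> D" using assms(2)[of "Complex s u"] u t by simp
  moreover have "dist (Complex s u) (Complex s (Im z)) < e"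
    unfolding dist_norm cmod_Complex_same_Re using u t by simp
  ultimately show "\<exists>y\<in>D. dist y (Complex s (Im z)) < e" by blast
qed

end

context planar_problem
begin

text \<open>In the sum \<open>q1 + r2\<close> the derivatives of \<open>phi\<close> and
  \<open>psi\<close> cancel by Cauchy-Riemann, and
  \<open>4 * (cosh (Re z))^2 * ((phi z)^2 + (psi z)^2)\<close> remains.\<close>

lemma laplacian_Q:
  assumes z: "z \<in> D"
  shows "\<exists>q1 q2 r1 r2. (Qs has_derivative (\<lambda>h. q1 * Re h + q2 * Im h)) (at z) \<and>
    (Qt has_derivative (\<lambda>h. r1 * Re h + r2 * Im h)) (at z) \<and> q1 + r2 \<ge> 0"
proof -
  obtain f1 f2 where f: "(phi has_derivative (\<lambda>h. f1 * Re h + f2 * Im h)) (at z)"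
    "(psi has_derivative (\<lambda>h. f2 * Re h + (- f1) * Im h)) (at z)"
    using phi_psi_derivative[OF z] by blast
  have two: "((\<lambda>z. 2 * (cosh (Re z))^2) has_derivative (\<lambda>h. 2 * (2 * (cosh (Re z))^2 * tanh (Re z) * Re h))) (at z)"
    by (rule has_derivative_mult_right[OF has_derivative_cosh_sq])
  define q where "q = (\<lambda>h::complex. 2 * (cosh (Re z))^2 * ((phi z * (wss z * Re h + wst z * Im h) + (f1 * Re h + f2 * Im h) * ws z) + (psi z * (wst z * Re h + wtt z * Im h) + (f2 * Re h + (- f1) * Im h) * wt z))
     + 2 * (2 * (cosh (Re z))^2 * tanh (Re z) * Re h) * (phi z * ws z + psi z * wt z))"
  define r where "r = (\<lambda>h::complex. 2 * (cosh (Re z))^2 * ((psi z * (wss z * Re h + wst z * Im h) + (f2 * Re h + (- f1) * Im h) * ws z) - (phi z * (wst z * Re h + wtt z * Im h) + (f1 * Re h + f2 * Im h) * wt z))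
     + 2 * (2 * (cosh (Re z))^2 * tanh (Re z) * Re h) * (psi z * ws z - phi z * wt z))"
  have dq: "(Qs has_derivative q) (at z)" unfolding Qs_def[abs_def] q_def
    by (rule has_derivative_mult[OF two has_derivative_add[OF has_derivative_mult[OF f(1) der_ws[OF z]] has_derivative_mult[OF f(2) der_wt[OF z]]]])
  have dr: "(Qt has_derivative r) (at z)" unfolding Qt_def[abs_def] r_def
    by (rule has_derivative_mult[OF two has_derivative_diff[OF has_derivative_mult[OF f(2) der_ws[OF z]] has_derivative_mult[OF f(1) der_wt[OF z]]]])
  have e: "g = (\<lambda>h. g 1 * Re h + g \<i> * Im h)" if "bounded_linear g" for g :: "complex \<Rightarrow> real"
  proof
    fix h :: complex
    interpret bounded_linear g by fact
    have "g h = g (Re h *\<^sub>R 1 + Im h *\<^sub>R \<i>)" by (intro arg_cong[of _ _ g]) (simp add: complex_eq_iff)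
    then show "g h = g 1 * Re h + g \<i> * Im h" by (simp add: add scaleR)
  qed
  have "q 1 + r \<i> = 2 * (cosh (Re z))^2 * (phi z * (wss z - wtt z + 2 * (tanh (Re z) * ws z)) + 2 * psi z * (wst z + tanh (Re z) * wt z))"
    by (simp add: q_def r_def algebra_simps)
  also have "wss z - wtt z + 2 * (tanh (Re z) * ws z) = 2 * phi z" by (simp add: wtt_eq[OF z] phi_def)
  also have "wst z + tanh (Re z) * wt z = psi z" by (simp add: psi_def)
  also have "2 * (cosh (Re z))^2 * (phi z * (2 * phi z) + 2 * psi z * psi z) = 4 * (cosh (Re z))^2 * ((phi z)^2 + (psi z)^2)"
    by (simp add: power2_eq_square algebra_simps)
  finally have "q 1 + r \<i> \<ge> 0" by simp
  moreover have "(Qs has_derivative (\<lambda>h. q 1 * Re h + q \<i> * Im h)) (at z)"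
    using dq e[OF has_derivative_bounded_linear[OF dq]] by metis
  moreover have "(Qt has_derivative (\<lambda>h. r 1 * Re h + r \<i> * Im h)) (at z)"
    using dr e[OF has_derivative_bounded_linear[OF dr]] by metis
  ultimately show ?thesis by blast
qed

text \<open>\<open>wt\<close> vanishes along the line, but \<open>wst\<close> is its derivative only
  inside \<open>D\<close>. If \<open>wst z\<close> were not zero, \<open>wt\<close> would change by
  a fixed amount along interior rows of length \<open>h\<close> close to the line, although its
  values at both ends of such a row are close to 0.\<close>

lemma wst_line:
  assumes z: "z \<in> closure D" "Im z = A \<or> Im z = B" "z \<notin> closure N"
  shows "wst z = 0"
proof (rule ccontr)
  assume ne: "wst z \<noteq> 0"
  obtain d where d: "d > 0" "\<And>y. cmod (y - z) < d \<Longrightarrow> A < Im y \<Longrightarrow> Im y < B \<Longrightarrow> y \<in> D"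
    "\<And>y. cmod (y - z) < d \<Longrightarrow> y \<notin> closure N"
    using line_fill[OF z(1,3)] by blast
  define m where "m = \<bar>wst z\<bar> / 2"
  have m: "m > 0" using ne by (simp add: m_def)
  obtain r where r: "r > 0" "\<And>y. y \<in> closure D \<Longrightarrow> dist y z < r \<Longrightarrow> dist (wst y) (wst z) < m"
    using cont(5) z(1) m unfolding continuous_on_iff by metis
  define h where "h = min d r / 4"
  have h: "h > 0" "4 * h \<le> d" "4 * h \<le> r" using d r by (auto simp: h_def)
  define s where "s = Re z"
  have cl: "Complex x (Im z) \<in> closure D" if "s \<le> x" "x \<le> s + h" for x
    by (rule line_in_closure[OF d(1,2) z(2)]) (use that h in \<open>auto simp: s_def\<close>)
  have wt0: "wt (Complex x (Im z)) = 0" if "s \<le> x" "x \<le> s + h" for x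
  proof (rule neumann_line[OF cl[OF that]])
    show "Im (Complex x (Im z)) = A \<or> Im (Complex x (Im z)) = B" using z by simp
    show "Complex x (Im z) \<notin> closure N" by (rule d(3)) (use that h in \<open>simp add: cmod_def s_def\<close>)
  qed
  have "\<exists>r>0. \<forall>y\<in>closure D. dist y (Complex x (Im z)) < r \<longrightarrow> \<bar>wt y\<bar> < m * h / 3" if "s \<le> x" "x \<le> s + h" for x
    using cont(3) cl[OF that] wt0[OF that] m h unfolding continuous_on_iff dist_real_def
    by (metis diff_zero mult_pos_pos zero_less_divide_iff zero_less_numeral)
  then obtain r0 r1 where rr: "r0 > 0" "r1 > 0" "\<And>y. y \<in> closure D \<Longrightarrow> dist y (Complex s (Im z)) < r0 \<Longrightarrow> \<bar>wt y\<bar> < m * h / 3"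
     "\<And>y. y \<in> closure D \<Longrightarrow> dist y (Complex (s + h) (Im z)) < r1 \<Longrightarrow> \<bar>wt y\<bar> < m * h / 3"
    using h(1) by (metis less_eq_real_def less_add_same_cancel1)
  define t where "t = Min {r0 / 2, r1 / 2, h, (B - A) / 2}"
  have t: "t > 0" "t < r0" "t < r1" "t \<le> h" "t < B - A" using rr h AB by (auto simp: t_def min_def)
  define u where "u = (if Im z = A then A + t else B - t)"
  have u: "A < u" "u < B" "\<bar>u - Im z\<bar> = t" using t z(2) by (auto simp: u_def)
  have near: "cmod (Complex x u - z) \<le> 2 * h" if "s \<le> x" "x \<le> s + h" for x
    using cmod_le[of "Complex x u - z"] that u t by (simp add: s_def)
  have D: "Complex x u \<in> D" if "s \<le> x" "x \<le> s + h" for x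
    using d(2)[of "Complex x u"] near[OF that] u h by simp
  have "\<exists>x>s. x < s + h \<and> wt (Complex (s + h) u) - wt (Complex s u) = (s + h - s) * wst (Complex x u)"
    by (rule MVT2) (use h in \<open>auto intro!: has_derivative_Re_line[OF der_wt] D\<close>)
  then obtain x where x: "s < x" "x < s + h" "wt (Complex (s + h) u) - wt (Complex s u) = h * wst (Complex x u)" by auto
  have "Complex x u \<in> closure D" using D[of x] x closure_subset by force
  then have "\<bar>wst (Complex x u) - wst z\<bar> < m"
    using r(2)[of "Complex x u"] near[of x] x h by (simp add: dist_norm)
  then have "\<bar>wst (Complex x u)\<bar> > m" using m_def by linarith
  then have "h * \<bar>wst (Complex x u)\<bar> > h * m" using h by simp
  moreover have "\<bar>wt (Complex s u)\<bar> < m * h / 3"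
    using D[of s] closure_subset h u t by (intro rr(3)) (auto simp: dist_norm cmod_Complex_same_Re)
  moreover have "\<bar>wt (Complex (s + h) u)\<bar> < m * h / 3"
    using D[of "s + h"] closure_subset h u t by (intro rr(4)) (auto simp: dist_norm cmod_Complex_same_Re)
  moreover have "h * \<bar>wst (Complex x u)\<bar> = \<bar>wt (Complex (s + h) u) - wt (Complex s u)\<bar>"
    unfolding x(3) using h by (simp add: abs_mult)
  ultimately have "h * m < 2 * (m * h / 3)" by linarith
  then show False using m h by (simp add: mult.commute)
qed

text \<open>Away from the corners both terms of \<open>psi\<close> vanish. Corners are isolated, so
  points of the line slightly to the left of a corner are none, and continuity carries the zero
  over.\<close>

lemma psi_line:
  assumes z: "z \<in> closure D" "Im z = A \<or> Im z = B"
  shows "psi z = 0"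
proof (cases "z \<in> closure N")
  case False
  then show ?thesis using wst_line[OF z False] neumann_line[OF z False] by (simp add: psi_def)
next
  case True
  then obtain d where d: "d > 0" "\<And>y. y \<in> closure N \<Longrightarrow> (Im y = A \<or> Im y = B) \<Longrightarrow> cmod (y - z) < d \<Longrightarrow> y = z"
    using corner_isolated[OF True z(2)] by blast
  have zero: "psi (Complex s (Im z)) = 0" if "Re z - d < s" "s < Re z" for s
  proof -
    define y where "y = Complex s (Im z)"
    have y: "y \<in> closure D" unfolding y_def by (rule closure_down[OF z(1) that(2)])
    have "Re y \<noteq> Re z" "cmod (y - z) < d" using that by (auto simp: y_def cmod_def)
    then have "y \<noteq> z" "cmod (y - z) < d" by auto
    then have n: "y \<notin> closure N" using d(2)[of y] z(2) by (auto simp: y_def)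
    show ?thesis using wst_line[OF y _ n] neumann_line[OF y _ n] z(2) by (simp add: psi_def y_def)
  qed
  have "((\<lambda>s. psi (Complex s (Im z))) \<longlongrightarrow> psi z) (at_left (Re z))"
  proof -
    have t: "((\<lambda>s. Complex s (Im z)) \<longlongrightarrow> z) (at_left (Re z))"
    proof -
      have "((\<lambda>s. Complex s (Im z)) \<longlongrightarrow> Complex (Re z) (Im z)) (at_left (Re z))"
        by (intro tendsto_Complex tendsto_intros)
      then show ?thesis by simp
    qed
    have ev: "\<forall>\<^sub>F s in at_left (Re z). Complex s (Im z) \<in> closure D"
      unfolding eventually_at_filter using closure_down[OF z(1)] by (auto intro!: always_eventually)
    show ?thesis using continuous_on_tendsto_compose[OF cont_psi t z(1) ev] .
  qed
  moreover have "\<forall>\<^sub>F s in at_left (Re z). psi (Complex s (Im z)) = 0"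
    unfolding eventually_at_left_field using zero d(1) by (intro exI[of _ "Re z - d"]) auto
  then have "((\<lambda>s. psi (Complex s (Im z))) \<longlongrightarrow> 0) (at_left (Re z))" by (rule tendsto_eventually)
  ultimately show ?thesis using tendsto_unique[of "at_left (Re z)"] by auto
qed

text \<open>Strictly subharmonic, with negative outward normal derivative on both lines since \<open>B - A < 2\<pi>\<close>, and tending to
  \<open>-\<infinity>\<close> at the vertex: it removes both the Neumann boundary and the vertex from the maximum principle.\<close>

definition barrier :: "complex \<Rightarrow> real" where
  "barrier z = Re z + exp (Re z) * cos ((Im z - (A + B) / 2) / 2)"
definition bs :: "complex \<Rightarrow> real" where "bs z = 1 + exp (Re z) * cos ((Im z - (A + B) / 2) / 2)"
definition bt :: "complex \<Rightarrow> real" where "bt z = - exp (Re z) * sin ((Im z - (A + B) / 2) / 2) / 2"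

lemma cont_barrier: "continuous_on X barrier" "continuous_on X bt"
  unfolding barrier_def bt_def by (intro continuous_intros; simp)+

lemma der_barrier: "(barrier has_derivative (\<lambda>h. bs z * Re h + bt z * Im h)) (at z)"
  unfolding barrier_def[abs_def] bs_def bt_def
  by (auto intro!: derivative_eq_intros simp: algebra_simps)

lemma der_bs: "(bs has_derivative (\<lambda>h. (exp (Re z) * cos ((Im z - (A + B) / 2) / 2)) * Re h + bt z * Im h)) (at z)"
  unfolding bs_def[abs_def] bt_def by (auto intro!: derivative_eq_intros simp: algebra_simps)

lemma der_bt: "(bt has_derivative (\<lambda>h. bt z * Re h + (- exp (Re z) * cos ((Im z - (A + B) / 2) / 2) / 4) * Im h)) (at z)"
  unfolding bt_def[abs_def] by (auto intro!: derivative_eq_intros simp: algebra_simps)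

lemma barrier_le: "barrier z \<le> Re z + exp (Re z)"
  unfolding barrier_def by (simp add: mult_left_le)

end

text \<open>The added assumption controls the end at the antipode \<open>-p\<close>, where
  \<open>Q\<close> must not exceed its value on \<open>N\<close> in the limit.\<close>

locale planar_overdetermined = planar_problem +
  assumes far: "e > 0 \<Longrightarrow> \<exists>S. \<forall>z\<in>D. Re z > S \<longrightarrow> Q z < 1 + c^2 + e"
begin


text \<open>If \<open>Q\<close> exceeded its value on \<open>N\<close>, so would \<open>Q\<close>
  plus a small nonpositive multiple of the barrier. Its maximum over a truncated piece of the strip
  is excluded on \<open>N\<close> by \<open>Q_N\<close>, on the left by the barrier, on the right by
  \<open>far\<close>, on the lines because \<open>f\<close> increases inwards, and in the interior
  by strict subharmonicity.\<close>

lemma Q_le: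
  assumes z0: "z0 \<in> D" shows "Q z0 \<le> 1 + c^2"
proof (rule ccontr)
  assume n: "\<not> Q z0 \<le> 1 + c^2"
  define e where "e = (Q z0 - (1 + c^2)) / 2"
  have e: "e > 0" using n by (simp add: e_def)
  obtain S0 where S0: "\<And>z. z \<in> D \<Longrightarrow> Re z > S0 \<Longrightarrow> Q z < 1 + c^2 + e" using far[OF e] by blast
  define S where "S = max (S0 + 1) (Re z0 + 1)"
  \<comment> \<open>An upper bound of the barrier for \<open>Re z \<le> S\<close>, so that
    \<open>f \<le> Q\<close> there.\<close>
  define H where "H = S + exp S"
  have barH: "barrier z \<le> H" if "Re z \<le> S" for z
  proof -
    have "barrier z \<le> Re z + exp (Re z)" by (rule barrier_le)
    also have "\<dots> \<le> H" unfolding H_def using that by (intro add_mono) auto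
    finally show ?thesis .
  qed
  have farS: "Q z \<le> 1 + c^2 + e" if z: "z \<in> closure D" "Re z \<ge> S" for z
  proof -
    define T where "T = {z \<in> closure D. Q z \<le> 1 + c^2 + e \<or> Re z \<le> S0}"
    have "closed {z \<in> closure D. Q z \<le> 1 + c^2 + e}" "closed {z \<in> closure D. Re z \<le> S0}"
      by (intro continuous_on_closed_Collect_le continuous_intros cont_Q closed_closure)+
    moreover have "T = {z \<in> closure D. Q z \<le> 1 + c^2 + e} \<union> {z \<in> closure D. Re z \<le> S0}" by (auto simp: T_def)
    ultimately have "closed T" by auto
    moreover have "D \<subseteq> T" using S0 closure_subset by (force simp: T_def)
    ultimately have "closure D \<subseteq> T" by (rule closure_minimal[rotated])
    then show ?thesis using z by (auto simp: T_def S_def)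
  qed
  define a where "a = \<bar>barrier z0 - H\<bar> + 1"
  have a: "a > 0" by (simp add: a_def add_nonneg_pos)
  define k where "k = e / (2 * a)"
  have k: "k > 0" "k * \<bar>barrier z0 - H\<bar> < e"
  proof -
    show "k > 0" using e a by (simp add: k_def)
    then have "k * \<bar>barrier z0 - H\<bar> \<le> k * a" by (simp add: a_def)
    also have "\<dots> = e / 2" unfolding k_def using a by simp
    finally show "k * \<bar>barrier z0 - H\<bar> < e" using e by simp
  qed
  define f where "f = (\<lambda>z. Q z + k * (barrier z - H))"
  have fz0: "f z0 > 1 + c^2 + e"
  proof -
    have "k * (- \<bar>barrier z0 - H\<bar>) \<le> k * (barrier z0 - H)" using k(1) by (intro mult_left_mono) auto
    moreover have "Q z0 = 1 + c^2 + 2 * e" by (simp add: e_def field_simps)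
    ultimately show ?thesis using k(2) unfolding f_def by linarith
  qed
  \<comment> \<open>To the left of \<open>T1 = T - exp S - 1\<close> the term
    \<open>k * (barrier z - H)\<close> is at most \<open>- (M + 1)\<close>, which beats
    \<open>Q \<le> M\<close>; \<open>exp S\<close> allows for the exponential part of the
    barrier.\<close>
  define T where "T = min (Re z0) (min S (H - 1 - (M + 1) / k))"
  have QM: "Q z \<le> M" if "z \<in> closure D" for z using Q_bound[OF that] by (simp add: Q_def)
  have M: "M \<ge> 0"
  proof -
    have "0 \<le> Q z0" by (simp add: Q_def)
    also have "Q z0 \<le> M" using z0 closure_subset by (intro QM) blast
    finally show ?thesis .
  qed
  define T1 where "T1 = T - exp S - 1"
  have low: "f z < 0" if "z \<in> closure D" "Re z \<le> T1" for z
  proof -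
    have "barrier z \<le> T1 + exp S"
    proof -
      have "Re z \<le> S" using that exp_ge_zero[of S] unfolding T1_def T_def by linarith
      have "barrier z \<le> Re z + exp (Re z)" by (rule barrier_le)
      also have "\<dots> \<le> T1 + exp S" using that \<open>Re z \<le> S\<close> by (intro add_mono) auto
      finally show ?thesis .
    qed
    also have "\<dots> \<le> H - (M + 1) / k - 1" by (simp add: T1_def T_def)
    finally have "k * (barrier z - H) \<le> k * (- ((M + 1) / k))" using k(1) by (intro mult_left_mono) auto
    also have "\<dots> = - (M + 1)" using k(1) by simp
    finally show ?thesis using QM[OF that(1)] by (simp add: f_def)
  qed
  define K where "K = closure D \<inter> {z. T1 \<le> Re z \<and> Re z \<le> S}"
  have "compact K"
  proof -
    have "closed K" unfolding K_def
      by (intro closed_Int closed_closure closed_Collect_conj closed_Collect_le continuous_intros)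
    moreover have "bounded K"
    proof (rule boundedI)
      fix z assume "z \<in> K"
      then have "\<bar>Re z\<bar> \<le> \<bar>T1\<bar> + \<bar>S\<bar>" "\<bar>Im z\<bar> \<le> \<bar>A\<bar> + \<bar>B\<bar>" using closure_strip[of z] by (auto simp: K_def)
      then show "norm z \<le> \<bar>T1\<bar> + \<bar>S\<bar> + (\<bar>A\<bar> + \<bar>B\<bar>)" using cmod_le[of z] by linarith
    qed
    ultimately show ?thesis by (simp add: compact_eq_bounded_closed)
  qed
  moreover have z0K: "z0 \<in> K"
  proof -
    have "z0 \<in> closure D" using z0 closure_subset by blast
    moreover have "T1 \<le> Re z0" using exp_ge_zero[of S] unfolding T1_def T_def by linarith
    moreover have "Re z0 \<le> S" by (simp add: S_def)
    ultimately show ?thesis by (simp add: K_def)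
  qed
  moreover have "continuous_on K f" unfolding f_def K_def
    by (intro continuous_intros cont_barrier continuous_on_subset[OF cont_Q]) auto
  ultimately obtain z where zK: "z \<in> K" "\<And>y. y \<in> K \<Longrightarrow> f y \<le> f z"
    using continuous_attains_sup[of K f] by blast
  have fz: "f z > 1 + c^2 + e" using zK(2)[OF z0K] fz0 by simp
  have zc: "z \<in> closure D" "T1 \<le> Re z" "Re z \<le> S" using zK by (auto simp: K_def)
  have fQ: "f z \<le> Q z" using barH[OF zc(3)] k(1) by (simp add: f_def mult_nonneg_nonpos)
  have zT: "T1 < Re z" using low[OF zc(1)] fz e by (smt (verit) zero_le_power2)
  have zS: "Re z < S" using farS[OF zc(1)] fz fQ by linarith
  have zN: "z \<notin> closure N" using Q_N[of z] fz fQ e by auto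
  have der_f: "(f has_derivative (\<lambda>h. (Qs y + k * bs y) * Re h + (Qt y + k * bt y) * Im h)) (at y)" if "y \<in> D" for y
    unfolding f_def
    by (rule has_derivative_eq_rhs, rule has_derivative_add[OF der_Q[OF that] has_derivative_mult_right[OF has_derivative_diff[OF der_barrier has_derivative_const]]])
      (auto simp: algebra_simps)
  show False
  proof (cases "A < Im z \<and> Im z < B")
    case True
    then have zD: "z \<in> D" using D_cl[OF zc(1)] zN closure_subset by blast
    obtain d0 where d0: "d0 > 0" "\<And>y. cmod (y - z) < d0 \<Longrightarrow> y \<in> D" using D_near[OF zD] by blast
    define d where "d = Min {d0, Re z - T1, S - Re z}"
    have d: "d > 0" "d \<le> d0" "d \<le> Re z - T1" "d \<le> S - Re z" using d0 zT zS by (auto simp: d_def)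
    have yK: "y \<in> K \<and> y \<in> D" if "cmod (y - z) < d" for y
    proof -
      have "y \<in> D" using d0(2) d that by simp
      moreover have "\<bar>Re y - Re z\<bar> < d" using that abs_Re_le_cmod[of "y - z"] by simp
      ultimately show ?thesis using closure_subset[of D] d by (auto simp: K_def)
    qed
    obtain q1 q2 r1 r2 where q: "(Qs has_derivative (\<lambda>h. q1 * Re h + q2 * Im h)) (at z)"
      "(Qt has_derivative (\<lambda>h. r1 * Re h + r2 * Im h)) (at z)" "q1 + r2 \<ge> 0" using laplacian_Q[OF zD] by blast
    define C where "C = exp (Re z) * cos ((Im z - (A + B) / 2) / 2)"
    have C: "C > 0"
    proof -
      define m where "m = (A + B) / 2"
      have "Im z - m < pi" "- pi < Im z - m" using True width by (auto simp: m_def field_simps)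
      then have "- (pi / 2) < (Im z - (A + B) / 2) / 2" "(Im z - (A + B) / 2) / 2 < pi / 2"
        unfolding m_def[symmetric] by (simp_all add: field_simps)
      then show ?thesis unfolding C_def by (intro mult_pos_pos cos_gt_zero_pi) auto
    qed
    \<comment> \<open>The barrier contributes \<open>C - C / 4 > 0\<close> to the Laplacian, which
      makes the subharmonicity of \<open>Q\<close> strict.\<close>
    have "(q1 + k * C) + (r2 + k * (- C / 4)) \<le> 0"
    proof (rule no_interior_max_of_pos_laplacian[OF d(1), of z f])
      show "(f has_derivative (\<lambda>h. (Qs y + k * bs y) * Re h + (Qt y + k * bt y) * Im h)) (at y)" if "cmod (y - z) < d" for y
        using der_f yK that by blast
      show "((\<lambda>y. Qs y + k * bs y) has_derivative (\<lambda>h. (q1 + k * C) * Re h + (q2 + k * bt z) * Im h)) (at z)"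
        by (rule has_derivative_eq_rhs, rule has_derivative_add[OF q(1) has_derivative_mult_right[OF der_bs]])
          (auto simp: C_def algebra_simps)
      show "((\<lambda>y. Qt y + k * bt y) has_derivative (\<lambda>h. (r1 + k * bt z) * Re h + (r2 + k * (- C / 4)) * Im h)) (at z)"
        by (rule has_derivative_eq_rhs, rule has_derivative_add[OF q(2) has_derivative_mult_right[OF der_bt]])
          (auto simp: C_def algebra_simps)
      show "f y \<le> f z" if "cmod (y - z) < d" for y using zK(2) yK that by blast
    qed
    moreover have "k * C > 0" using k(1) C by simp
    ultimately show False using q(3) by (simp add: algebra_simps)
  next
    case False
    then have line: "Im z = A \<or> Im z = B" using closure_strip[OF zc(1)] by auto
    obtain d where d: "d > 0" "\<And>y. cmod (y - z) < d \<Longrightarrow> A < Im y \<Longrightarrow> Im y < B \<Longrightarrow> y \<in> D"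
      "\<And>y. cmod (y - z) < d \<Longrightarrow> y \<notin> closure N"
      using line_fill[OF zc(1) zN] by blast
    \<comment> \<open>\<open>\<sigma>\<close> points from the line into the strip, and
      \<open>F\<close> is the derivative of \<open>f\<close> in that direction. At \<open>z\<close>
      the part from \<open>Q\<close> is zero because \<open>psi\<close> and \<open>wt\<close> vanish
      there, so the positive barrier part decides.\<close>
    define \<sigma> :: real where "\<sigma> = (if Im z = A then 1 else -1)"
    define F where "F = (\<lambda>y. \<sigma> * (Qt y + k * bt y))"
    have "continuous_on (closure D) F" unfolding F_def Qt_def
      by (intro continuous_intros cont_phi cont_psi cont cont_barrier) 
    moreover have Fz: "F z > 0"
    proof -
      have "Qt z = 0" using psi_line[OF zc(1) line] neumann_line[OF zc(1) line zN] by (simp add: Qt_def)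
      moreover have "\<sigma> * bt z = exp (Re z) * sin ((B - A) / 4) / 2"
      proof -
        define x where "x = (B - A) / 4"
        have x: "(A - (A + B) / 2) / 2 = - x" "(B - (A + B) / 2) / 2 = x"
          by (simp_all add: field_simps x_def)
        show ?thesis
        proof (cases "Im z = A")
          case True
          then show ?thesis by (simp only: \<sigma>_def bt_def x x_def[symmetric] if_True) simp
        next
          case False
          then have "Im z = B" "B \<noteq> A" using line AB by auto
          then show ?thesis unfolding \<sigma>_def bt_def x_def[symmetric] by (simp del: divide_divide_eq_left add: x)
        qed
      qed
      moreover have "sin ((B - A) / 4) > 0" using width AB by (intro sin_gt_zero) auto
      ultimately have "\<sigma> * bt z > 0" "F z = k * (\<sigma> * bt z)" by (simp_all only: F_def) simp_all
      then show ?thesis using k(1) by simp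
    qed
    ultimately obtain r where r: "r > 0" "\<And>y. y \<in> closure D \<Longrightarrow> dist y z < r \<Longrightarrow> dist (F y) (F z) < F z"
      using zc(1) unfolding continuous_on_iff by metis
    define t where "t = Min {d / 2, r / 2, (B - A) / 2}"
    have t: "t > 0" "t < d" "t < r" "t < B - A" using d r AB by (auto simp: t_def min_def)
    define g where "g = (\<lambda>x. f (Complex (Re z) (Im z + \<sigma> * x)))"
    have inD: "Complex (Re z) (Im z + \<sigma> * x) \<in> D" if "0 < x" "x \<le> t" for x
      using that t line by (intro d(2)) (auto simp: cmod_def \<sigma>_def abs_mult)
    have "g 0 < g t"
    proof (rule DERIV_pos_imp_increasing_open[OF t(1)])
      fix x assume x: "0 < x" "x < t"
      let ?y = "Complex (Re z) (Im z + \<sigma> * x)"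
      have y: "?y \<in> D" using inD x by simp
      have "(g has_real_derivative (Qt ?y + k * bt ?y) * \<sigma>) (at x)"
        unfolding g_def
        by (rule DERIV_chain2[where f = "\<lambda>t. f (Complex (Re z) t)" and g = "\<lambda>x. Im z + \<sigma> * x", OF has_derivative_Im_line[OF der_f[OF y]]])
          (auto intro!: derivative_eq_intros)
      moreover have "dist ?y z < r" using x t line by (auto simp: dist_norm cmod_def \<sigma>_def)
      then have "F ?y > 0" using r(2)[of ?y] y closure_subset[of D] by (auto simp: dist_real_def subset_iff abs_less_iff)
      ultimately show "\<exists>y. (g has_real_derivative y) (at x) \<and> 0 < y" by (auto simp: F_def mult.commute)
    next
      have "continuous_on (closure D) f" unfolding f_def by (intro continuous_intros cont_barrier cont_Q)
      then show "continuous_on {0..t} g" unfolding g_def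
      proof (rule continuous_on_compose2)
        show "continuous_on {0..t} (\<lambda>x. Complex (Re z) (Im z + \<sigma> * x))"
          by (intro continuous_on_Complex continuous_intros)
        show "(\<lambda>x. Complex (Re z) (Im z + \<sigma> * x)) ` {0..t} \<subseteq> closure D"
        proof (rule image_subsetI)
          fix x assume "x \<in> {0..t}"
          then show "Complex (Re z) (Im z + \<sigma> * x) \<in> closure D"
            using inD[of x] zc(1) closure_subset[of D] by (cases "x = 0") auto
        qed
      qed
    qed
    moreover have "Complex (Re z) (Im z + \<sigma> * t) \<in> K"
      using inD[of t] t zc closure_subset[of D] by (auto simp: K_def)
    ultimately show False using zK(2)[of "Complex (Re z) (Im z + \<sigma> * t)"] by (simp add: g_def)
  qed
qed

text \<open>If \<open>Qs\<close> were negative, \<open>Q\<close> would exceed its boundary value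
  just below \<open>N\<close>, against \<open>Q_le\<close>. Inserting \<open>gradient_N\<close> and
  \<open>nt = - slope * ns\<close> shows that \<open>Qs\<close> is a positive multiple of
  \<open>c * (phi - psi * slope)\<close>, and \<open>phi - psi * slope\<close> is the derivative of
  \<open>b\<close> along the graph.\<close>

lemma Qs_N: assumes z: "z \<in> N" shows "c * (phi z - psi z * slope z) \<ge> 0"
proof -
  have "Qs z \<ge> 0"
  proof (rule ccontr)
    assume n: "\<not> Qs z \<ge> 0"
    have "continuous_on (closure D) Qs" unfolding Qs_def by (intro continuous_intros cont_phi cont_psi cont)
    from N_line_approach[OF _ this, of z] z
    have "((\<lambda>s. Qs (Complex s (Im z))) \<longlongrightarrow> Qs z) (at_left (Re z))" by auto
    then have "\<forall>\<^sub>F s in at_left (Re z). Qs (Complex s (Im z)) < 0" using n by (intro order_tendstoD) auto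
    then obtain l where l: "l < Re z" "\<And>s. l < s \<Longrightarrow> s < Re z \<Longrightarrow> Qs (Complex s (Im z)) < 0"
      unfolding eventually_at_left_field by blast
    define m where "m = (l + Re z) / 2"
    have m: "l < m" "m < Re z" using l(1) by (auto simp: m_def)
    have inD: "Complex s (Im z) \<in> D" if "s < Re z" for s using down[of z] z that by auto
    define g where "g = (\<lambda>s. Q (Complex s (Im z)))"
    have gd: "(g has_real_derivative Qs (Complex s (Im z))) (at s)" if "s < Re z" for s
      unfolding g_def by (rule has_derivative_Re_line[OF der_Q[OF inD[OF that]]])
    have "g (Re z) < g m"
    proof (rule DERIV_neg_imp_decreasing_open[OF m(2)])
      show "\<exists>y. (g has_real_derivative y) (at x) \<and> y < 0" if "m < x" "x < Re z" for x
        using gd[OF that(2)] l(2)[of x] that m by auto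
      show "continuous_on {m..Re z} g" unfolding g_def
      proof (rule continuous_on_compose2[OF cont_Q])
        show "continuous_on {m..Re z} (\<lambda>x. Complex x (Im z))" by (intro continuous_on_Complex continuous_intros)
        show "(\<lambda>x. Complex x (Im z)) ` {m..Re z} \<subseteq> closure D"
        proof (rule image_subsetI)
          fix x assume "x \<in> {m..Re z}"
          then show "Complex x (Im z) \<in> closure D"
            using inD[of x] z N_closure closure_subset[of D] by (cases "x = Re z") auto
        qed
      qed
    qed
    moreover have "g m \<le> 1 + c^2" unfolding g_def by (rule Q_le[OF inD[OF m(2)]])
    moreover have "g (Re z) = 1 + c^2" using Q_N[of z] z closure_subset[of N] by (auto simp: g_def)
    ultimately show False by simp
  qed
  moreover have "Qs z = (2 * (cosh (Re z))^2 * ns z) * (c * (phi z - psi z * slope z))"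
    using ns_pos[OF z] by (simp add: Qs_def gradient_N[OF z] slope_def field_simps)
  moreover have "2 * (cosh (Re z))^2 * ns z > 0" using ns_pos[OF z] by simp
  ultimately show ?thesis by (simp add: zero_le_mult_iff)
qed

text \<open>For \<open>c = 0\<close> the gradient vanishes along \<open>N\<close>, so the Hessian is known there up to the equation.\<close>

lemma degenerate_N: assumes z: "z \<in> N" and c: "c = 0"
  shows "phi z - psi z * slope z = - ((sech (Re z))^2)"
proof -
  have zero: "ws y = 0" "wt y = 0" if "y \<in> N" for y using gradient_N[OF that] c by auto
  have 1: "wss z * slope z + wst z = 0"
    by (rule graph_derivative_zero[OF z _ der_ws cont(2,4,5)]) (use zero z in auto)
  have 2: "wst z * slope z + wtt z = 0"
    by (rule graph_derivative_zero[OF z _ der_wt cont(3,5,6)]) (use zero z in auto)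
  have 3: "wss z + wtt z + 2 * (sech (Re z))^2 = 0" using pde[of z] w_N[OF z] z N_closure by auto
  have "psi z = wst z" "phi z = wss z + (sech (Re z))^2" using zero[OF z] w_N[OF z] by (auto simp: phi_def psi_def)
  then show ?thesis using 2 3 by (simp add: algebra_simps)
qed

end

section \<open>The imaginary part of the holomorphic primitive\<close>

locale planar_conjugate = planar_overdetermined +
  fixes b :: "complex \<Rightarrow> real"
  assumes der_b: "z \<in> D \<Longrightarrow> (b has_derivative (\<lambda>h. - psi z * Re h + phi z * Im h)) (at z)"

context planar_conjugate
begin

lemma in_closure: "z \<in> D \<union> N \<Longrightarrow> z \<in> closure D"
  using closure_subset[of D] N_closure by auto

lemma phi_le: "z \<in> closure D \<Longrightarrow> \<bar>phi z\<bar> \<le> M * (sech (Re z))^2"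
  using phi_bound by (simp add: phi_def)

lemma psi_le: "z \<in> closure D \<Longrightarrow> \<bar>psi z\<bar> \<le> M * (sech (Re z))^2"
  using psi_bound by (simp add: psi_def)

lemma M_nonneg: "M \<ge> 0"
proof -
  obtain z where "z \<in> N" using N_nonempty by blast
  then have "0 \<le> M * (sech (Re z))^2" using phi_le[OF in_closure[of z]] by auto
  then show ?thesis by (simp add: zero_le_mult_iff)
qed

lemma DERIV_tanh_sech: "(tanh has_real_derivative (sech x)^2) (at x)"
  by (auto intro!: derivative_eq_intros simp: sech_sq)

text \<open>\<open>M * tanh\<close> has derivative \<open>M * (sech s)^2\<close>, which dominates
  \<open>\<bar>psi\<bar>\<close>, so it stays nondecreasing in \<open>s\<close> when
  \<open>b\<close> is added or subtracted. As \<open>tanh\<close> is bounded, this gives uniform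
  control at both ends.\<close>

lemma b_column:
  assumes "Complex s t \<in> D" "s' \<le> s"
  shows "\<bar>b (Complex s t) - b (Complex s' t)\<bar> \<le> M * (tanh s - tanh s')"
proof -
  have inD: "Complex x t \<in> D" if "x \<le> s" for x using D_down[OF assms(1), of x] that assms(1) by (cases "x = s") auto
  have db: "((\<lambda>x. b (Complex x t)) has_real_derivative - psi (Complex x t)) (at x)" if "x \<le> s" for x
    by (rule has_derivative_Re_line[OF der_b[OF inD[OF that]]])
  have psi: "\<bar>psi (Complex x t)\<bar> \<le> M * (sech x)^2" if "x \<le> s" for x
    using psi_le[OF in_closure, of "Complex x t"] inD[OF that] by simp
  have "M * tanh s' - b (Complex s' t) \<le> M * tanh s - b (Complex s t)"
  proof (rule DERIV_nonneg_imp_nondecreasing[OF assms(2)])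
    fix x assume "s' \<le> x" "x \<le> s"
    then show "\<exists>y. ((\<lambda>x. M * tanh x - b (Complex x t)) has_real_derivative y) (at x) \<and> 0 \<le> y"
      using psi[of x] by (intro exI[of _ "M * (sech x)^2 - - psi (Complex x t)"] conjI DERIV_diff DERIV_cmult DERIV_tanh_sech db) (auto simp: abs_le_iff)
  qed
  moreover have "M * tanh s' + b (Complex s' t) \<le> M * tanh s + b (Complex s t)"
  proof (rule DERIV_nonneg_imp_nondecreasing[OF assms(2)])
    fix x assume "s' \<le> x" "x \<le> s"
    then show "\<exists>y. ((\<lambda>x. M * tanh x + b (Complex x t)) has_real_derivative y) (at x) \<and> 0 \<le> y"
      using psi[of x] by (intro exI[of _ "M * (sech x)^2 + - psi (Complex x t)"] conjI DERIV_add DERIV_cmult DERIV_tanh_sech db) (auto simp: abs_le_iff)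
  qed
  ultimately show ?thesis by (simp add: abs_le_iff algebra_simps)
qed

lemma b_row:
  assumes "s < L" "A < t" "t \<le> t'" "t' < B"
  shows "\<bar>b (Complex s t') - b (Complex s t)\<bar> \<le> M * (sech s)^2 * (B - A)"
proof -
  have inD: "Complex s x \<in> D" if "t \<le> x" "x \<le> t'" for x using D_low[of "Complex s x"] assms that by auto
  have db: "((\<lambda>x. b (Complex s x)) has_real_derivative phi (Complex s x)) (at x)" if "t \<le> x" "x \<le> t'" for x
    by (rule has_derivative_Im_line[OF der_b[OF inD[OF that]]])
  have "\<bar>b (Complex s t') - b (Complex s t)\<bar> \<le> M * (sech s)^2 * (t' - t)"
  proof (rule mean_value_bound[OF assms(3)])
    show "continuous_on {t..t'} (\<lambda>x. b (Complex s x))" by (rule DERIV_continuous_on_Icc, rule db)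
    show "((\<lambda>x. b (Complex s x)) has_real_derivative phi (Complex s x)) (at x)" if "t < x" "x < t'" for x
      using db that by simp
    show "\<bar>phi (Complex s x)\<bar> \<le> M * (sech s)^2" if "t < x" "x < t'" for x
      using phi_le[OF in_closure, of "Complex s x"] inD[of x] that by simp
  qed
  also have "\<dots> \<le> M * (sech s)^2 * (B - A)" using M_nonneg assms by (intro mult_left_mono) auto
  finally show ?thesis .
qed

text \<open>Along the middle column \<open>b\<close> is Cauchy by \<open>b_column\<close>. The
  oscillation across a row tends to 0 with \<open>sech\<close>, so all columns share the limit
  \<open>l\<close>, the value of the conjugate function at the vertex \<open>p\<close>.\<close>

lemma b_limit_at_cusp:
  "\<exists>l. \<forall>z\<in>D. \<bar>b z - l\<bar> \<le> M * (1 + tanh (Re z))"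
proof -
  define m where "m = (A + B) / 2"
  have m: "A < m" "m < B" using AB by (auto simp: m_def)
  define y where "y = (\<lambda>n. L - 1 - real n)"
  have y: "y n < L" for n by (simp add: y_def)
  have yD: "Complex (y n) t \<in> D" if "A < t" "t < B" for n t using D_low[of "Complex (y n) t"] y that by simp
  have "filterlim y at_bot sequentially" unfolding filterlim_at_bot eventually_sequentially
  proof
    fix Z
    obtain N0 where "L - 1 - Z \<le> real N0" using real_arch_simple by blast
    then show "\<exists>N. \<forall>n\<ge>N. y n \<le> Z" by (intro exI[of _ N0]) (auto simp: y_def)
  qed
  then have ty: "(\<lambda>n. tanh (y n)) \<longlonglongrightarrow> -1" by (rule filterlim_compose[OF tanh_real_at_bot])
  define x where "x = (\<lambda>n. b (Complex (y n) m))"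
  have dxy: "dist (x i) (x j) \<le> dist (M * tanh (y i)) (M * tanh (y j))" for i j
  proof -
    have "\<bar>x i - x j\<bar> \<le> \<bar>M * tanh (y i) - M * tanh (y j)\<bar>" if "i \<le> j" for i j
      using b_column[OF yD[OF m], of "y j" i] that by (auto simp: x_def y_def algebra_simps)
    from this[of i j] this[of j i] show ?thesis unfolding dist_real_def by (cases "i \<le> j") (auto simp: abs_minus_commute)
  qed
  have "Cauchy (\<lambda>n. M * tanh (y n))"
    by (intro LIMSEQ_imp_Cauchy[of _ "M * (-1)"] tendsto_mult ty tendsto_const)
  then have "Cauchy x" using dxy unfolding Cauchy_def by (meson le_less_trans)
  then obtain l where l: "x \<longlonglongrightarrow> l" using Cauchy_convergent convergent_def by blast
  have "\<bar>b z - l\<bar> \<le> M * (1 + tanh (Re z))" if z: "z \<in> D" for z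
  proof -
    have st: "A < Im z" "Im z < B" using D_strip[OF z] by auto
    have 1: "(\<lambda>n. \<bar>b z - x n\<bar>) \<longlonglongrightarrow> \<bar>b z - l\<bar>" by (intro tendsto_intros l)
    have 2: "(\<lambda>n. M * (tanh (Re z) - tanh (y n)) + M * (1 - (tanh (y n))^2) * (B - A)) \<longlonglongrightarrow> M * (tanh (Re z) - (-1)) + M * (1 - (-1)^2) * (B - A)"
      by (intro tendsto_intros ty)
    have "\<forall>\<^sub>F n in sequentially. y n \<le> Re z"
      using \<open>filterlim y at_bot sequentially\<close> unfolding filterlim_at_bot by blast
    then have "\<forall>\<^sub>F n in sequentially. \<bar>b z - x n\<bar> \<le> M * (tanh (Re z) - tanh (y n)) + M * (1 - (tanh (y n))^2) * (B - A)"
    proof eventually_elim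
      case (elim n)
      have "\<bar>b z - b (Complex (y n) (Im z))\<bar> \<le> M * (tanh (Re z) - tanh (y n))"
        using b_column[of "Re z" "Im z" "y n"] z elim by simp
      moreover have "\<bar>b (Complex (y n) (Im z)) - x n\<bar> \<le> M * (sech (y n))^2 * (B - A)"
        using b_row[OF y, of m "Im z" n] b_row[OF y, of "Im z" m n] st m
        by (cases "m \<le> Im z") (auto simp: x_def abs_minus_commute)
      ultimately show ?case unfolding sech_sq by linarith
    qed
    from tendsto_le[OF _ 2 1 this] show ?thesis by (simp add: add.commute)
  qed
  then show ?thesis by blast
qed

end

locale planar_normalized = planar_conjugate +
  assumes b_low: "z \<in> D \<Longrightarrow> \<bar>b z\<bar> \<le> M * (1 + tanh (Re z))"
begin

text \<open>Extension of \<open>b\<close> to \<open>N\<close> by radial limits.\<close>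

definition bx :: "complex \<Rightarrow> real" where
  "bx z = (if z \<in> N then Lim (at_left (Re z)) (\<lambda>s. b (Complex s (Im z))) else b z)"

lemma bx_D: "z \<in> D \<Longrightarrow> bx z = b z" using DN by (auto simp: bx_def)

text \<open>\<open>b + M * tanh\<close> is nondecreasing and bounded along the column, so the radial
  limit exists.\<close>

lemma bx_N: assumes z: "z \<in> N" shows "((\<lambda>s. b (Complex s (Im z))) \<longlongrightarrow> bx z) (at_left (Re z))"
proof -
  define g where "g = (\<lambda>s. b (Complex s (Im z)) + M * tanh s)"
  have inD: "Complex s (Im z) \<in> D" if "s < Re z" for s using down[of z] z that by auto
  have "(g \<longlongrightarrow> Sup (g ` ({..<Re z} \<inter> {..<Re z}))) (at (Re z) within {..<Re z} \<inter> {..<Re z})"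
  proof (rule Lim_left_bound)
    show "g s \<le> g t" if "s \<in> {..<Re z}" "t \<in> {..<Re z}" "t < Re z" "s \<le> t" for s t
      using b_column[OF inD[of t], of s] that by (simp add: g_def abs_le_iff algebra_simps)
    show "g s \<le> M * (1 + 1) + M * 1" if "s \<in> {..<Re z}" "s < Re z" for s
    proof -
      have "M * (1 + tanh s) \<le> M * (1 + 1)" "M * tanh s \<le> M * 1"
        by (rule mult_left_mono; use M_nonneg tanh_real_lt_1[of s] in simp)+
      moreover have "b (Complex s (Im z)) \<le> M * (1 + tanh s)" using b_low[OF inD[OF that(2)]] by (simp add: abs_le_iff)
      ultimately show ?thesis unfolding g_def by linarith
    qed
  qed
  then obtain l where "(g \<longlongrightarrow> l) (at_left (Re z))" by auto
  then have "((\<lambda>s. g s - M * tanh s) \<longlongrightarrow> l - M * tanh (Re z)) (at_left (Re z))" by (intro tendsto_intros) auto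
  then have l: "((\<lambda>s. b (Complex s (Im z))) \<longlongrightarrow> l - M * tanh (Re z)) (at_left (Re z))" by (simp add: g_def)
  then show ?thesis using tendsto_Lim[OF _ l] z by (simp add: bx_def)
qed

lemma bx_N_le:
  assumes z: "z \<in> N" and "l < Re z" and "\<And>s. l < s \<Longrightarrow> s < Re z \<Longrightarrow> \<bar>b (Complex s (Im z))\<bar> \<le> m"
  shows "\<bar>bx z\<bar> \<le> m"
proof (rule tendsto_upperbound[OF tendsto_rabs[OF bx_N[OF z]]])
  show "\<forall>\<^sub>F s in at_left (Re z). \<bar>b (Complex s (Im z))\<bar> \<le> m"
    unfolding eventually_at_left_field using assms by blast
qed simp

lemma bx_low: assumes z: "z \<in> D \<union> N" shows "\<bar>bx z\<bar> \<le> M * (1 + tanh (Re z))"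
proof (cases "z \<in> N")
  case False
  then show ?thesis using z b_low bx_D by auto
next
  case True
  show ?thesis
  proof (rule bx_N_le[OF True, of "Re z - 1"])
    fix s assume s: "s < Re z"
    have "\<bar>b (Complex s (Im z))\<bar> \<le> M * (1 + tanh s)" using b_low[OF down[OF z s]] by simp
    also have "\<dots> \<le> M * (1 + tanh (Re z))" using s M_nonneg by (intro mult_left_mono) auto
    finally show "\<bar>b (Complex s (Im z))\<bar> \<le> M * (1 + tanh (Re z))" .
  qed simp
qed

lemma der_bx: assumes z: "z \<in> D" shows "(bx has_derivative (\<lambda>h. - psi z * Re h + phi z * Im h)) (at z)"
  by (rule has_derivative_transform_within_open[OF der_b[OF z] D_open z]) (simp add: bx_D)

lemma bx_left: assumes z: "z \<in> N" shows "((\<lambda>s. bx (Complex s (Im z))) \<longlongrightarrow> bx z) (at_left (Re z))"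
proof (rule Lim_transform_eventually[OF bx_N[OF z]])
  show "\<forall>\<^sub>F s in at_left (Re z). b (Complex s (Im z)) = bx (Complex s (Im z))"
    unfolding eventually_at_left_field using down[of z] z bx_D by (intro exI[of _ "Re z - 1"]) auto
qed

lemma bx_expansion:
  assumes z: "z \<in> N" and e: "e > 0"
  obtains d where "d > 0" "\<And>y. y \<in> D \<union> N \<Longrightarrow> cmod (y - z) < d \<Longrightarrow>
     \<bar>bx y - bx z + psi z * (Re y - Re z) - phi z * (Im y - Im z)\<bar> \<le> e * cmod (y - z)"
proof -
  have c: "continuous_on (closure D) (\<lambda>z. - psi z)" by (intro continuous_intros cont_psi)
  from boundary_expansion[OF z der_bx bx_left cont_lim[OF c z] cont_lim[OF cont_phi z] e]
  obtain d where "d > 0" "\<And>y. y \<in> D \<union> N \<Longrightarrow> cmod (y - z) < d \<Longrightarrow>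
     \<bar>bx y - bx z - (- psi z) * (Re y - Re z) - phi z * (Im y - Im z)\<bar> \<le> e * cmod (y - z)" by meson
  then show thesis using that[of d] by simp
qed

lemma cont_bx: "continuous_on (D \<union> N) bx"
proof (unfold continuous_on_eq_continuous_within, intro ballI)
  fix z assume z: "z \<in> D \<union> N"
  show "continuous (at z within D \<union> N) bx"
  proof (cases "z \<in> D")
    case True
    then show ?thesis using has_derivative_continuous[OF der_bx] continuous_at_imp_continuous_at_within by blast
  next
    case False
    then have zN: "z \<in> N" using z by auto
    obtain d where d: "d > 0" "\<And>y. y \<in> D \<union> N \<Longrightarrow> cmod (y - z) < d \<Longrightarrow>
     \<bar>bx y - bx z + psi z * (Re y - Re z) - phi z * (Im y - Im z)\<bar> \<le> 1 * cmod (y - z)"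
      using bx_expansion[OF zN zero_less_one] by blast
    define k where "k = \<bar>psi z\<bar> + \<bar>phi z\<bar> + 1"
    have bd: "dist (bx y) (bx z) \<le> k * dist y z" if y: "y \<in> D \<union> N" "dist y z < d" for y
    proof -
      have "\<bar>bx y - bx z\<bar> \<le> \<bar>bx y - bx z + psi z * (Re y - Re z) - phi z * (Im y - Im z)\<bar> + \<bar>psi z * (Re y - Re z)\<bar> + \<bar>phi z * (Im y - Im z)\<bar>"
        by linarith
      also have "\<dots> \<le> 1 * cmod (y - z) + \<bar>psi z\<bar> * cmod (y - z) + \<bar>phi z\<bar> * cmod (y - z)"
        using d(2)[OF y(1)] y(2) abs_Re_le_cmod[of "y - z"] abs_Im_le_cmod[of "y - z"]
        unfolding abs_mult dist_norm by (intro add_mono mult_left_mono) auto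
      finally show ?thesis by (simp add: k_def dist_norm algebra_simps)
    qed
    have k: "k > 0" by (simp add: k_def add_nonneg_pos)
    show ?thesis
      unfolding continuous_within_eps_delta
    proof (intro allI impI)
      fix e :: real assume e: "e > 0"
      have "dist (bx y) (bx z) < e" if "y \<in> D \<union> N" "dist y z < min d (e / k)" for y
      proof -
        have "dist (bx y) (bx z) \<le> k * dist y z" using that by (intro bd) auto
        also have "\<dots> < e" using that k by (simp add: field_simps)
        finally show ?thesis .
      qed
      moreover have "min d (e / k) > 0" using d(1) e k by simp
      ultimately show "\<exists>d>0. \<forall>y\<in>D \<union> N. dist y z < d \<longrightarrow> dist (bx y) (bx z) < e" by blast
    qed
  qed
qed

lemma low_abscissa: assumes "e > 0" obtains s where "s < S" "M * (1 + tanh s) \<le> e"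
proof -
  have "((\<lambda>s. M * (1 + tanh s)) \<longlongrightarrow> M * (1 + (-1))) at_bot"
    by (intro tendsto_intros tanh_real_at_bot)
  then have "((\<lambda>s. M * (1 + tanh s)) \<longlongrightarrow> 0) at_bot" by simp
  then have "\<forall>\<^sub>F s in at_bot. M * (1 + tanh s) < e" using assms by (rule order_tendstoD)
  then obtain u where u: "\<And>s. s \<le> u \<Longrightarrow> M * (1 + tanh s) < e" unfolding eventually_at_bot_linorder by blast
  show thesis by (rule that[of "min u (S - 1)"]) (use u[of "min u (S - 1)"] in auto)
qed

text \<open>Since \<open>psi\<close> vanishes on both lines, compactness makes it small on columns
  near them, and integrating from an abscissa where \<open>b\<close> is already small keeps
  \<open>b\<close> small up to \<open>S\<close>. The bound is uniform in the column, including the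
  part next to a corner.\<close>

lemma b_line:
  assumes e: "e > 0"
  obtains \<delta> where "\<delta> > 0" "\<And>z. z \<in> D \<union> N \<Longrightarrow> Re z \<le> S \<Longrightarrow> Im z < A + \<delta> \<or> B - \<delta> < Im z \<Longrightarrow> \<bar>bx z\<bar> \<le> e"
proof -
  have e2: "e / 2 > 0" using e by simp
  obtain s1 where s1: "s1 < S" "M * (1 + tanh s1) \<le> e / 2" using low_abscissa[OF e2] by blast
  define l where "l = S - s1"
  define \<eta> where "\<eta> = e / (2 * l)"
  have l: "l > 0" using s1 by (simp add: l_def)
  then have \<eta>: "\<eta> > 0" "\<eta> * l = e / 2" using e by (auto simp: \<eta>_def)
  \<comment> \<open>The part of the truncated closure where \<open>psi\<close> is not small. It is
    compact and misses both lines, which yields the distance \<delta>.\<close>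
  define K where "K = {z \<in> closure D. \<eta> \<le> \<bar>psi z\<bar>} \<inter> {z. s1 \<le> Re z \<and> Re z \<le> S}"
  have "compact K"
  proof -
    have "closed K" unfolding K_def
      by (intro closed_Int closed_closure closed_Collect_conj closed_Collect_le continuous_on_closed_Collect_le continuous_intros cont_psi)
    moreover have "bounded K"
    proof (rule boundedI)
      fix z assume "z \<in> K"
      then have "\<bar>Re z\<bar> \<le> \<bar>s1\<bar> + \<bar>S\<bar>" "\<bar>Im z\<bar> \<le> \<bar>A\<bar> + \<bar>B\<bar>" using closure_strip[of z] by (auto simp: K_def)
      then show "norm z \<le> \<bar>s1\<bar> + \<bar>S\<bar> + (\<bar>A\<bar> + \<bar>B\<bar>)" using cmod_le[of z] by linarith
    qed
    ultimately show ?thesis by (simp add: compact_eq_bounded_closed)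
  qed
  have "\<exists>\<delta>>0. \<forall>z\<in>K. \<delta> \<le> min (Im z - A) (B - Im z)"
  proof (cases "K = {}")
    case True
    then show ?thesis by (intro exI[of _ 1]) auto
  next
    case False
    have "continuous_on K (\<lambda>z. min (Im z - A) (B - Im z))" by (intro continuous_intros)
    from continuous_attains_inf[OF \<open>compact K\<close> False this]
    obtain z where z: "z \<in> K" "\<And>y. y \<in> K \<Longrightarrow> min (Im z - A) (B - Im z) \<le> min (Im y - A) (B - Im y)" by blast
    have zc: "z \<in> closure D" "psi z \<noteq> 0" using z(1) \<eta>(1) by (auto simp: K_def)
    then have "A < Im z" "Im z < B" using psi_line[OF zc(1)] closure_strip[OF zc(1)] by force+
    then show ?thesis using z(2) by (intro exI[of _ "min (Im z - A) (B - Im z)"]) auto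
  qed
  then obtain \<delta> where \<delta>: "\<delta> > 0" "\<And>z. z \<in> K \<Longrightarrow> \<delta> \<le> min (Im z - A) (B - Im z)" by blast
  have main: "\<bar>b z\<bar> \<le> e" if z: "z \<in> D" "Re z \<le> S" "Im z < A + \<delta> \<or> B - \<delta> < Im z" for z
  proof (cases "Re z \<le> s1")
    case True
    have "\<bar>b z\<bar> \<le> M * (1 + tanh (Re z))" by (rule b_low[OF z(1)])
    also have "\<dots> \<le> M * (1 + tanh s1)" using True M_nonneg by (intro mult_left_mono) auto
    finally show ?thesis using s1(2) e by simp
  next
    case False
    have inD: "Complex x (Im z) \<in> D" if "x \<le> Re z" for x
      using D_down[of "Re z" "Im z" x] z(1) that by (cases "x = Re z") auto
    have db: "((\<lambda>x. b (Complex x (Im z))) has_real_derivative - psi (Complex x (Im z))) (at x)" if "x \<le> Re z" for x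
      by (rule has_derivative_Re_line[OF der_b[OF inD[OF that]]])
    have "\<bar>b (Complex (Re z) (Im z)) - b (Complex s1 (Im z))\<bar> \<le> \<eta> * (Re z - s1)"
    proof (rule mean_value_bound)
      show "((\<lambda>x. b (Complex x (Im z))) has_real_derivative - psi (Complex x (Im z))) (at x)" if "x < Re z" for x
        using db that by simp
      show "continuous_on {s1..Re z} (\<lambda>x. b (Complex x (Im z)))" by (rule DERIV_continuous_on_Icc, rule db)
      show "s1 \<le> Re z" using False by simp
      show "\<bar>- psi (Complex x (Im z))\<bar> \<le> \<eta>" if "s1 < x" "x < Re z" for x
      proof (rule ccontr)
        assume "\<not> ?thesis"
        then have "Complex x (Im z) \<in> K" using in_closure[of "Complex x (Im z)"] inD[of x] that z(2) by (auto simp: K_def)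
        then show False using \<delta>(2)[of "Complex x (Im z)"] z(3) by auto
      qed
    qed
    also have "\<dots> \<le> \<eta> * l" using \<eta>(1) z(2) by (intro mult_left_mono) (auto simp: l_def)
    finally have "\<bar>b z - b (Complex s1 (Im z))\<bar> \<le> e / 2" using \<eta>(2) by simp
    moreover have "\<bar>b (Complex s1 (Im z))\<bar> \<le> e / 2" using b_low[OF inD[of s1]] s1(2) False by simp
    ultimately show ?thesis using abs_triangle_ineq[of "b z - b (Complex s1 (Im z))" "b (Complex s1 (Im z))"] by simp
  qed
  have "\<bar>bx z\<bar> \<le> e" if z: "z \<in> D \<union> N" "Re z \<le> S" "Im z < A + \<delta> \<or> B - \<delta> < Im z" for z
  proof (cases "z \<in> N")
    case False
    then show ?thesis using z main bx_D by auto
  next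
    case True
    show ?thesis
      by (rule bx_N_le[OF True, of "Re z - 1"]) (use main[OF down[OF z(1)]] z in auto)
  qed
  then show thesis using that \<delta>(1) by blast
qed

text \<open>What counts is that one sign serves all of \<open>N\<close>, so that \<open>b\<close> is
  monotone along it: the sign of \<open>c\<close>, or \<open>-1\<close> for \<open>c = 0\<close> by
  \<open>degenerate_N\<close>.\<close>

lemma sign_N: "\<exists>\<kappa>. \<bar>\<kappa>\<bar> = 1 \<and> (\<forall>z\<in>N. \<kappa> * (phi z - psi z * slope z) \<ge> 0)"
proof (cases "c = 0")
  case True
  show ?thesis using degenerate_N[OF _ True] by (intro exI[of _ "-1"]) auto
next
  case False
  show ?thesis
  proof (intro exI[of _ "sgn c"] conjI ballI)
    show "\<bar>sgn c\<bar> = 1" using False by (simp add: abs_sgn_eq)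
    fix z assume "z \<in> N"
    from Qs_N[OF this] False show "0 \<le> sgn c * (phi z - psi z * slope z)"
      by (auto simp: sgn_if zero_le_mult_iff)
  qed
qed

definition g :: "real \<Rightarrow> real \<Rightarrow> real" where "g S t = bx (Complex (top S t) t)"

lemma top_in: "A < t \<Longrightarrow> t < B \<Longrightarrow> Complex (top S t) t \<in> D \<union> N"
  using top_cases[of t S] by auto

lemma top_continuous_on: "X \<subseteq> {A<..<B} \<Longrightarrow> continuous_on X (top S)"
  using top_cont by (intro continuous_at_imp_continuous_on) auto

lemma cont_g: assumes "A < t" "t < B" shows "isCont (g S) t"
proof -
  have "continuous_on {A<..<B} (g S)" unfolding g_def
  proof (rule continuous_on_compose2[OF cont_bx])
    show "continuous_on {A<..<B} (\<lambda>x. Complex (top S x) x)" by (intro continuous_on_Complex top_continuous_on continuous_intros) auto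
    show "(\<lambda>x. Complex (top S x) x) ` {A<..<B} \<subseteq> D \<union> N"
      by (rule image_subsetI, rule top_in) auto
  qed
  then show ?thesis unfolding continuous_on_eq_continuous_at[OF open_greaterThanLessThan] using assms by simp
qed

text \<open>Along \<open>N\<close> the function \<open>\<kappa> * g S\<close> cannot decrease to
  first order, by the choice of \<kappa>. On the artificial cut \<open>Re = S\<close> its derivative
  is \<open>\<kappa> * phi\<close>, of size at most \<open>M * (sech S)^2\<close>. A point of
  \<open>N\<close> on the level \<open>S\<close> may have neighbours of both kinds, hence a
  one-sided quotient.\<close>

lemma top_quotient:
  assumes \<kappa>: "\<bar>\<kappa>\<bar> = 1" "\<And>z. z \<in> N \<Longrightarrow> \<kappa> * (phi z - psi z * slope z) \<ge> 0"
    and t: "A < t" "t < B" and e: "e > 0"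
  shows "\<exists>d>0. \<forall>x. t < x \<and> x < t + d \<longrightarrow> \<kappa> * g S x - \<kappa> * g S t \<ge> - (M * (sech S)^2 + e) * (x - t)"
  using top_cases[OF t, of S]
proof
  assume D: "top S t = S \<and> Complex S t \<in> D"
  then obtain d0 where d0: "d0 > 0" "\<And>y. cmod (y - Complex S t) < d0 \<Longrightarrow> y \<in> D" using D_near by metis
  have inD: "Complex S x \<in> D" if "\<bar>x - t\<bar> < d0" for x
    by (rule d0(2)) (use that in \<open>simp add: cmod_Complex_same_Re\<close>)
  have gx: "g S x = b (Complex S x)" if "\<bar>x - t\<bar> < d0" for x
  proof -
    have st: "A < x" "x < B" using D_strip[OF inD[OF that]] by auto
    have "top S x = S" using le_top[OF st, of S S] top_le[OF st, of S] inD[OF that] by auto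
    then show ?thesis using bx_D[OF inD[OF that]] by (simp add: g_def)
  qed
  have "\<kappa> * g S x - \<kappa> * g S t \<ge> - (M * (sech S)^2 + e) * (x - t)" if "t < x" "x < t + d0" for x
  proof -
    have "\<bar>b (Complex S x) - b (Complex S t)\<bar> \<le> M * (sech S)^2 * (x - t)"
    proof (rule mean_value_bound)
      have near: "\<bar>y - t\<bar> < d0" if "t \<le> y" "y \<le> x" for y using that \<open>x < t + d0\<close> by auto
      have db: "((\<lambda>x. b (Complex S x)) has_real_derivative phi (Complex S y)) (at y)" if "t \<le> y" "y \<le> x" for y
        by (rule has_derivative_Im_line[OF der_b[OF inD[OF near[OF that]]]])
      show "continuous_on {t..x} (\<lambda>x. b (Complex S x))" by (rule DERIV_continuous_on_Icc, rule db)
      show "((\<lambda>x. b (Complex S x)) has_real_derivative phi (Complex S y)) (at y)" if "t < y" "y < x" for y using db that by simp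
      show "\<bar>phi (Complex S y)\<bar> \<le> M * (sech S)^2" if "t < y" "y < x" for y
        using phi_le[OF in_closure, of "Complex S y"] inD[OF near, of y] that by simp
      show "t \<le> x" using that by simp
    qed
    then have "\<bar>\<kappa> * g S x - \<kappa> * g S t\<bar> \<le> M * (sech S)^2 * (x - t)"
      using gx[of x] gx[of t] that \<kappa>(1) d0(1) by (simp add: abs_mult right_diff_distrib[symmetric])
    moreover have "e * (x - t) \<ge> 0" using e that by simp
    ultimately show ?thesis by (simp add: abs_le_iff algebra_simps)
  qed
  then show ?thesis using d0(1) by blast
next
  define z where "z = Complex (top S t) t"
  assume "Complex (top S t) t \<in> N"
  then have zN: "z \<in> N" by (simp add: z_def)
  have zS: "Re z \<le> S" using top_le[OF t] by (simp add: z_def)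
  define m where "m = slope z"
  define k where "k = \<bar>psi z\<bar> + \<bar>m\<bar> + 2"
  have k: "k > 0" by (simp add: k_def)
  define e1 where "e1 = min 1 (e / k)"
  have e1: "e1 > 0" "e1 \<le> 1" "e1 * k \<le> e" using e k by (auto simp: e1_def min_def field_simps)
  obtain d1 where d1: "d1 > 0" "\<And>y. y \<in> D \<union> N \<Longrightarrow> cmod (y - z) < d1 \<Longrightarrow>
     \<bar>bx y - bx z + psi z * (Re y - Re z) - phi z * (Im y - Im z)\<bar> \<le> e1 * cmod (y - z)"
    using bx_expansion[OF zN e1(1)] by blast
  obtain d2 where d2: "d2 > 0" "\<And>y. y \<in> N \<Longrightarrow> cmod (y - z) < d2 \<Longrightarrow> \<bar>Re y - Re z - m * (Im y - Im z)\<bar> \<le> e1 * \<bar>Im y - Im z\<bar>"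
    using N_slope[OF zN e1(1)] unfolding m_def by blast
  define d3 where "d3 = (if Re z = S then 1 else S - Re z)"
  have d3: "d3 > 0" using zS by (simp add: d3_def)
  define r where "r = Min {d1, d2, d3}"
  have r: "r > 0" using d1 d2 d3 by (simp add: r_def)
  obtain d where d: "d > 0" "\<And>x. \<bar>x - Im z\<bar> < d \<Longrightarrow> A < x \<and> x < B \<and> cmod (Complex (top S x) x - z) < r"
    using top_near_N[OF zN zS r] by blast
  have "\<kappa> * g S x - \<kappa> * g S t \<ge> - (M * (sech S)^2 + e) * (x - t)" if x: "t < x" "x < t + d" for x
  proof -
    define y where "y = Complex (top S x) x"
    have y: "A < x" "x < B" "cmod (y - z) < d1" "cmod (y - z) < d2" "cmod (y - z) < d3"
      using d(2)[of x] x by (auto simp: y_def z_def r_def)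
    have yDN: "y \<in> D \<union> N" unfolding y_def by (rule top_in[OF y(1,2)])
    define a where "a = Re y - Re z"
    define h where "h = x - t"
    have h: "h > 0" "Im y - Im z = h" using x by (auto simp: h_def y_def z_def)
    define E where "E = bx y - bx z + psi z * a - phi z * h"
    have E: "\<bar>E\<bar> \<le> e1 * cmod (y - z)" using d1(2)[OF yDN y(3)] by (simp add: E_def a_def h(2))
    have yz: "cmod (y - z) \<le> \<bar>a\<bar> + h" using cmod_le[of "y - z"] h by (simp add: a_def)
    have diff: "\<kappa> * g S x - \<kappa> * g S t = \<kappa> * (phi z * h - psi z * a) + \<kappa> * E"
      by (simp add: E_def g_def y_def[symmetric] z_def[symmetric] algebra_simps)
    have kE: "\<kappa> * E \<ge> - (e1 * (\<bar>a\<bar> + h))"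
    proof -
      have "\<bar>\<kappa> * E\<bar> = \<bar>E\<bar>" using \<kappa>(1) by (simp add: abs_mult)
      moreover have "e1 * cmod (y - z) \<le> e1 * (\<bar>a\<bar> + h)" using yz e1(1) by (intro mult_left_mono) auto
      ultimately show ?thesis using E by linarith
    qed
    show ?thesis
    proof (cases "y \<in> N")
      case True
      have am: "\<bar>a - m * h\<bar> \<le> e1 * h" using d2(2)[OF True y(4)] h by (simp add: a_def)
      have mh: "\<bar>m * h\<bar> = \<bar>m\<bar> * h" using h by (simp add: abs_mult)
      have "e1 * h \<le> h" using e1 h by simp
      then have a: "\<bar>a\<bar> \<le> (\<bar>m\<bar> + 1) * h" using am mh unfolding distrib_right by linarith
      have "phi z * h - psi z * a = (phi z - psi z * m) * h - psi z * (a - m * h)" by (simp add: algebra_simps)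
      then have "\<kappa> * (phi z * h - psi z * a) = (\<kappa> * (phi z - psi z * m)) * h - \<kappa> * (psi z * (a - m * h))"
        by (simp add: algebra_simps)
      moreover have "(\<kappa> * (phi z - psi z * m)) * h \<ge> 0" using \<kappa>(2)[OF zN] h by (simp add: m_def)
      moreover have "\<bar>\<kappa> * (psi z * (a - m * h))\<bar> \<le> \<bar>psi z\<bar> * (e1 * h)"
        using \<kappa>(1) am by (simp add: abs_mult mult_left_mono)
      moreover have "e1 * (\<bar>a\<bar> + h) \<le> e1 * ((\<bar>m\<bar> + 2) * h)" using a e1 by (intro mult_left_mono) (auto simp: algebra_simps)
      ultimately have "\<kappa> * g S x - \<kappa> * g S t \<ge> - (\<bar>psi z\<bar> * (e1 * h)) - e1 * ((\<bar>m\<bar> + 2) * h)"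
        using kE diff by linarith
      also have "- (\<bar>psi z\<bar> * (e1 * h)) - e1 * ((\<bar>m\<bar> + 2) * h) = - (e1 * k * h)" by (simp add: k_def algebra_simps)
      finally have "\<kappa> * g S x - \<kappa> * g S t \<ge> - (e1 * k * h)" .
      moreover have "e1 * k * h \<le> e * h" using e1 h by (intro mult_right_mono) auto
      moreover have "M * (sech S)^2 * h \<ge> 0" using M_nonneg h by simp
      ultimately show ?thesis by (simp add: h_def[symmetric] algebra_simps)
    next
      case False
      then have tx: "top S x = S" using top_cases[OF y(1,2), of S] by (auto simp: y_def)
      have "\<bar>Re y - Re z\<bar> < d3" using y(5) abs_Re_le_cmod[of "y - z"] by simp
      then have RzS: "Re z = S" using tx zS by (auto simp: y_def d3_def split: if_splits)
      then have a: "a = 0" by (simp add: a_def y_def tx)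
      have "\<bar>\<kappa> * (phi z * h)\<bar> \<le> M * (sech S)^2 * h"
        using phi_le[OF in_closure, of z] zN \<kappa>(1) h RzS by (simp add: abs_mult mult_right_mono)
      moreover have "e1 * h \<le> e * h"
      proof -
        have "e1 * 1 \<le> e1 * k" using e1 by (intro mult_left_mono) (auto simp: k_def)
        then have "e1 \<le> e" using e1(3) by linarith
        then show ?thesis using h by (intro mult_right_mono) auto
      qed
      ultimately show ?thesis using diff kE unfolding a h_def[symmetric] by (simp add: algebra_simps)
    qed
  qed
  then show ?thesis using d(1) by blast
qed

text \<open>By \<open>b_line\<close>, \<open>g S\<close> tends to 0 at both ends of the interval. A
  function with this property that can decrease by at most \<open>\<eta> * (B - A)\<close> in total,
  after multiplication by \<kappa>, is bounded by that amount.\<close>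

lemma top_bound:
  assumes t: "A < t" "t < B" shows "\<bar>g S t\<bar> \<le> M * (sech S)^2 * (B - A)"
proof -
  obtain \<kappa> where \<kappa>: "\<bar>\<kappa>\<bar> = 1" "\<And>z. z \<in> N \<Longrightarrow> \<kappa> * (phi z - psi z * slope z) \<ge> 0" using sign_N by blast
  define \<eta> where "\<eta> = M * (sech S)^2"
  have \<eta>: "\<eta> \<ge> 0" using M_nonneg by (simp add: \<eta>_def)
  have mono: "\<kappa> * g S v - \<kappa> * g S u \<ge> - \<eta> * (v - u)" if "A < u" "u \<le> v" "v < B" for u v
  proof (rule monotone_of_lower_quotient[OF that(2)])
    show "isCont (\<lambda>t. \<kappa> * g S t) x" if "u \<le> x" "x \<le> v" for x
      using cont_g[of x S] that \<open>A < u\<close> \<open>v < B\<close> by (intro continuous_intros) auto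
    show "\<exists>d>0. \<forall>y. x < y \<and> y < x + d \<longrightarrow> - (\<eta> + e) * (y - x) \<le> \<kappa> * g S y - \<kappa> * g S x"
      if "u \<le> x" "x < v" "0 < e" for x e
      unfolding \<eta>_def by (rule top_quotient[OF \<kappa>]) (use that \<open>A < u\<close> \<open>v < B\<close> in auto)
  qed
  have "\<bar>\<kappa> * g S t\<bar> \<le> \<eta> * (B - A)"
  proof (rule field_le_epsilon)
    fix e :: real assume e: "e > 0"
    obtain \<delta> where \<delta>: "\<delta> > 0" "\<And>z. z \<in> D \<union> N \<Longrightarrow> Re z \<le> S \<Longrightarrow> Im z < A + \<delta> \<or> B - \<delta> < Im z \<Longrightarrow> \<bar>bx z\<bar> \<le> e"
      using b_line[OF e] by blast
    have end_le: "\<bar>\<kappa> * g S x\<bar> \<le> e" if "A < x" "x < B" "x < A + \<delta> \<or> B - \<delta> < x" for x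
      using \<delta>(2)[OF top_in[OF that(1,2), of S]] top_le[OF that(1,2), of S] that(3) \<kappa>(1) by (simp add: g_def abs_mult)
    define u where "u = min t (A + \<delta> / 2)"
    define v where "v = max t (B - \<delta> / 2)"
    have u: "A < u" "u \<le> t" "u < B" "u < A + \<delta>" using t \<delta>(1) by (auto simp: u_def min_def)
    have v: "v < B" "t \<le> v" "A < v" "B - \<delta> < v" using t \<delta>(1) by (auto simp: v_def max_def)
    have "\<kappa> * g S t \<ge> - \<eta> * (t - u) + - e" using mono[of u t] end_le[of u] u t by (auto simp: abs_le_iff)
    moreover have "\<eta> * (t - u) \<le> \<eta> * (B - A)" using \<eta> u t by (intro mult_left_mono) auto
    moreover have "\<kappa> * g S t \<le> e + \<eta> * (v - t)" using mono[of t v] end_le[of v] v t by (auto simp: abs_le_iff)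
    moreover have "\<eta> * (v - t) \<le> \<eta> * (B - A)" using \<eta> v t by (intro mult_left_mono) auto
    ultimately show "\<bar>\<kappa> * g S t\<bar> \<le> \<eta> * (B - A) + e" by (simp add: abs_le_iff)
  qed
  then show ?thesis using \<kappa>(1) by (simp add: abs_mult \<eta>_def)
qed

text \<open>The maximum principle for the harmonic function \<open>b\<close> below the truncated
  graph, applied to both signs \<sigma>. The neighbourhoods of the lines and of the vertex are cut
  away by \<open>b_line\<close> and \<open>b_low\<close>, the graph is handled by
  \<open>top_bound\<close>, and a small multiple of \<open>exp (Re z)\<close> makes the function
  strictly subharmonic.\<close>

lemma b_bound:
  assumes \<sigma>: "\<bar>\<sigma>\<bar> = 1" and z1: "z1 \<in> D" "Re z1 < S"
  shows "\<sigma> * b z1 \<le> M * (sech S)^2 * (B - A)"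
proof (rule ccontr)
  define \<eta> where "\<eta> = M * (sech S)^2 * (B - A)"
  have \<eta>: "\<eta> \<ge> 0" using M_nonneg AB by (simp add: \<eta>_def)
  assume n: "\<not> \<sigma> * b z1 \<le> M * (sech S)^2 * (B - A)"
  \<comment> \<open>A quarter of the excess: after losing \<open>e\<close> to the exponential term,
    the maximum still exceeds both the bound \<open>e\<close> near the lines and the bound \<eta> on
    the graph.\<close>
  define e where "e = (\<sigma> * b z1 - \<eta>) / 4"
  have "\<eta> < \<sigma> * b z1" using n unfolding \<eta>_def by linarith
  then have e: "e > 0" "\<sigma> * b z1 = \<eta> + 4 * e" unfolding e_def by (simp_all add: field_simps)
  obtain \<delta> where \<delta>: "\<delta> > 0" "\<And>z. z \<in> D \<union> N \<Longrightarrow> Re z \<le> S \<Longrightarrow> Im z < A + \<delta> \<or> B - \<delta> < Im z \<Longrightarrow> \<bar>bx z\<bar> \<le> e"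
    using b_line[OF e(1)] by blast
  obtain s1 where s1: "s1 < Re z1" "M * (1 + tanh s1) \<le> e" using low_abscissa[OF e(1)] by blast
  have abs_\<sigma>: "\<bar>\<sigma> * x\<bar> = \<bar>x\<bar>" for x using \<sigma> by (simp add: abs_mult)
  define X where "X = {z. A + \<delta> / 2 \<le> Im z \<and> Im z \<le> B - \<delta> / 2 \<and> s1 \<le> Re z}"
  define K where "K = {z \<in> X. Re z \<le> top S (Im z)}"
  have X: "closed X" unfolding X_def by (intro closed_Collect_conj closed_Collect_le continuous_intros)
  have XI: "A < Im z \<and> Im z < B" if "z \<in> X" for z using that \<delta>(1) by (auto simp: X_def)
  have "compact K"
  proof -
    have "continuous_on X (\<lambda>z. top S (Im z))"
      by (rule continuous_on_compose2[OF top_continuous_on[OF order_refl]]) (use XI in \<open>auto intro!: continuous_intros\<close>)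
    then have "closed K" unfolding K_def using X by (intro continuous_on_closed_Collect_le continuous_intros)
    moreover have "bounded K"
    proof (rule boundedI)
      fix z assume z: "z \<in> K"
      then have st: "A < Im z" "Im z < B" using XI by (auto simp: K_def)
      have "s1 \<le> Re z" "Re z \<le> S" using z top_le[OF st, of S] by (auto simp: K_def X_def)
      then have "\<bar>Re z\<bar> \<le> \<bar>s1\<bar> + \<bar>S\<bar>" "\<bar>Im z\<bar> \<le> \<bar>A\<bar> + \<bar>B\<bar>" using st by auto
      then show "norm z \<le> \<bar>s1\<bar> + \<bar>S\<bar> + (\<bar>A\<bar> + \<bar>B\<bar>)" using cmod_le[of z] by linarith
    qed
    ultimately show ?thesis by (simp add: compact_eq_bounded_closed)
  qed
  have KDN: "z \<in> D \<union> N \<and> Re z \<le> S" if "z \<in> K" for z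
  proof -
    have st: "A < Im z" "Im z < B" using XI that by (auto simp: K_def)
    have "Complex (Re z) (Im z) \<in> D \<union> N"
    proof (cases "Re z = top S (Im z)")
      case True
      then show ?thesis using top_in[OF st, of S] by simp
    next
      case False
      then have "Re z < top S (Im z)" using that by (simp add: K_def)
      from top_below[OF st this] show ?thesis by simp
    qed
    moreover have "Re z \<le> S" using top_le[OF st, of S] that by (simp add: K_def)
    ultimately show ?thesis by simp
  qed
  \<comment> \<open>Makes the exponential term at most \<open>e\<close> for
    \<open>Re z \<le> S\<close>.\<close>
  define k where "k = e / exp S"
  have k: "k > 0" "k * exp S = e" using e by (auto simp: k_def)
  define f where "f = (\<lambda>z. \<sigma> * bx z + k * exp (Re z))"
  have kexp: "k * exp (Re z) \<le> e" if "Re z \<le> S" for z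
  proof -
    have "k * exp (Re z) \<le> k * exp S" using that k by (intro mult_left_mono) auto
    then show ?thesis using k by simp
  qed
  have z1K: "z1 \<in> K"
  proof -
    have st: "A < Im z1" "Im z1 < B" using D_strip[OF z1(1)] by auto
    have "\<not> \<bar>bx z1\<bar> \<le> e" using e \<eta> bx_D[OF z1(1)] abs_\<sigma>[of "b z1"] by auto
    then have "\<not> (Im z1 < A + \<delta> \<or> B - \<delta> < Im z1)" using \<delta>(2)[of z1] z1 by auto
    moreover have "Re z1 \<le> top S (Im z1)" using z1 le_top[OF st, of "Re z1" S] by simp
    ultimately show ?thesis using \<delta>(1) s1 by (auto simp: K_def X_def)
  qed
  have "continuous_on K f" unfolding f_def
    by (intro continuous_intros continuous_on_subset[OF cont_bx]) (use KDN in auto)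
  then obtain z where z: "z \<in> K" "\<And>y. y \<in> K \<Longrightarrow> f y \<le> f z"
    using continuous_attains_sup[OF \<open>compact K\<close>] z1K by blast
  have "f z1 \<ge> \<sigma> * b z1" using k by (simp add: f_def bx_D[OF z1(1)])
  then have "\<sigma> * bx z + k * exp (Re z) \<ge> \<eta> + 4 * e" using z(2)[OF z1K] e by (simp add: f_def)
  then have big: "\<sigma> * bx z \<ge> \<eta> + 3 * e" using kexp[of z] KDN[OF z(1)] by linarith
  then have big': "\<bar>bx z\<bar> > e" "\<bar>bx z\<bar> > \<eta>" using abs_\<sigma>[of "bx z"] e(1) \<eta> by linarith+
  have st: "A < Im z" "Im z < B" using XI z(1) by (auto simp: K_def)
  have in1: "A + \<delta> / 2 < Im z" "Im z < B - \<delta> / 2"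
  proof -
    have "\<not> (Im z < A + \<delta> \<or> B - \<delta> < Im z)" using \<delta>(2)[of z] KDN[OF z(1)] big' by auto
    then show "A + \<delta> / 2 < Im z" "Im z < B - \<delta> / 2" using \<delta>(1) by auto
  qed
  have in2: "s1 < Re z"
  proof (rule ccontr)
    assume "\<not> s1 < Re z"
    then have "M * (1 + tanh (Re z)) \<le> M * (1 + tanh s1)" using M_nonneg by (intro mult_left_mono) auto
    then show False using bx_low[of z] KDN[OF z(1)] s1(2) big' by simp
  qed
  have in3: "Re z < top S (Im z)"
  proof (rule ccontr)
    assume "\<not> Re z < top S (Im z)"
    then have "top S (Im z) = Re z" using z(1) by (auto simp: K_def)
    then have "g S (Im z) = bx z" by (simp add: g_def)
    then show False using top_bound[OF st, of S] big' by (simp add: \<eta>_def)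
  qed
  have zD: "z \<in> D" using top_below[OF st in3] by simp
  obtain d0 where d0: "d0 > 0" "\<And>y. cmod (y - z) < d0 \<Longrightarrow> y \<in> D" using D_near[OF zD] by blast
  define d where "d = Min {d0, Im z - (A + \<delta> / 2), (B - \<delta> / 2) - Im z, Re z - s1, S - Re z}"
  have "Re z < S" using in3 top_le[OF st, of S] by simp
  then have d: "d > 0" "d \<le> d0" "d \<le> Im z - (A + \<delta> / 2)" "d \<le> (B - \<delta> / 2) - Im z" "d \<le> Re z - s1" "d \<le> S - Re z"
    using d0 in1 in2 by (auto simp: d_def)
  have yK: "y \<in> K" "y \<in> D" if "cmod (y - z) < d" for y
  proof -
    show yD: "y \<in> D" using d0(2) d that by simp
    have "\<bar>Re y - Re z\<bar> < d" "\<bar>Im y - Im z\<bar> < d" using that abs_Re_le_cmod[of "y - z"] abs_Im_le_cmod[of "y - z"] by auto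
    then have y: "s1 \<le> Re y" "Re y \<le> S" "A + \<delta> / 2 \<le> Im y" "Im y \<le> B - \<delta> / 2" using d by linarith+
    moreover have "Re y \<le> top S (Im y)" using D_strip[OF yD] yD y by (intro le_top) auto
    ultimately show "y \<in> K" by (simp add: K_def X_def)
  qed
  obtain f1 f2 where f12: "(phi has_derivative (\<lambda>h. f1 * Re h + f2 * Im h)) (at z)"
    "(psi has_derivative (\<lambda>h. f2 * Re h + (- f1) * Im h)) (at z)" using phi_psi_derivative[OF zD] by blast
  have dexp: "((\<lambda>z. k * exp (Re z)) has_derivative (\<lambda>h. k * (exp (Re z) * Re h))) (at z)" for z
    by (auto intro!: derivative_eq_intros)
  have "(- \<sigma> * f2 + k * exp (Re z)) + \<sigma> * f2 \<le> 0"
  proof (rule no_interior_max_of_pos_laplacian[OF d(1), of z f])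
    show "(f has_derivative (\<lambda>h. (- \<sigma> * psi y + k * exp (Re y)) * Re h + (\<sigma> * phi y) * Im h)) (at y)" if "cmod (y - z) < d" for y
      unfolding f_def
      by (rule has_derivative_eq_rhs, rule has_derivative_add[OF has_derivative_mult_right[OF der_bx[OF yK(2)[OF that]]] dexp])
        (auto simp: algebra_simps)
    show "((\<lambda>y. - \<sigma> * psi y + k * exp (Re y)) has_derivative (\<lambda>h. (- \<sigma> * f2 + k * exp (Re z)) * Re h + (\<sigma> * f1) * Im h)) (at z)"
      by (rule has_derivative_eq_rhs, rule has_derivative_add[OF has_derivative_mult_right[OF f12(2)] dexp])
        (auto simp: algebra_simps)
    show "((\<lambda>y. \<sigma> * phi y) has_derivative (\<lambda>h. (\<sigma> * f1) * Re h + (\<sigma> * f2) * Im h)) (at z)"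
      by (rule has_derivative_eq_rhs, rule has_derivative_mult_right[OF f12(1)]) (auto simp: algebra_simps)
    show "f y \<le> f z" if "cmod (y - z) < d" for y using z(2) yK(1)[OF that] by blast
  qed
  moreover have "k * exp (Re z) > 0" using k(1) by simp
  ultimately show False by simp
qed

lemma b_zero: assumes z: "z \<in> D" shows "b z = 0"
proof -
  have "((\<lambda>S. M * (1 - (tanh S)^2) * (B - A)) \<longlongrightarrow> M * (1 - 1^2) * (B - A)) at_top"
    by (intro tendsto_intros tanh_real_at_top)
  then have lim: "((\<lambda>S. M * (sech S)^2 * (B - A)) \<longlongrightarrow> 0) at_top" by (simp add: sech_sq)
  have "\<sigma> * b z \<le> 0" if "\<bar>\<sigma>\<bar> = 1" for \<sigma>
  proof (rule tendsto_lowerbound[OF lim])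
    show "\<forall>\<^sub>F S in at_top. \<sigma> * b z \<le> M * (sech S)^2 * (B - A)"
      using eventually_gt_at_top[of "Re z"] by eventually_elim (rule b_bound[OF that z])
  qed simp
  from this[of 1] this[of "-1"] show ?thesis by simp
qed

lemma phi_psi_zero: assumes z: "z \<in> D" shows "phi z = 0" "psi z = 0"
proof -
  have "(b has_derivative (\<lambda>h. 0)) (at z)"
    by (rule has_derivative_transform_within_open[OF has_derivative_const D_open z]) (simp add: b_zero)
  from has_derivative_unique[OF this der_b[OF z]]
  have "(\<lambda>h. 0) = (\<lambda>h. - psi z * Re h + phi z * Im h)" .
  from fun_cong[OF this, of 1] fun_cong[OF this, of \<i>] show "phi z = 0" "psi z = 0" by auto
qed

end

section \<open>Vanishing of the Hessian form and linearity of the solution\<close>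

context planar_overdetermined
begin

lemma rigid: 
  shows "z \<in> D \<Longrightarrow> phi z = 0" "z \<in> D \<Longrightarrow> psi z = 0"
proof -
  obtain b0 where b0: "\<And>z. z \<in> D \<Longrightarrow> (b0 has_derivative (\<lambda>h. - psi z * Re h + phi z * Im h)) (at z)"
    using conjugate_exists by blast
  interpret planar_conjugate A B L D N ns nt w ws wt wss wst wtt c M b0 by standard (rule b0)
  \<comment> \<open>Subtracting the common limit at the vertex gives the normalisation
    \<open>b_low\<close>.\<close>
  obtain l where l: "\<And>z. z \<in> D \<Longrightarrow> \<bar>b0 z - l\<bar> \<le> M * (1 + tanh (Re z))" using b_limit_at_cusp by blast
  interpret planar_normalized A B L D N ns nt w ws wt wss wst wtt c M "\<lambda>z. b0 z - l"
  proof
    show "((\<lambda>z. b0 z - l) has_derivative (\<lambda>h. - psi z * Re h + phi z * Im h)) (at z)" if "z \<in> D" for z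
      by (rule has_derivative_eq_rhs[OF has_derivative_diff[OF b0[OF that] has_derivative_const]]) simp
  qed (rule l)
  show "z \<in> D \<Longrightarrow> phi z = 0" "z \<in> D \<Longrightarrow> psi z = 0" using phi_psi_zero by auto
qed

text \<open>By continuity \<open>phi\<close> and \<open>psi\<close> vanish on \<open>N\<close> too,
  against the nonzero value in \<open>degenerate_N\<close>. It ensures later that the radial
  derivative of \<open>a \<bullet> x\<close> does not vanish on Gamma_0.\<close>

lemma c_nonzero: "c \<noteq> 0"
proof
  assume c: "c = 0"
  obtain z where z: "z \<in> N" using N_nonempty by blast
  have "phi y = 0 \<and> psi y = 0" if "y \<in> closure D" for y
    using continuous_constant_on_closure[OF cont_phi, of 0 y] continuous_constant_on_closure[OF cont_psi, of 0 y] rigid that by blast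
  then have "phi z = 0" "psi z = 0" using z N_closure by auto
  then show False using degenerate_N[OF z c] by simp
qed

lemma constant_on_D:
  fixes f :: "complex \<Rightarrow> real"
  assumes s: "\<And>z. z \<in> D \<Longrightarrow> ((\<lambda>s. f (Complex s (Im z))) has_real_derivative 0) (at (Re z))"
    and t: "\<And>z. z \<in> D \<Longrightarrow> ((\<lambda>t. f (Complex (Re z) t)) has_real_derivative 0) (at (Im z))"
  shows "\<exists>k. \<forall>z\<in>D. f z = k"
proof -
  have col: "f z = f (Complex s (Im z))" if z: "z \<in> D" "s < Re z" for s z
  proof -
    have inD: "Complex x (Im z) \<in> D" if "x \<le> Re z" for x
      using D_down[of "Re z" "Im z" x] z(1) that by (cases "x = Re z") auto
    have d: "((\<lambda>x. f (Complex x (Im z))) has_real_derivative 0) (at x)" if "x \<le> Re z" for x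
      using s[OF inD[OF that]] by simp
    have "\<bar>f (Complex (Re z) (Im z)) - f (Complex s (Im z))\<bar> \<le> 0 * (Re z - s)"
    proof (rule mean_value_bound)
      show "((\<lambda>x. f (Complex x (Im z))) has_real_derivative 0) (at x)" if "x < Re z" for x using d that by simp
      show "continuous_on {s..Re z} (\<lambda>x. f (Complex x (Im z)))" by (rule DERIV_continuous_on_Icc, rule d)
    qed (use z in auto)
    then show ?thesis by simp
  qed
  have row: "f (Complex s t1) = f (Complex s t2)" if "s < L" "A < t1" "t1 \<le> t2" "t2 < B" for s t1 t2
  proof -
    have d: "((\<lambda>x. f (Complex s x)) has_real_derivative 0) (at x)" if "t1 \<le> x" "x \<le> t2" for x
      using t[of "Complex s x"] D_low[of "Complex s x"] that \<open>s < L\<close> \<open>A < t1\<close> \<open>t2 < B\<close> by simp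
    have "\<bar>f (Complex s t2) - f (Complex s t1)\<bar> \<le> 0 * (t2 - t1)"
    proof (rule mean_value_bound)
      show "continuous_on {t1..t2} (\<lambda>x. f (Complex s x))" by (rule DERIV_continuous_on_Icc, rule d)
      show "((\<lambda>x. f (Complex s x)) has_real_derivative 0) (at x)" if "t1 < x" "x < t2" for x using d that by simp
    qed (use that in auto)
    then show ?thesis by simp
  qed
  have "f z = f y" if "z \<in> D" "y \<in> D" for z y
  proof -
    define s where "s = min (L - 1) (min (Re z - 1) (Re y - 1))"
    have s: "s < Re z" "s < Re y" by (simp_all add: s_def)
    note col[OF that(1) s(1)] col[OF that(2) s(2)]
    moreover have sL: "s < L" by (simp add: s_def)
    have "f (Complex s (Im z)) = f (Complex s (Im y))"
    proof (cases "Im z \<le> Im y")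
      case True
      show ?thesis by (rule row[OF sL _ True]) (use D_strip[OF that(1)] D_strip[OF that(2)] in auto)
    next
      case False
      then have "Im y \<le> Im z" by simp
      show ?thesis by (rule row[OF sL _ \<open>Im y \<le> Im z\<close>, symmetric]) (use D_strip[OF that(1)] D_strip[OF that(2)] in auto)
    qed
    ultimately show ?thesis by (simp only:)
  qed
  then show ?thesis by blast
qed

text \<open>\<open>Y\<close>, \<open>V\<close> and \<open>- (ws + tanh s * w)\<close> are the
  components of \<open>X\<close> along the rotating unit vectors in the equatorial plane and along
  \<open>p\<close>. Rotating back gives the components in the fixed frame, which are constant
  because \<open>E = 0\<close>; then \<open>w = X \<bullet> x\<close>.\<close>

lemma w_linear:
  "\<exists>a1 a2 a3. \<forall>z\<in>D. w z = sech (Re z) * (a1 * cos (Im z) + a2 * sin (Im z)) - a3 * tanh (Re z)"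
proof -
  define Y where "Y = (\<lambda>z. sech (Re z) * w z - sinh (Re z) * ws z)"
  define V where "V = (\<lambda>z. cosh (Re z) * wt z)"
  have ch: "cosh s \<noteq> (0::real)" for s by simp
  have wss: "wss z = - (tanh (Re z) * ws z) - (sech (Re z))^2 * w z" "wst z = - (tanh (Re z) * wt z)"
    "wtt z = tanh (Re z) * ws z - (sech (Re z))^2 * w z" if "z \<in> D" for z
    using rigid[OF that] wtt_eq[OF that] unfolding phi_def psi_def by linarith+
  note lines = has_derivative_Re_line[OF der_w] has_derivative_Re_line[OF der_ws] has_derivative_Re_line[OF der_wt]
    has_derivative_Im_line[OF der_w] has_derivative_Im_line[OF der_ws] has_derivative_Im_line[OF der_wt]
  have z': "Complex (Re z) (Im z) \<in> D" if "z \<in> D" for z using that by simp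
  have Ys: "((\<lambda>s. Y (Complex s (Im z))) has_real_derivative 0) (at (Re z))" if z: "z \<in> D" for z
  proof -
    have "((\<lambda>s. Y (Complex s (Im z))) has_real_derivative
       (- (sech (Re z) * tanh (Re z)) * w z + sech (Re z) * ws z - (cosh (Re z) * ws z + sinh (Re z) * wss z))) (at (Re z))"
      unfolding Y_def complex.sel by (auto intro!: derivative_eq_intros lines z' z)
    moreover have "- (sech (Re z) * tanh (Re z)) * w z + sech (Re z) * ws z - (cosh (Re z) * ws z + sinh (Re z) * wss z) = 0"
      unfolding wss[OF z] using cosh_square_eq[of "Re z"]
      by (simp add: sech_def tanh_def field_simps power2_eq_square)
    ultimately show ?thesis by simp
  qed
  have Vs: "((\<lambda>s. V (Complex s (Im z))) has_real_derivative 0) (at (Re z))" if z: "z \<in> D" for z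
  proof -
    have "((\<lambda>s. V (Complex s (Im z))) has_real_derivative (sinh (Re z) * wt z + cosh (Re z) * wst z)) (at (Re z))"
      unfolding V_def complex.sel by (auto intro!: derivative_eq_intros lines z' z)
    then show ?thesis unfolding wss[OF z] by (simp add: tanh_def)
  qed
  have Yt: "((\<lambda>t. Y (Complex (Re z) t)) has_real_derivative V z) (at (Im z))" if z: "z \<in> D" for z
  proof -
    have "((\<lambda>t. Y (Complex (Re z) t)) has_real_derivative (sech (Re z) * wt z - sinh (Re z) * wst z)) (at (Im z))"
      unfolding Y_def complex.sel by (auto intro!: derivative_eq_intros lines z' z)
    moreover have "sech (Re z) * wt z - sinh (Re z) * wst z = V z"
      unfolding wss[OF z] V_def using cosh_square_eq[of "Re z"] by (simp add: sech_def tanh_def field_simps power2_eq_square)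
    ultimately show ?thesis by simp
  qed
  have Vt: "((\<lambda>t. V (Complex (Re z) t)) has_real_derivative - Y z) (at (Im z))" if z: "z \<in> D" for z
  proof -
    have "((\<lambda>t. V (Complex (Re z) t)) has_real_derivative (cosh (Re z) * wtt z)) (at (Im z))"
      unfolding V_def complex.sel by (auto intro!: derivative_eq_intros lines z' z)
    moreover have "cosh (Re z) * wtt z = - Y z"
      unfolding wss[OF z] Y_def by (simp add: sech_def tanh_def field_simps power2_eq_square)
    ultimately show ?thesis by simp
  qed
  have "\<exists>k. \<forall>z\<in>D. (\<lambda>z. cos (Im z) * Y z - sin (Im z) * V z) z = k"
    by (rule constant_on_D; simp, rule DERIV_cong, (rule derivative_intros Ys Vs Yt Vt | assumption)+, simp)
  then obtain a1 where a1: "\<And>z. z \<in> D \<Longrightarrow> cos (Im z) * Y z - sin (Im z) * V z = a1" by auto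
  have "\<exists>k. \<forall>z\<in>D. (\<lambda>z. sin (Im z) * Y z + cos (Im z) * V z) z = k"
    by (rule constant_on_D; simp, rule DERIV_cong, (rule derivative_intros Ys Vs Yt Vt | assumption)+, simp)
  then obtain a2 where a2: "\<And>z. z \<in> D \<Longrightarrow> sin (Im z) * Y z + cos (Im z) * V z = a2" by auto
  have "\<exists>k. \<forall>z\<in>D. (\<lambda>z. ws z + tanh (Re z) * w z) z = k"
  proof (rule constant_on_D)
    fix z assume z: "z \<in> D"
    have d: "((\<lambda>z. ws z + tanh (Re z) * w z) has_derivative (\<lambda>h. 0 * Re h + 0 * Im h)) (at (Complex (Re z) (Im z)))"
      using der_a[OF z] rigid[OF z] by simp
    show "((\<lambda>s. ws (Complex s (Im z)) + tanh (Re (Complex s (Im z))) * w (Complex s (Im z))) has_real_derivative 0) (at (Re z))"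
      using has_derivative_Re_line[OF d] .
    show "((\<lambda>t. ws (Complex (Re z) t) + tanh (Re (Complex (Re z) t)) * w (Complex (Re z) t)) has_real_derivative 0) (at (Im z))"
      using has_derivative_Im_line[OF d] .
  qed
  then obtain a3 where a3: "\<And>z. z \<in> D \<Longrightarrow> ws z + tanh (Re z) * w z = a3" by auto
  have "w z = sech (Re z) * (a1 * cos (Im z) + a2 * sin (Im z)) - (- a3) * tanh (Re z)" if z: "z \<in> D" for z
  proof -
    have "a1 * cos (Im z) + a2 * sin (Im z) = Y z * ((cos (Im z))^2 + (sin (Im z))^2)"
      unfolding a1[OF z, symmetric] a2[OF z, symmetric] by (simp only: power2_eq_square) (simp only: algebra_simps)
    then have "a1 * cos (Im z) + a2 * sin (Im z) = Y z" by simp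
    moreover have "sech (Re z) * Y z = (1 - (tanh (Re z))^2) * w z - tanh (Re z) * ws z"
      unfolding Y_def sech_sq[symmetric] by (simp add: sech_def tanh_def power2_eq_square field_simps)
    ultimately show ?thesis unfolding a3[OF z, symmetric] by (simp add: algebra_simps power2_eq_square)
  qed
  then show ?thesis by blast
qed

end

section \<open>Conformal polar coordinates on the sphere\<close>

lemma tanh_artanh:
  assumes "\<bar>x\<bar> < (1::real)" shows "tanh (artanh x) = x"
proof -
  have x: "1 + x > 0" "1 - x > 0" using assms by auto
  define E where "E = exp (- 2 * artanh x)"
  have "E = inverse ((1 + x) / (1 - x))"
    using x by (simp add: E_def artanh_def exp_minus)
  then have "E * (1 + x) = 1 - x" using x by simp
  then have "1 - E = x * (1 + E)" by (simp add: algebra_simps)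
  moreover have "1 + E > 0" by (simp add: E_def add_pos_pos)
  ultimately have "(1 - E) / (1 + E) = x" by (simp add: divide_eq_eq)
  then show ?thesis by (simp add: tanh_real_altdef E_def)
qed

locale polar_frame =
  fixes p e1 e2 :: "real^3"
  assumes unit: "p \<bullet> p = 1" "e1 \<bullet> e1 = 1" "e2 \<bullet> e2 = 1"
    and orth: "e1 \<bullet> e2 = 0" "e1 \<bullet> p = 0" "e2 \<bullet> p = 0"
begin

lemma orth': "e2 \<bullet> e1 = 0" "p \<bullet> e1 = 0" "p \<bullet> e2 = 0"
  using orth by (simp_all add: inner_commute)

lemmas frame = unit orth orth'

end

section \<open>Orthonormal frames and matrices in space\<close>

lemma orthonormal_expand:
  fixes a b c y :: "real^3"
  assumes "a \<bullet> a = 1" "b \<bullet> b = 1" "c \<bullet> c = 1" "a \<bullet> b = 0" "a \<bullet> c = 0" "b \<bullet> c = 0"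
  shows "y = (y \<bullet> a) *\<^sub>R a + (y \<bullet> b) *\<^sub>R b + (y \<bullet> c) *\<^sub>R c"
proof -
  have ne: "a \<noteq> b" "a \<noteq> c" "b \<noteq> c" using assms by auto
  have nz: "0 \<notin> {a, b, c}" using assms by auto
  have po: "pairwise orthogonal {a, b, c}"
    using assms by (auto simp: pairwise_def orthogonal_def inner_commute)
  have ind: "independent {a, b, c}" using pairwise_orthogonal_independent[OF po nz] .
  have "card {a, b, c} = 3" using ne by simp
  then have "UNIV \<subseteq> span {a, b, c}" by (intro card_ge_dim_independent ind) (auto simp: dim_UNIV)
  then have "(\<Sum>v\<in>{a, b, c}. (y \<bullet> v) *\<^sub>R v) = y"
    using assms by (intro orthonormal_basis_expand po) (auto simp: norm_eq_1)
  then show ?thesis using ne by (simp add: add.assoc)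
qed

lemma orthonormal_inner:
  fixes a b c y z :: "real^3"
  assumes "a \<bullet> a = 1" "b \<bullet> b = 1" "c \<bullet> c = 1" "a \<bullet> b = 0" "a \<bullet> c = 0" "b \<bullet> c = 0"
  shows "y \<bullet> z = (y \<bullet> a) * (z \<bullet> a) + (y \<bullet> b) * (z \<bullet> b) + (y \<bullet> c) * (z \<bullet> c)"
proof -
  have "y \<bullet> z = ((y \<bullet> a) *\<^sub>R a + (y \<bullet> b) *\<^sub>R b + (y \<bullet> c) *\<^sub>R c) \<bullet> z"
    using orthonormal_expand[OF assms, of y] by simp
  then show ?thesis by (simp only: inner_add_left inner_scaleR_left inner_commute[of z])
qed

text \<open>The completeness relation of an orthonormal frame. It splits the Euclidean trace of the
  Hessian into a radial and a tangential part.\<close>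

lemma trace_orthonormal:
  fixes a b c :: "real^3" and H :: "real^3^3"
  assumes "a \<bullet> a = 1" "b \<bullet> b = 1" "c \<bullet> c = 1" "a \<bullet> b = 0" "a \<bullet> c = 0" "b \<bullet> c = 0"
  shows "(\<Sum>i\<in>UNIV. H $ i $ i) = a \<bullet> (H *v a) + b \<bullet> (H *v b) + c \<bullet> (H *v c)"
proof -
  have d: "a $ i * a $ j + b $ i * b $ j + c $ i * c $ j = (if i = j then 1 else 0)" for i j
    using orthonormal_inner[OF assms, of "axis i 1" "axis j 1"]
    by (simp add: inner_axis') (auto simp: axis_def split: if_splits)
  have q: "v \<bullet> (H *v v) = (\<Sum>i\<in>UNIV. \<Sum>j\<in>UNIV. H $ i $ j * (v $ i * v $ j))" for v
    by (simp add: inner_vec_def matrix_vector_mult_def sum_distrib_left mult_ac)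
  have "a \<bullet> (H *v a) + b \<bullet> (H *v b) + c \<bullet> (H *v c) =
    (\<Sum>i\<in>UNIV. \<Sum>j\<in>UNIV. H $ i $ j * (a $ i * a $ j + b $ i * b $ j + c $ i * c $ j))"
    unfolding q by (simp add: sum.distrib distrib_left)
  also have "\<dots> = (\<Sum>i\<in>UNIV. \<Sum>j\<in>UNIV. if i = j then H $ i $ j else 0)"
    unfolding d by (intro sum.cong refl) auto
  finally show ?thesis by simp
qed

lemma norm_matrix_vector_le:
  fixes H :: "real^3^3"
  shows "norm (H *v y) \<le> 3 * (norm H * norm y)"
proof -
  have "\<bar>(H *v y) $ i\<bar> \<le> norm H * norm y" for i
  proof -
    have "(H *v y) $ i = H $ i \<bullet> y" by (simp add: matrix_vector_mult_def inner_vec_def)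
    then have "\<bar>(H *v y) $ i\<bar> \<le> norm (H $ i) * norm y" by (simp add: Cauchy_Schwarz_ineq2)
    also have "\<dots> \<le> norm H * norm y" by (intro mult_right_mono Finite_Cartesian_Product.norm_nth_le) simp
    finally show ?thesis .
  qed
  then have "(\<Sum>i\<in>UNIV. \<bar>(H *v y) $ i\<bar>) \<le> (\<Sum>i\<in>(UNIV::3 set). norm H * norm y)" by (intro sum_mono)
  then show ?thesis using norm_le_l1_cart[of "H *v y"] by simp
qed

section \<open>The conformal chart and its derivatives\<close>

context polar_frame
begin

definition circ :: "real \<Rightarrow> real^3" where "circ t = cos t *\<^sub>R e1 + sin t *\<^sub>R e2"
definition circ' :: "real \<Rightarrow> real^3" where "circ' t = - sin t *\<^sub>R e1 + cos t *\<^sub>R e2"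

text \<open>In polar coordinates this is \<open>cos r *\<^sub>R p + sin r *\<^sub>R circ t\<close>.
  The five vectors after it are its first and second partial derivatives.\<close>

definition xx :: "complex \<Rightarrow> real^3" where "xx z = sech (Re z) *\<^sub>R circ (Im z) - tanh (Re z) *\<^sub>R p"
definition xs :: "complex \<Rightarrow> real^3" where "xs z = - (sech (Re z) * tanh (Re z)) *\<^sub>R circ (Im z) - (sech (Re z))^2 *\<^sub>R p"
definition xt :: "complex \<Rightarrow> real^3" where "xt z = sech (Re z) *\<^sub>R circ' (Im z)"
definition xss :: "complex \<Rightarrow> real^3" where
  "xss z = (sech (Re z) * (tanh (Re z))^2 - sech (Re z) * (sech (Re z))^2) *\<^sub>R circ (Im z) + (2 * (sech (Re z))^2 * tanh (Re z)) *\<^sub>R p"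
definition xst :: "complex \<Rightarrow> real^3" where "xst z = - (sech (Re z) * tanh (Re z)) *\<^sub>R circ' (Im z)"
definition xtt :: "complex \<Rightarrow> real^3" where "xtt z = - sech (Re z) *\<^sub>R circ (Im z)"

lemma circ_inner: "circ t \<bullet> circ t = 1" "circ' t \<bullet> circ' t = 1" "circ t \<bullet> circ' t = 0" "circ' t \<bullet> circ t = 0"
  "circ t \<bullet> p = 0" "circ' t \<bullet> p = 0" "p \<bullet> circ t = 0" "p \<bullet> circ' t = 0"
  "circ t \<bullet> e1 = cos t" "circ t \<bullet> e2 = sin t" "circ' t \<bullet> e1 = - sin t" "circ' t \<bullet> e2 = cos t"
  by (simp_all add: circ_def circ'_def inner_add_left inner_add_right inner_diff_left inner_diff_right frame flip: power2_eq_square)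

lemma tanh_sech: "(sech s)^2 + (tanh s)^2 = 1" by (simp add: sech_sq)

lemma xx_inner: "xx z \<bullet> xx z = 1" "xs z \<bullet> xs z = (sech (Re z))^2" "xt z \<bullet> xt z = (sech (Re z))^2"
  "xx z \<bullet> xs z = 0" "xx z \<bullet> xt z = 0" "xs z \<bullet> xt z = 0" "xx z \<bullet> p = - tanh (Re z)" "p \<bullet> xx z = - tanh (Re z)"
  "xx z \<bullet> e1 = sech (Re z) * cos (Im z)" "xx z \<bullet> e2 = sech (Re z) * sin (Im z)"
proof -
  have h: "tanh (Re z) * tanh (Re z) = 1 - sech (Re z) * sech (Re z)"
    using tanh_sech[of "Re z"] by (simp add: power2_eq_square)
  have h2: "sech (Re z) * (tanh (Re z) * (sech (Re z) * tanh (Re z))) = sech (Re z) * sech (Re z) - sech (Re z) * (sech (Re z) * (sech (Re z) * sech (Re z)))"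
  proof -
    have "sech (Re z) * (tanh (Re z) * (sech (Re z) * tanh (Re z))) = (sech (Re z) * sech (Re z)) * (tanh (Re z) * tanh (Re z))"
      by (simp only: mult_ac)
    then show ?thesis unfolding h by (simp only: right_diff_distrib mult_1_right mult_ac)
  qed
  show "xx z \<bullet> xx z = 1" "xs z \<bullet> xs z = (sech (Re z))^2" "xt z \<bullet> xt z = (sech (Re z))^2"
    "xx z \<bullet> xs z = 0" "xx z \<bullet> xt z = 0" "xs z \<bullet> xt z = 0" "xx z \<bullet> p = - tanh (Re z)" "p \<bullet> xx z = - tanh (Re z)"
    "xx z \<bullet> e1 = sech (Re z) * cos (Im z)" "xx z \<bullet> e2 = sech (Re z) * sin (Im z)"
    unfolding xx_def xs_def xt_def power2_eq_square
    by (simp_all add: inner_diff_left inner_diff_right circ_inner frame h h2 mult.assoc)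
qed

lemma norm_xx [simp]: "norm (xx z) = 1" by (simp add: norm_eq_1 xx_inner)

lemma tangent_frame:
  "xx z \<bullet> xx z = 1" "(cosh (Re z) *\<^sub>R xs z) \<bullet> (cosh (Re z) *\<^sub>R xs z) = 1" "(cosh (Re z) *\<^sub>R xt z) \<bullet> (cosh (Re z) *\<^sub>R xt z) = 1"
  "xx z \<bullet> (cosh (Re z) *\<^sub>R xs z) = 0" "xx z \<bullet> (cosh (Re z) *\<^sub>R xt z) = 0" "(cosh (Re z) *\<^sub>R xs z) \<bullet> (cosh (Re z) *\<^sub>R xt z) = 0"
  using cosh_sech(1)[of "Re z"] by (simp_all add: xx_inner power2_eq_square mult.assoc)

lemma tangent_inner:
  assumes "y \<bullet> xx z = 0"
  shows "y \<bullet> v = (cosh (Re z))^2 * ((y \<bullet> xs z) * (v \<bullet> xs z) + (y \<bullet> xt z) * (v \<bullet> xt z))"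
  using orthonormal_inner[OF tangent_frame, of y v z] assms by (simp add: power2_eq_square algebra_simps)

text \<open>In this and the next two lemmas the tangential parts of the second derivatives, the
  Christoffel terms, cancel. What remains is normal to the sphere or zero, hence invisible to a
  tangential gradient.\<close>

lemma xss_xtt: "xss z + xtt z = - (2 * (sech (Re z))^2) *\<^sub>R xx z"
proof -
  have t: "(tanh (Re z))^2 = 1 - (sech (Re z))^2" by (simp add: sech_sq)
  show ?thesis unfolding xss_def xtt_def xx_def t by (simp add: vec_eq_iff algebra_simps)
qed

lemma xss_xs: "xss z + tanh (Re z) *\<^sub>R xs z = - ((sech (Re z))^2) *\<^sub>R xx z"
  by (simp add: vec_eq_iff xss_def xs_def xx_def power2_eq_square algebra_simps)

lemma xst_xt: "xst z + tanh (Re z) *\<^sub>R xt z = 0"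
  by (simp add: xst_def xt_def mult.commute)

lemma has_derivative_circ:
  "((\<lambda>z. circ (Im z)) has_derivative (\<lambda>h. Im h *\<^sub>R circ' (Im z))) (at z)"
  "((\<lambda>z. circ' (Im z)) has_derivative (\<lambda>h. - Im h *\<^sub>R circ (Im z))) (at z)"
  unfolding circ_def circ'_def
  by (auto intro!: derivative_eq_intros simp: algebra_simps)

lemma has_derivative_sech_Re:
  "((\<lambda>z. sech (Re z)) has_derivative (\<lambda>h. - (sech (Re z) * tanh (Re z)) * Re h)) (at z)"
  by (rule DERIV_compose_FDERIV[of sech, THEN has_derivative_eq_rhs])
    (auto intro!: derivative_eq_intros has_derivative_Re has_derivative_ident)

lemma der_xx: "(xx has_derivative (\<lambda>h. Re h *\<^sub>R xs z + Im h *\<^sub>R xt z)) (at z)"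
  unfolding xx_def[abs_def]
  by (rule has_derivative_eq_rhs, rule has_derivative_diff[OF has_derivative_scaleR[OF has_derivative_sech_Re has_derivative_circ(1)] has_derivative_scaleR_left[OF has_derivative_tanh_Re]])
    (auto simp: xs_def xt_def algebra_simps)

lemma der_xs: "(xs has_derivative (\<lambda>h. Re h *\<^sub>R xss z + Im h *\<^sub>R xst z)) (at z)"
  unfolding xs_def[abs_def]
  by (rule has_derivative_eq_rhs, rule has_derivative_diff[OF has_derivative_scaleR[OF has_derivative_minus[OF has_derivative_mult[OF has_derivative_sech_Re has_derivative_tanh_Re]] has_derivative_circ(1)] has_derivative_scaleR_left[OF has_derivative_sech_sq]])
    (auto simp: xss_def xst_def power2_eq_square algebra_simps)

lemma der_xt: "(xt has_derivative (\<lambda>h. Re h *\<^sub>R xst z + Im h *\<^sub>R xtt z)) (at z)"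
  unfolding xt_def[abs_def]
  by (rule has_derivative_eq_rhs, rule has_derivative_scaleR[OF has_derivative_sech_Re has_derivative_circ(2)])
    (auto simp: xst_def xtt_def algebra_simps)

lemma cont_frame: "continuous_on X xx" "continuous_on X xs" "continuous_on X xt" "continuous_on X xss" "continuous_on X xst" "continuous_on X xtt"
  unfolding xx_def xs_def xt_def xss_def xst_def xtt_def circ_def circ'_def
  by (intro continuous_intros; simp)+

lemma xx_inj:
  assumes "xx z = xx y" "\<bar>Im z - Im y\<bar> < 2 * pi"
  shows "z = y"
proof -
  have "tanh (Re z) = tanh (Re y)" using assms(1) xx_inner(7)[of z] xx_inner(7)[of y] by simp
  then have r: "Re z = Re y" by simp
  have "cos (Im z) = cos (Im y)" "sin (Im z) = sin (Im y)"
    using assms(1) xx_inner(9,10)[of z] xx_inner(9,10)[of y] r by simp_all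
  then obtain n :: int where n: "Im z = Im y + 2 * pi * of_int n" using sin_cos_eq_iff[of "Im z" "Im y"] by metis
  have "n = 0"
  proof (rule ccontr)
    assume "n \<noteq> 0"
    then have "\<bar>real_of_int n\<bar> \<ge> 1" by linarith
    then have "2 * pi * 1 \<le> 2 * pi * \<bar>real_of_int n\<bar>" by (intro mult_left_mono) auto
    then show False using assms(2) n by (simp add: abs_mult)
  qed
  then show ?thesis using r n by (simp add: complex_eq_iff)
qed

lemma unit_expand: "x \<bullet> x = (x \<bullet> p)^2 + (x \<bullet> e1)^2 + (x \<bullet> e2)^2"
  using orthonormal_inner[of p e1 e2 x x] frame by (simp add: power2_eq_square)

lemma xx_surj:
  assumes x: "norm x = 1" "x \<noteq> p" "x \<noteq> - p"
  obtains z where "xx z = x" "0 \<le> Im z" "Im z < 2 * pi"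
proof -
  have xe: "x = (x \<bullet> p) *\<^sub>R p + (x \<bullet> e1) *\<^sub>R e1 + (x \<bullet> e2) *\<^sub>R e2"
    by (rule orthonormal_expand) (simp_all add: frame)
  define s where "s = artanh (- (x \<bullet> p))"
  have np: "norm p = 1" using unit by (simp add: norm_eq_1)
  have "\<bar>x \<bullet> p\<bar> \<le> 1" using Cauchy_Schwarz_ineq2[of x p] x(1) np by simp
  moreover have "x \<bullet> p \<noteq> 1" using norm_cauchy_schwarz_eq[of x p] x np by auto
  moreover have "x \<bullet> p \<noteq> - 1"
  proof
    assume "x \<bullet> p = - 1"
    then have "x \<bullet> (- p) = norm x * norm (- p)" using x np by simp
    then show False using norm_cauchy_schwarz_eq[of x "- p"] x np by auto
  qed
  ultimately have xp: "\<bar>- (x \<bullet> p)\<bar> < 1" by auto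
  have ts: "tanh s = - (x \<bullet> p)" using tanh_artanh xp unfolding s_def by blast
  have "(x \<bullet> e1)^2 + (x \<bullet> e2)^2 = (sech s)^2"
    using unit_expand[of x] x(1) ts by (simp add: sech_sq norm_eq_1)
  then have "((x \<bullet> e1) / sech s)^2 + ((x \<bullet> e2) / sech s)^2 = 1"
    by (simp add: power_divide add_divide_distrib[symmetric])
  then obtain t where t: "0 \<le> t" "t < 2 * pi" "(x \<bullet> e1) / sech s = cos t" "(x \<bullet> e2) / sech s = sin t"
    using sincos_total_2pi by metis
  have "xx (Complex s t) = x"
    unfolding xx_def circ_def using t(3,4) by (subst xe) (simp add: ts scaleR_add_right field_simps)
  then show thesis using that[of "Complex s t"] t by simp
qed

lemma dist_pole: "(dist (xx z) p)^2 = 2 + 2 * tanh (Re z)" "(dist (xx z) (- p))^2 = 2 - 2 * tanh (Re z)"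
  unfolding dist_norm power2_norm_eq_inner
  by (simp_all add: inner_diff_left inner_diff_right inner_add_left inner_add_right xx_inner frame)

lemma xx_not_pole: "xx z \<noteq> p" "xx z \<noteq> - p"
proof -
  show "xx z \<noteq> p" using dist_pole(1)[of z] tanh_real_gt_neg1[of "Re z"] by auto
  show "xx z \<noteq> - p" using dist_pole(2)[of z] tanh_real_lt_1[of "Re z"] by auto
qed

lemma geo_xx:
  assumes "0 < r" "r < pi"
  obtains s where "tanh s = - cos r" "sech s = sin r" "\<And>t. geo p (circ t) r = xx (Complex s t)"
proof -
  have c: "\<bar>- cos r\<bar> < 1" using assms cos_monotone_0_pi[of 0 r] cos_monotone_0_pi[of r pi] by (auto simp: abs_less_iff)
  define s where "s = artanh (- cos r)"
  have ts: "tanh s = - cos r" using tanh_artanh c unfolding s_def by blast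
  have "(sech s)^2 = (sin r)^2" using ts by (simp add: sech_sq sin_squared_eq)
  then have "sech s = sin r" using sin_gt_zero[OF assms] sech_pos[of s] by (simp add: power2_eq_iff_nonneg less_imp_le)
  then show thesis using that[of s] ts by (simp add: geo_def xx_def)
qed

lemma xx_geo:
  obtains r where "0 < r" "r < pi" "cos r = - tanh s" "sin r = sech s" "\<And>t. xx (Complex s t) = geo p (circ t) r"
proof -
  define r where "r = arccos (- tanh s)"
  have b: "-1 < - tanh s" "- tanh s < 1" using tanh_real_bounds[of s] by auto
  have r: "0 < r" "r < pi" "cos r = - tanh s" using arccos_lt_bounded[OF b] cos_arccos[of "- tanh s"] b by (auto simp: r_def)
  have "(sech s)^2 = (sin r)^2" using r by (simp add: sech_sq sin_squared_eq)
  then have "sin r = sech s" using sin_gt_zero[OF r(1,2)] sech_pos[of s] by (simp add: power2_eq_iff_nonneg less_imp_le)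
  then show thesis using that[of r] r by (simp add: geo_def xx_def)
qed

text \<open>Away from the poles only a compact piece \<open>\<bar>Re z\<bar> \<le> T\<close> of the
  closed strip matters, and its image is closed. At the poles the preimages escape to infinity,
  hence the exclusion of \<open>p\<close> and \<open>- p\<close>.\<close>

lemma lift_closure:
  assumes x: "x \<in> closure X" "x \<noteq> p" "x \<noteq> - p" and X: "X \<subseteq> xx ` P"
    and P: "\<And>z. z \<in> P \<Longrightarrow> A \<le> Im z \<and> Im z \<le> B"
  obtains z where "z \<in> closure {z \<in> P. xx z \<in> X}" "xx z = x" "A \<le> Im z" "Im z \<le> B"
proof -
  define PX where "PX = {z \<in> P. xx z \<in> X}"
  have "X \<subseteq> sphere 0 1" using X by auto
  then have "closure X \<subseteq> sphere 0 1" by (intro closure_minimal) auto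
  then have nx: "norm x = 1" using x(1) by auto
  obtain z0 where z0: "xx z0 = x" using xx_surj[OF nx x(2,3)] by blast
  define T where "T = \<bar>Re z0\<bar> + 1"
  have "tanh (Re z0) < tanh T" "tanh (- T) < tanh (Re z0)" unfolding tanh_real_less_iff by (auto simp: T_def)
  then have xp: "\<bar>x \<bullet> p\<bar> < tanh T" using z0 xx_inner(7)[of z0] by (auto simp: abs_less_iff)
  define U where "U = {y. \<bar>y \<bullet> p\<bar> < tanh T}"
  have "open U" unfolding U_def by (intro open_Collect_less continuous_intros)
  then have "x \<in> closure (U \<inter> X)" using open_Int_closure_subset[of U X] x(1) xp by (auto simp: U_def)
  define K where "K = closure PX \<inter> {z. - T \<le> Re z \<and> Re z \<le> T \<and> A \<le> Im z \<and> Im z \<le> B}"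
  have "compact K"
  proof -
    have "closed K" unfolding K_def by (intro closed_Int closed_closure closed_Collect_conj closed_Collect_le continuous_intros)
    moreover have "bounded K"
    proof (rule boundedI)
      fix z assume "z \<in> K"
      then have "\<bar>Re z\<bar> \<le> \<bar>T\<bar>" "\<bar>Im z\<bar> \<le> \<bar>A\<bar> + \<bar>B\<bar>" by (auto simp: K_def)
      then show "norm z \<le> \<bar>T\<bar> + (\<bar>A\<bar> + \<bar>B\<bar>)" using cmod_le[of z] by linarith
    qed
    ultimately show ?thesis by (simp add: compact_eq_bounded_closed)
  qed
  then have "closed (xx ` K)" by (intro compact_imp_closed compact_continuous_image cont_frame)
  moreover have "U \<inter> X \<subseteq> xx ` K"
  proof
    fix y assume y: "y \<in> U \<inter> X"
    then obtain z where z: "z \<in> P" "y = xx z" using X by auto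
    then have "z \<in> closure PX" using y closure_subset[of PX] by (auto simp: PX_def)
    moreover have "\<bar>tanh (Re z)\<bar> < tanh T" using y z xx_inner(7)[of z] by (auto simp: U_def)
    then have "tanh (Re z) < tanh T" "tanh (- T) < tanh (Re z)" by (auto simp: abs_less_iff)
    then have "Re z < T" "- T < Re z" by (simp_all only: tanh_real_less_iff)
    ultimately show "y \<in> xx ` K" using z P by (auto simp: K_def)
  qed
  ultimately have "closure (U \<inter> X) \<subseteq> xx ` K" by (intro closure_minimal)
  then obtain z where "z \<in> K" "xx z = x" using \<open>x \<in> closure (U \<inter> X)\<close> by blast
  then show thesis using that[of z] by (auto simp: K_def PX_def)
qed

end

section \<open>Exterior domains of a cone\<close>

locale cone_domain = polar_frame p e1 e2 for p e1 e2 :: "real^3" +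
  fixes \<alpha> :: real and \<Omega> :: "(real^3) set" and \<nu> :: "real^3 \<Rightarrow> real^3"
  assumes alpha: "0 < \<alpha>" "\<alpha> \<le> pi"
    and adm: "admissible_exterior p (scone p (tarc e1 e2 \<alpha>)) \<Omega>"
    and nu: "x \<in> Gamma0 (scone p (tarc e1 e2 \<alpha>)) \<Omega> \<union> (Gamma1 (scone p (tarc e1 e2 \<alpha>)) \<Omega> - {p}) \<Longrightarrow> outward_normal \<Omega> x (\<nu> x)"
    and star: "star_shaped_wrt p (scone p (tarc e1 e2 \<alpha>)) \<Omega> \<nu>"
begin

definition "C = scone p (tarc e1 e2 \<alpha>)"
definition "strip = {z. \<alpha> < Im z \<and> Im z < 2 * pi}"
definition "G0 = Gamma0 C \<Omega>"
definition "D = {z \<in> strip. xx z \<in> \<Omega>}"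
definition "N = {z \<in> strip. xx z \<in> G0}"

lemma alpha_lt: "\<alpha> < 2 * pi" using alpha pi_gt_zero by linarith

lemma C_image: "C = (\<lambda>(r, t). geo p (circ t) r) ` ({0..<pi} \<times> {0..\<alpha>})"
  unfolding C_def scone_def tarc_def circ_def[symmetric] by (auto simp: image_iff) metis+

lemma closure_C: "closure C = (\<lambda>(r, t). geo p (circ t) r) ` ({0..pi} \<times> {0..\<alpha>})" (is "_ = ?K")
proof
  have "compact ?K"
    by (intro compact_continuous_image compact_Times)
      (auto simp: case_prod_beta geo_def circ_def intro!: continuous_intros)
  moreover have "C \<subseteq> ?K" unfolding C_image by (intro image_mono) auto
  ultimately show "closure C \<subseteq> ?K" by (intro closure_minimal compact_imp_closed)
  show "?K \<subseteq> closure C"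
  proof clarsimp
    fix r t assume rt: "0 \<le> r" "r \<le> pi" "0 \<le> t" "t \<le> \<alpha>"
    have "(\<lambda>r. geo p (circ t) r) ` closure {0..<pi} \<subseteq> closure C"
    proof (rule image_closure_subset)
      show "continuous_on (closure {0..<pi}) (geo p (circ t))" unfolding geo_def by (intro continuous_intros)
      show "geo p (circ t) ` {0..<pi} \<subseteq> closure C"
        using rt closure_subset[of C] by (force simp: C_image)
    qed auto
    then show "geo p (circ t) r \<in> closure C" using rt by auto
  qed
qed

lemma p_in_C: "p \<in> closure C" "- p \<in> closure C"
proof -
  have "geo p (circ 0) 0 \<in> closure C"
    unfolding closure_C by (rule image_eqI[of _ _ "(0, 0)"]) (use alpha in auto)
  moreover have "geo p (circ 0) pi \<in> closure C"
    unfolding closure_C by (rule image_eqI[of _ _ "(pi, 0)"]) (use alpha in auto)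
  ultimately show "p \<in> closure C" "- p \<in> closure C" by (auto simp: geo_def)
qed

lemma closure_C_cases:
  assumes "x \<in> closure C" "x \<noteq> p" "x \<noteq> - p"
  obtains z where "x = xx z" "0 \<le> Im z" "Im z \<le> \<alpha>"
proof -
  obtain r t where rt: "0 \<le> r" "r \<le> pi" "0 \<le> t" "t \<le> \<alpha>" "x = geo p (circ t) r" using assms(1) unfolding closure_C by auto
  have "r \<noteq> 0" "r \<noteq> pi" using assms rt by (auto simp: geo_def)
  then obtain s where "geo p (circ t) r = xx (Complex s t)" using geo_xx[of r] rt by (metis less_eq_real_def)
  then show thesis using that[of "Complex s t"] rt by simp
qed

lemma xx_in_closure_C: assumes "0 \<le> Im z" "Im z \<le> \<alpha>" shows "xx z \<in> closure C"
proof -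
  obtain r where r: "0 < r" "r < pi" "xx (Complex (Re z) (Im z)) = geo p (circ (Im z)) r" using xx_geo by metis
  then show ?thesis unfolding closure_C using assms by (intro image_eqI[of _ _ "(r, Im z)"]) auto
qed

lemma xx_line: assumes "Im z = \<alpha> \<or> Im z = 2 * pi" shows "xx z \<in> closure C"
proof (cases "Im z = \<alpha>")
  case True then show ?thesis using xx_in_closure_C alpha by simp
next
  case False
  then have "xx z = xx (Complex (Re z) 0)" using assms by (simp add: xx_def circ_def)
  then show ?thesis using xx_in_closure_C[of "Complex (Re z) 0"] alpha by simp
qed

lemma xx_S2: "xx z \<in> S2" by (simp add: S2_def)

lemma strip_ext: assumes "z \<in> strip" shows "xx z \<notin> closure C"
proof
  assume "xx z \<in> closure C"
  then obtain y where y: "xx z = xx y" "0 \<le> Im y" "Im y \<le> \<alpha>" using closure_C_cases xx_not_pole by metis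
  have "z = y" by (rule xx_inj[OF y(1)]) (use y assms alpha alpha_lt in \<open>auto simp: strip_def abs_less_iff\<close>)
  then show False using y assms by (auto simp: strip_def)
qed

lemma exterior: "S2 - closure C = xx ` strip"
proof
  show "xx ` strip \<subseteq> S2 - closure C" using xx_S2 strip_ext by auto
  show "S2 - closure C \<subseteq> xx ` strip"
  proof
    fix x assume x: "x \<in> S2 - closure C"
    then have "norm x = 1" "x \<noteq> p" "x \<noteq> - p" using p_in_C by (auto simp: S2_def)
    then obtain z where z: "xx z = x" "0 \<le> Im z" "Im z < 2 * pi" using xx_surj by blast
    then have "\<not> Im z \<le> \<alpha>" using xx_in_closure_C[of z] x by auto
    then show "x \<in> xx ` strip" using z by (auto simp: strip_def)
  qed
qed

lemmas adm' = adm[folded C_def, unfolded admissible_exterior_def, folded G0_def]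

lemma Omega_sub: "\<Omega> \<subseteq> xx ` strip" using adm' exterior by blast

lemma Omega_S2: "\<Omega> \<subseteq> S2" using adm' by blast

lemma closure_Omega_S2: "closure \<Omega> \<subseteq> S2"
  using closure_minimal[OF Omega_S2] by (simp add: S2_def)

lemma Omega_open: obtains T where "open T" "\<Omega> = S2 \<inter> T"
  using adm' unfolding openin_open by blast

lemma s_interior_Omega: "s_interior \<Omega> = \<Omega>"
proof -
  obtain T where T: "open T" "\<Omega> = S2 \<inter> T" by (rule Omega_open)
  have "\<exists>e>0. \<forall>y\<in>S2. dist y x < e \<longrightarrow> y \<in> \<Omega>" if "x \<in> \<Omega>" for x
    using T that unfolding open_dist by blast
  then show ?thesis unfolding s_interior_def by blast
qed

lemma sbd_Omega: "sbd \<Omega> = closure \<Omega> - \<Omega>" by (simp add: sbd_def s_interior_Omega)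

text \<open>A point of \<open>closure \<Omega>\<close> in the closed cone cannot be interior to
  \<open>C\<close>, because \<Omega> avoids \<open>C\<close>; so it lies on \<open>sbd C\<close>.
  Removing \<open>sbd C\<close> from the boundary therefore leaves exactly the part outside the
  closed cone.\<close>

lemma G0_eq: "G0 = (closure \<Omega> - \<Omega>) \<inter> xx ` strip"
proof -
  have "x \<in> sbd C" if xc: "x \<in> closure \<Omega>" "x \<in> closure C" for x
  proof (rule ccontr)
    assume "x \<notin> sbd C"
    then have "x \<in> s_interior C" using xc by (auto simp: sbd_def)
    then obtain e where e: "e > 0" "\<And>y. y \<in> S2 \<Longrightarrow> dist y x < e \<Longrightarrow> y \<in> C" unfolding s_interior_def by blast
    obtain y where "y \<in> \<Omega>" "dist y x < e" using xc(1) e(1) unfolding closure_approachable by blast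
    then show False using e(2)[of y] adm' closure_subset[of C] by blast
  qed
  moreover have "x \<notin> sbd C" if "x \<in> xx ` strip" for x using that exterior by (auto simp: sbd_def)
  moreover have "x \<in> closure C \<or> x \<in> xx ` strip" if "x \<in> closure \<Omega>" for x
    using that closure_Omega_S2 exterior by blast
  ultimately show ?thesis unfolding G0_def Gamma0_def sbd_Omega by blast
qed

lemma G0_closure: "closure G0 \<subseteq> closure \<Omega> - \<Omega>"
proof -
  obtain T where T: "open T" "\<Omega> = S2 \<inter> T" by (rule Omega_open)
  have "closure \<Omega> - \<Omega> = closure \<Omega> - T" using T closure_Omega_S2 by blast
  then have "closed (closure \<Omega> - \<Omega>)" using T by (simp add: closed_Diff)
  then show ?thesis using G0_eq by (intro closure_minimal) auto
qed

lemma corner_set: "x \<in> closure G0 \<Longrightarrow> x \<notin> xx ` strip \<Longrightarrow> x \<in> closure G0 - G0"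
  using G0_eq by blast

lemma D_open: "open D"
proof -
  obtain T where T: "open T" "\<Omega> = S2 \<inter> T" by (rule Omega_open)
  have "open (xx -` T)" by (intro open_vimage T cont_frame)
  moreover have "open strip" unfolding strip_def by (intro open_Collect_conj open_Collect_less continuous_intros)
  moreover have "D = strip \<inter> xx -` T" unfolding D_def using T(2) xx_S2 by blast
  ultimately show ?thesis by auto
qed

lemma xx_closure_D: "z \<in> closure D \<Longrightarrow> xx z \<in> closure \<Omega>"
  using image_closure_subset[OF cont_frame(1)[of "closure D"], of "closure \<Omega>"] closure_subset[of \<Omega>]
  by (auto simp: D_def image_subset_iff)

lemma xx_closure_N: "z \<in> closure N \<Longrightarrow> xx z \<in> closure G0"
  using image_closure_subset[OF cont_frame(1)[of "closure N"], of "closure G0"] closure_subset[of G0]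
  by (auto simp: N_def image_subset_iff)

lemma lift_Omega:
  assumes "x \<in> closure \<Omega>" "x \<noteq> p" "x \<noteq> - p"
  obtains z where "z \<in> closure D" "xx z = x" "\<alpha> \<le> Im z" "Im z \<le> 2 * pi"
  using lift_closure[OF assms Omega_sub, of \<alpha> "2 * pi"] unfolding D_def by (auto simp: strip_def)

lemma lift_G0:
  assumes "x \<in> closure G0" "x \<noteq> p" "x \<noteq> - p"
  obtains z where "z \<in> closure N" "xx z = x" "\<alpha> \<le> Im z" "Im z \<le> 2 * pi"
  using lift_closure[OF assms, of strip \<alpha> "2 * pi"] G0_eq unfolding N_def by (auto simp: strip_def)

lemma strip_inj: "xx z = xx y \<Longrightarrow> \<alpha> \<le> Im z \<Longrightarrow> Im z \<le> 2 * pi \<Longrightarrow> \<alpha> \<le> Im y \<Longrightarrow> Im y \<le> 2 * pi \<Longrightarrow> z = y"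
  using alpha by (intro xx_inj) (auto simp: abs_less_iff)

lemma D_cl: "z \<in> closure D \<Longrightarrow> z \<in> strip \<Longrightarrow> z \<in> D \<union> N"
  using xx_closure_D[of z] G0_eq by (auto simp: D_def N_def)

lemma N_closure: "N \<subseteq> closure D"
proof
  fix z assume z: "z \<in> N"
  then have "xx z \<in> closure \<Omega>" using G0_eq by (auto simp: N_def)
  then obtain y where "y \<in> closure D" "xx y = xx z" "\<alpha> \<le> Im y" "Im y \<le> 2 * pi" using lift_Omega xx_not_pole by metis
  then show "z \<in> closure D" using strip_inj[of y z] z by (auto simp: N_def strip_def)
qed

lemma DN: "D \<inter> N = {}" using G0_eq by (auto simp: D_def N_def)

lemma N_nonempty: "N \<noteq> {}"
proof -
  obtain x where "x \<in> G0" using adm' by blast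
  then show ?thesis using G0_eq by (auto simp: N_def)
qed

lemma p_not_G0: "p \<in> closure \<Omega>" "p \<notin> closure G0"
proof -
  show "p \<in> closure \<Omega>" using adm' sbd_Omega by blast
  have "p \<notin> xx ` strip" using xx_not_pole(1) by (metis imageE)
  then show "p \<notin> closure G0" using adm' corner_set by blast
qed

text \<open>Since \<open>p\<close> is not in the closure of \<open>\<Gamma>\<^sub>0\<close>, the domain fills the exterior of the cone near \<open>p\<close>.\<close>

lemma D_low: "\<exists>L. (\<forall>z. Re z < L \<longrightarrow> z \<in> strip \<longrightarrow> z \<in> D) \<and> (\<forall>z. Re z < L \<longrightarrow> z \<notin> closure N)"
proof -
  obtain d where d: "d > 0" "\<And>x. dist x p < d \<Longrightarrow> x \<notin> closure G0"
    using p_not_G0(2) closed_closure[of G0] unfolding closed_def open_dist by (metis ComplD ComplI)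
  have "((\<lambda>s::real. 2 + 2 * tanh s) \<longlongrightarrow> 2 + 2 * (-1)) at_bot" by (intro tendsto_intros tanh_real_at_bot)
  then have "((\<lambda>s::real. 2 + 2 * tanh s) \<longlongrightarrow> (0::real)) at_bot" by simp
  then have "\<forall>\<^sub>F s in at_bot. 2 + 2 * tanh s < d^2" using d(1) by (intro order_tendstoD) auto
  then obtain L where L: "2 + 2 * tanh L < d^2" unfolding eventually_at_bot_linorder by blast
  have near: "dist (xx z) p < d" if "Re z < L" for z
  proof -
    have "tanh (Re z) < tanh L" using that by simp
    then have "2 + 2 * tanh (Re z) < d^2" using L by linarith
    then have "(dist (xx z) p)^2 < d^2" by (simp only: dist_pole)
    then show ?thesis by (rule power2_less_imp_less) (use d(1) in simp)
  qed
  have cN: "z \<notin> closure N" if "Re z < L" for z using d(2)[OF near[OF that]] xx_closure_N[of z] by blast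
  define V where "V = {z. Re z < L} \<inter> ({z. Im z > \<alpha>} \<inter> {z. Im z < 2 * pi})"
  have "V \<subseteq> D"
  proof (rule connected_fill[OF _ D_open])
    show "connected V" unfolding V_def
      by (intro convex_connected convex_Int convex_halfspace_Re_lt convex_halfspace_Im_gt convex_halfspace_Im_lt)
    show "z \<in> D" if "z \<in> V" "z \<in> closure (V \<inter> D)" for z
    proof -
      have "z \<in> closure D" using that(2) closure_mono[of "V \<inter> D" D] by blast
      moreover have "z \<in> strip" "z \<notin> N" using that(1) cN[of z] closure_subset[of N] by (auto simp: V_def strip_def)
      ultimately show ?thesis using D_cl by blast
    qed
    have "2 + 2 * tanh L > 0" using tanh_real_gt_neg1[of L] by linarith
    then have "sqrt (2 + 2 * tanh L) > 0" by simp
    then obtain y where y: "y \<in> \<Omega>" "dist y p < sqrt (2 + 2 * tanh L)"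
      using p_not_G0(1) unfolding closure_approachable by blast
    then obtain z where z: "z \<in> strip" "y = xx z" using Omega_sub by blast
    have "(dist y p)^2 < 2 + 2 * tanh L"
      using y(2) \<open>2 + 2 * tanh L > 0\<close> by (metis real_less_rsqrt real_sqrt_less_iff real_sqrt_abs abs_of_nonneg zero_le_dist)
    then have "tanh (Re z) < tanh L" unfolding z(2) dist_pole by linarith
    then have "Re z < L" by simp
    then have "z \<in> V \<inter> D" using z y by (auto simp: V_def D_def strip_def)
    then show "V \<inter> D \<noteq> {}" by blast
  qed
  then have "\<forall>z. Re z < L \<longrightarrow> z \<in> strip \<longrightarrow> z \<in> D" by (auto simp: V_def strip_def)
  then show ?thesis using cN by blast
qed

definition ns :: "complex \<Rightarrow> real" where "ns z = \<nu> (xx z) \<bullet> xs z"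
definition nt :: "complex \<Rightarrow> real" where "nt z = \<nu> (xx z) \<bullet> xt z"

lemma normal_G0:
  assumes "z \<in> N"
  shows "norm (\<nu> (xx z)) = 1" "\<nu> (xx z) \<bullet> xx z = 0"
    "\<And>e. e > 0 \<Longrightarrow> \<exists>d>0. \<forall>y\<in>closure \<Omega> - \<Omega>. norm (y - xx z) < d \<longrightarrow> \<bar>(y - xx z) \<bullet> \<nu> (xx z)\<bar> \<le> e * norm (y - xx z)"
    "\<exists>\<epsilon>>0. \<forall>t. 0 < t \<and> t < \<epsilon> \<longrightarrow> geo (xx z) (\<nu> (xx z)) t \<notin> closure \<Omega>"
proof -
  have "outward_normal \<Omega> (xx z) (\<nu> (xx z))" using nu[folded C_def] assms by (auto simp: N_def G0_def)
  then show "norm (\<nu> (xx z)) = 1" "\<nu> (xx z) \<bullet> xx z = 0"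
    "\<And>e. e > 0 \<Longrightarrow> \<exists>d>0. \<forall>y\<in>closure \<Omega> - \<Omega>. norm (y - xx z) < d \<longrightarrow> \<bar>(y - xx z) \<bullet> \<nu> (xx z)\<bar> \<le> e * norm (y - xx z)"
    "\<exists>\<epsilon>>0. \<forall>t. 0 < t \<and> t < \<epsilon> \<longrightarrow> geo (xx z) (\<nu> (xx z)) t \<notin> closure \<Omega>"
    unfolding outward_normal_def sbd_Omega by blast+
qed

lemma grad_r_xx: "grad_r p (xx z) = cosh (Re z) *\<^sub>R xs z"
proof -
  have "1 - (p \<bullet> xx z)^2 = (sech (Re z))^2" by (simp add: xx_inner sech_sq)
  then have "sqrt (1 - (p \<bullet> xx z)^2) = sech (Re z)" by (simp add: less_imp_le)
  moreover have "(p \<bullet> xx z) *\<^sub>R xx z - p = xs z"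
  proof -
    have e: "(sech (Re z) * sech (Re z)) *\<^sub>R p + (tanh (Re z) * tanh (Re z)) *\<^sub>R p = p"
      unfolding scaleR_add_left[symmetric] using tanh_sech[of "Re z"] by (simp add: power2_eq_square)
    show ?thesis by (simp add: xx_inner) (simp add: xx_def xs_def power2_eq_square algebra_simps e)
  qed
  ultimately show ?thesis by (simp add: grad_r_def sech_def)
qed

lemma ns_pos: assumes "z \<in> N" shows "ns z > 0"
proof -
  have "grad_r p (xx z) \<bullet> \<nu> (xx z) > 0"
    using star[folded C_def] assms unfolding star_shaped_wrt_def by (auto simp: N_def G0_def)
  then have "cosh (Re z) * ns z > 0" by (simp add: grad_r_xx ns_def inner_commute)
  then show ?thesis by (rule zero_less_mult_pos) simp
qed

lemma N_cone:
  assumes z: "z \<in> N" and e: "e > 0"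
  shows "\<exists>d>0. \<forall>y\<in>N. cmod (y - z) < d \<longrightarrow> \<bar>ns z * (Re y - Re z) + nt z * (Im y - Im z)\<bar> \<le> e * cmod (y - z)"
proof -
  define n where "n = \<nu> (xx z)"
  have n: "norm n = 1" using normal_G0(1)[OF z] by (simp add: n_def)
  define k where "k = norm (xs z) + norm (xt z) + 1"
  have k: "k > 0" by (simp add: k_def add_nonneg_pos)
  define e1 where "e1 = e / (2 * k)"
  have e1: "e1 > 0" using e k by (simp add: e1_def)
  obtain d1 where d1: "d1 > 0" "\<And>y. y \<in> closure \<Omega> - \<Omega> \<Longrightarrow> norm (y - xx z) < d1 \<Longrightarrow> \<bar>(y - xx z) \<bullet> n\<bar> \<le> e1 * norm (y - xx z)"
    using normal_G0(3)[OF z e1] unfolding n_def by blast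
  define e2 where "e2 = min 1 (e / 2)"
  have e2: "e2 > 0" "e2 \<le> 1" "e2 \<le> e / 2" using e by (auto simp: e2_def)
  obtain d2 where d2: "d2 > 0" "\<And>y. norm (y - z) < d2 \<Longrightarrow>
     norm (xx y - xx z - (Re (y - z) *\<^sub>R xs z + Im (y - z) *\<^sub>R xt z)) \<le> e2 * norm (y - z)"
    using der_xx[of z] e2(1) unfolding has_derivative_at_alt by blast
  define d where "d = min d2 (d1 / k)"
  have d: "d > 0" using d1 d2 k by (simp add: d_def)
  have "\<bar>ns z * (Re y - Re z) + nt z * (Im y - Im z)\<bar> \<le> e * cmod (y - z)" if y: "y \<in> N" "cmod (y - z) < d" for y
  proof -
    define v where "v = Re (y - z) *\<^sub>R xs z + Im (y - z) *\<^sub>R xt z"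
    define r where "r = xx y - xx z - v"
    have r: "norm r \<le> e2 * cmod (y - z)" using d2(2)[of y] y(2) by (simp add: r_def v_def d_def)
    have "norm v \<le> \<bar>Re (y - z)\<bar> * norm (xs z) + \<bar>Im (y - z)\<bar> * norm (xt z)"
      unfolding v_def by (rule order.trans[OF norm_triangle_ineq]) simp
    also have "\<dots> \<le> cmod (y - z) * norm (xs z) + cmod (y - z) * norm (xt z)"
      using abs_Re_le_cmod[of "y - z"] abs_Im_le_cmod[of "y - z"] by (intro add_mono mult_right_mono) auto
    finally have v: "norm v \<le> cmod (y - z) * norm (xs z) + cmod (y - z) * norm (xt z)" .
    have "e2 * cmod (y - z) \<le> 1 * cmod (y - z)" using e2 by (intro mult_right_mono) auto
    then have nxy: "norm (xx y - xx z) \<le> k * cmod (y - z)"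
      using norm_triangle_ineq[of v r] v r by (simp add: r_def k_def algebra_simps)
    have "k * cmod (y - z) < d1" using y(2) k by (simp add: d_def field_simps)
    then have "norm (xx y - xx z) < d1" using nxy by linarith
    moreover have "xx y \<in> closure \<Omega> - \<Omega>" using y(1) G0_eq by (auto simp: N_def)
    ultimately have "\<bar>(xx y - xx z) \<bullet> n\<bar> \<le> e1 * norm (xx y - xx z)" using d1(2) by blast
    also have "\<dots> \<le> e1 * (k * cmod (y - z))" using nxy e1 by (intro mult_left_mono) auto
    also have "\<dots> = e / 2 * cmod (y - z)" using k by (simp add: e1_def)
    finally have 1: "\<bar>(xx y - xx z) \<bullet> n\<bar> \<le> e / 2 * cmod (y - z)" .
    have "\<bar>r \<bullet> n\<bar> \<le> norm r * norm n" by (rule Cauchy_Schwarz_ineq2)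
    also have "\<dots> \<le> e2 * cmod (y - z)" using r n by simp
    also have "\<dots> \<le> e / 2 * cmod (y - z)" using e2 by (intro mult_right_mono) auto
    finally have 2: "\<bar>r \<bullet> n\<bar> \<le> e / 2 * cmod (y - z)" .
    have "ns z * (Re y - Re z) + nt z * (Im y - Im z) = v \<bullet> n"
      by (simp add: v_def ns_def nt_def n_def inner_add_left inner_commute[of "\<nu> (xx z)"] mult.commute)
    also have "v \<bullet> n = (xx y - xx z) \<bullet> n - r \<bullet> n" by (simp add: r_def inner_diff_left)
    also have "\<bar>\<dots>\<bar> \<le> \<bar>(xx y - xx z) \<bullet> n\<bar> + \<bar>r \<bullet> n\<bar>" by (rule abs_triangle_ineq4)
    also have "\<dots> \<le> e / 2 * cmod (y - z) + e / 2 * cmod (y - z)" using 1 2 by (rule add_mono)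
    finally show ?thesis by simp
  qed
  then show ?thesis using d by blast
qed

text \<open>Turning the direction from the outward normal to the radial one at fixed geodesic distance, one does not meet
  the boundary, by the tangent cone condition.\<close>

lemma radial_exit:
  assumes z: "z \<in> N"
  shows "\<exists>t1>0. \<forall>t. 0 < t \<and> t < t1 \<longrightarrow> geo (xx z) (cosh (Re z) *\<^sub>R xs z) t \<notin> closure \<Omega>"
proof -
  define x n e where "x = xx z" and "n = \<nu> (xx z)" and "e = cosh (Re z) *\<^sub>R xs z"
  have x: "x \<bullet> x = 1" by (simp add: x_def xx_inner)
  have n: "n \<bullet> n = 1" "n \<bullet> x = 0" "x \<bullet> n = 0" using normal_G0(1,2)[OF z] by (simp_all add: n_def x_def norm_eq_1 inner_commute)
  have ee: "e \<bullet> e = 1" "e \<bullet> x = 0" using tangent_frame[of z] by (simp_all add: e_def x_def inner_commute)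
  define \<kappa> where "\<kappa> = n \<bullet> e"
  have \<kappa>: "\<kappa> > 0" using ns_pos[OF z] by (simp add: \<kappa>_def n_def e_def ns_def)
  have \<kappa>1: "\<kappa> \<le> 1" using norm_cauchy_schwarz[of n e] n ee by (simp add: \<kappa>_def norm_eq_sqrt_inner)
  have "\<kappa> / 2 > 0" using \<kappa> by simp
  then obtain d where d: "d > 0" "\<And>y. y \<in> closure \<Omega> - \<Omega> \<Longrightarrow> norm (y - x) < d \<Longrightarrow> \<bar>(y - x) \<bullet> n\<bar> \<le> \<kappa> / 2 * norm (y - x)"
    using normal_G0(3)[OF z, of "\<kappa> / 2"] unfolding n_def x_def by blast
  obtain \<epsilon> where \<epsilon>: "\<epsilon> > 0" "\<And>t. 0 < t \<Longrightarrow> t < \<epsilon> \<Longrightarrow> geo x n t \<notin> closure \<Omega>"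
    using normal_G0(4)[OF z] unfolding x_def n_def by blast
  \<comment> \<open>\<open>t1 \<le> 1\<close> gives \<open>cos (t / 2) > 1 / 2\<close>. Then a
    displacement along a direction \<open>m l\<close> with
    \<open>m l \<bullet> n \<ge> \<kappa>\<close> has a component along \<open>n\<close> of more
    than \<open>\<kappa> / 2\<close> times the chord, which the choice of \<open>d\<close> forbids
    for boundary points.\<close>
  define t1 where "t1 = Min {d, \<epsilon>, 1}"
  have t1: "t1 > 0" "t1 \<le> d" "t1 \<le> \<epsilon>" "t1 \<le> 1" using d \<epsilon> by (auto simp: t1_def)
  obtain T where T: "open T" "\<Omega> = S2 \<inter> T" by (rule Omega_open)
  have "geo x e t \<notin> closure \<Omega>" if t: "0 < t" "t < t1" for t
  proof
    assume bad: "geo x e t \<in> closure \<Omega>"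
    \<comment> \<open>The segment from the normal to the radial direction. Since
      \<open>\<kappa> \<le> 1\<close>, its inner product with \<open>n\<close> never drops below
      \<kappa>, and normalising can only raise it.\<close>
    define q where "q = (\<lambda>l. (1 - l) *\<^sub>R n + l *\<^sub>R e)"
    have qn: "q l \<bullet> n \<ge> \<kappa>" if "0 \<le> l" "l \<le> 1" for l
    proof -
      have "(1 - l) * 1 \<ge> (1 - l) * \<kappa>" using that \<kappa>1 by (intro mult_left_mono) auto
      then show ?thesis by (simp add: q_def inner_add_left n inner_commute[of e n] \<kappa>_def[symmetric] algebra_simps)
    qed
    have q0: "q l \<noteq> 0" if "0 \<le> l" "l \<le> 1" for l using qn[OF that] \<kappa> by auto
    have qle: "norm (q l) \<le> 1" if "0 \<le> l" "l \<le> 1" for l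
    proof -
      have "norm (q l) \<le> norm ((1 - l) *\<^sub>R n) + norm (l *\<^sub>R e)" unfolding q_def by (rule norm_triangle_ineq)
      then show ?thesis using that n ee by (simp add: norm_eq_sqrt_inner)
    qed
    define m where "m = (\<lambda>l. (1 / norm (q l)) *\<^sub>R q l)"
    have m: "m l \<bullet> m l = 1" "m l \<bullet> x = 0" "m l \<bullet> n \<ge> \<kappa>" "x \<bullet> m l = 0" if l: "0 \<le> l" "l \<le> 1" for l
    proof -
      have "norm (m l) = 1" using q0[OF l] by (simp add: m_def)
      then show "m l \<bullet> m l = 1" by (simp add: norm_eq_1)
      show "m l \<bullet> x = 0" by (simp add: m_def q_def inner_add_left n ee)
      then show "x \<bullet> m l = 0" by (simp add: inner_commute)
      have "\<kappa> \<le> (q l \<bullet> n) / 1" using qn[OF l] by simp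
      also have "\<dots> \<le> (q l \<bullet> n) / norm (q l)" using qn[OF l] \<kappa> q0[OF l] qle[OF l] by (intro divide_left_mono) auto
      finally show "m l \<bullet> n \<ge> \<kappa>" by (simp add: m_def)
    qed
    define P where "P = (\<lambda>l. geo x (m l) t) ` {0..1}"
    have PS: "P \<subseteq> S2"
    proof
      fix y assume "y \<in> P"
      then obtain l where l: "0 \<le> l" "l \<le> 1" "y = geo x (m l) t" by (auto simp: P_def)
      have "y \<bullet> y = (cos t)^2 + (sin t)^2"
        using m[OF l(1,2)] x by (simp add: l(3) geo_def inner_add_left inner_add_right power2_eq_square)
      then show "y \<in> S2" by (simp add: S2_def norm_eq_1)
    qed
    have Pb: "y \<notin> closure \<Omega> - \<Omega>" if yP: "y \<in> P" for y
    proof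
      assume y: "y \<in> closure \<Omega> - \<Omega>"
      obtain l where l: "0 \<le> l" "l \<le> 1" "y = geo x (m l) t" using yP by (auto simp: P_def)
      have s: "sin (t / 2) > 0" using t t1 pi_gt3 by (intro sin_gt_zero) auto
      have c: "cos (t / 2) > 1 / 2"
      proof -
        have "cos (pi / 3) < cos (t / 2)" using t t1 pi_gt3 by (intro cos_monotone_0_pi) auto
        then show ?thesis by (simp add: cos_60)
      qed
      have "(y - x) \<bullet> (y - x) = (cos t - 1)^2 + (sin t)^2"
        using m[OF l(1,2)] x by (simp add: l(3) geo_def inner_diff_left inner_diff_right inner_add_left inner_add_right power2_eq_square algebra_simps)
      also have "\<dots> = 2 - 2 * cos t" using sin_cos_squared_add[of t] by (simp add: power2_eq_square algebra_simps)
      also have "\<dots> = (2 * sin (t / 2))^2" using cos_double_sin[of "t / 2"] by (simp add: power_mult_distrib)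
      finally have "(norm (y - x))^2 = (2 * sin (t / 2))^2" by (simp add: power2_norm_eq_inner)
      then have ny: "norm (y - x) = 2 * sin (t / 2)" by (rule power2_eq_imp_eq) (use s in auto)
      have "2 * sin (t / 2) \<le> t" using sin_x_le_x[of "t / 2"] t by simp
      then have "norm (y - x) < d" using ny t t1 by linarith
      from d(2)[OF y this] have "\<bar>(y - x) \<bullet> n\<bar> \<le> \<kappa> / 2 * (2 * sin (t / 2))" by (simp add: ny)
      moreover have "(y - x) \<bullet> n = sin t * (m l \<bullet> n)"
        using n by (simp add: l(3) geo_def inner_diff_left inner_add_left)
      moreover have "sin t = 2 * sin (t / 2) * cos (t / 2)" using sin_double[of "t / 2"] by simp
      moreover have "2 * sin (t / 2) * cos (t / 2) * (m l \<bullet> n) > 2 * sin (t / 2) * (1 / 2) * \<kappa>"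
        using s c m(3)[OF l(1,2)] \<kappa> by (intro mult_less_le_imp_less mult_strict_left_mono) auto
      ultimately show False by (simp add: abs_le_iff mult.commute[of \<kappa>])
    qed
    have "P \<subseteq> T"
    proof (rule connected_fill)
      have "continuous_on {0..1} (\<lambda>l. geo x (m l) t)"
        unfolding geo_def m_def by (intro continuous_intros) (use q0 in \<open>auto simp: q_def intro!: continuous_intros\<close>)
      then show "connected P" unfolding P_def by (intro connected_continuous_image) auto
      show "open T" by fact
      show "y \<in> T" if "y \<in> P" "y \<in> closure (P \<inter> T)" for y
      proof -
        have "P \<inter> T \<subseteq> \<Omega>" using PS T by blast
        then have "y \<in> closure \<Omega>" using that(2) closure_mono by blast
        then show ?thesis using Pb[OF that(1)] T by blast
      qed
      have "m 1 = e" using ee by (simp add: m_def q_def norm_eq_sqrt_inner)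
      then have "geo x e t \<in> P" unfolding P_def by (intro image_eqI[of _ _ 1]) auto
      then have "geo x e t \<in> P \<inter> T" using bad Pb[of "geo x e t"] T by blast
      then show "P \<inter> T \<noteq> {}" by blast
    qed
    moreover have "m 0 = n" using n by (simp add: m_def q_def norm_eq_sqrt_inner)
    then have "geo x n t \<in> P" unfolding P_def by (intro image_eqI[of _ _ 0]) auto
    ultimately have "geo x n t \<in> \<Omega>" using PS T by blast
    then show False using \<epsilon>(2)[of t] t t1 closure_subset[of \<Omega>] by auto
  qed
  then show ?thesis using t1(1) unfolding x_def e_def by blast
qed

text \<open>The column above \<open>z\<close> is the radial geodesic through \<open>xx z\<close>,
  parametrised by the polar distance \<open>r s\<close>, so \<open>radial_exit\<close> carries over
  to the chart.\<close>

lemma N_up: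
  assumes z: "z \<in> N"
  shows "\<exists>d>0. \<forall>h. 0 < h \<and> h < d \<longrightarrow> Complex (Re z + h) (Im z) \<notin> closure D"
proof -
  obtain t1 where t1: "t1 > 0" "\<And>t. 0 < t \<Longrightarrow> t < t1 \<Longrightarrow> geo (xx z) (cosh (Re z) *\<^sub>R xs z) t \<notin> closure \<Omega>"
    using radial_exit[OF z] by blast
  define r where "r = (\<lambda>s. arccos (- tanh s))"
  have b: "-1 < - tanh s" "- tanh s < 1" for s :: real using tanh_real_bounds[of s] by auto
  have r: "0 < r s" "r s < pi" "cos (r s) = - tanh s" "sin (r s) = sech s" for s
  proof -
    show rs: "0 < r s" "r s < pi" "cos (r s) = - tanh s"
      using arccos_lt_bounded[OF b] cos_arccos[of "- tanh s"] b[of s] by (auto simp: r_def)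
    have "(sech s)^2 = (sin (r s))^2" using rs by (simp add: sech_sq sin_squared_eq)
    then show "sin (r s) = sech s" using sin_gt_zero[OF rs(1,2)] sech_pos[of s] by (simp add: power2_eq_iff_nonneg less_imp_le)
  qed
  have "isCont r (Re z)" unfolding r_def
    by (rule isCont_o2[where f = "\<lambda>s. - tanh s" and g = arccos]) (auto intro!: continuous_intros isCont_arccos b)
  then obtain d where d: "d > 0" "\<And>s. \<bar>s - Re z\<bar> < d \<Longrightarrow> \<bar>r s - r (Re z)\<bar> < t1"
    using t1(1) unfolding continuous_at_eps_delta dist_real_def by blast
  have "Complex (Re z + h) (Im z) \<notin> closure D" if h: "0 < h" "h < d" for h
  proof -
    define t where "t = r (Re z + h) - r (Re z)"
    have "- tanh (Re z + h) < - tanh (Re z)" using h by simp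
    then have "t > 0" unfolding t_def r_def using arccos_less_arccos[of "- tanh (Re z + h)" "- tanh (Re z)"] b[of "Re z + h"] b[of "Re z"] by simp
    moreover have "t < t1" using d(2)[of "Re z + h"] h by (simp add: t_def abs_less_iff)
    ultimately have "geo (xx z) (cosh (Re z) *\<^sub>R xs z) t \<notin> closure \<Omega>" by (rule t1(2))
    moreover have "geo (xx z) (cosh (Re z) *\<^sub>R xs z) t = xx (Complex (Re z + h) (Im z))"
    proof -
      have 1: "xx z = cos (r (Re z)) *\<^sub>R p + sin (r (Re z)) *\<^sub>R circ (Im z)" by (simp add: r xx_def)
      have "cosh (Re z) * (sech (Re z) * tanh (Re z)) = tanh (Re z)" "cosh (Re z) * (sech (Re z))^2 = sech (Re z)"
        by (simp_all add: sech_def power2_eq_square)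
      then have 2: "cosh (Re z) *\<^sub>R xs z = cos (r (Re z)) *\<^sub>R circ (Im z) - sin (r (Re z)) *\<^sub>R p"
        by (simp add: r xs_def scaleR_diff_right)
      have "geo (xx z) (cosh (Re z) *\<^sub>R xs z) t = cos (r (Re z) + t) *\<^sub>R p + sin (r (Re z) + t) *\<^sub>R circ (Im z)"
        unfolding geo_def 1 2 by (simp add: cos_add sin_add algebra_simps)
      also have "r (Re z) + t = r (Re z + h)" by (simp add: t_def)
      finally show ?thesis by (simp add: r xx_def)
    qed
    ultimately show ?thesis using xx_closure_D by metis
  qed
  then show ?thesis using d(1) by blast
qed

definition "L = (SOME L. (\<forall>z. Re z < L \<longrightarrow> z \<in> strip \<longrightarrow> z \<in> D) \<and> (\<forall>z. Re z < L \<longrightarrow> z \<notin> closure N))"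

lemma L: "Re z < L \<Longrightarrow> z \<in> strip \<Longrightarrow> z \<in> D" "Re z < L \<Longrightarrow> z \<notin> closure N"
  using someI_ex[OF D_low] unfolding L_def by blast+

sublocale planar_strip \<alpha> "2 * pi" L D N ns nt
proof
  show "z \<in> D \<union> N" if "z \<in> closure D" "\<alpha> < Im z" "Im z < 2 * pi" for z
    using D_cl[of z] that by (simp add: strip_def)
qed (use alpha_lt D_open N_closure DN L(1) N_up ns_pos N_cone in \<open>auto simp: D_def N_def strip_def\<close>)

end

lemma sech_cosh_cancel: "(sech s)^2 * ((cosh s)^2 * k) = k"
  by (simp add: sech_def power_divide)

section \<open>The faces of the cone, the corners and the antipode\<close>

context cone_domain
begin

lemma line_closure_Omega:
  assumes "z \<in> closure D" "Im z = \<alpha> \<or> Im z = 2 * pi"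
  shows "xx z \<in> closure \<Omega> - \<Omega>"
  using xx_closure_D[OF assms(1)] xx_line[OF assms(2)] Omega_sub strip_ext by auto

lemma closure_N_iff:
  assumes "\<alpha> \<le> Im z" "Im z \<le> 2 * pi" shows "z \<in> closure N \<longleftrightarrow> xx z \<in> closure G0"
proof
  assume "xx z \<in> closure G0"
  then obtain y where "y \<in> closure N" "xx y = xx z" "\<alpha> \<le> Im y" "Im y \<le> 2 * pi" using lift_G0 xx_not_pole by metis
  then show "z \<in> closure N" using strip_inj[of y z] assms by auto
qed (rule xx_closure_N)

text \<open>Near \<open>z\<close> the whole boundary line maps into the boundary of \<Omega>. Moving
  along it by \<open>h\<close>, the tangent cone condition bounds
  \<open>h * \<bar>xs z \<bullet> n\<bar>\<close> by an arbitrarily small multiple of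
  \<open>h\<close>.\<close>

lemma line_normal:
  assumes z: "z \<in> closure D" "Im z = \<alpha> \<or> Im z = 2 * pi" "z \<notin> closure N"
  shows "xx z \<in> Gamma1 C \<Omega> - {p}" "norm (\<nu> (xx z)) = 1" "\<nu> (xx z) \<bullet> xx z = 0" "\<nu> (xx z) \<bullet> xs z = 0"
proof -
  have Imz: "\<alpha> \<le> Im z" "Im z \<le> 2 * pi" using z(2) alpha_lt by auto
  have "xx z \<notin> closure G0" using z(3) closure_N_iff[OF Imz] by simp
  then show G1: "xx z \<in> Gamma1 C \<Omega> - {p}"
    using line_closure_Omega[OF z(1,2)] xx_not_pole(1)[of z] by (auto simp: Gamma1_def sbd_Omega G0_def)
  have on: "outward_normal \<Omega> (xx z) (\<nu> (xx z))" using nu[folded C_def] G1 by blast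
  then show "norm (\<nu> (xx z)) = 1" "\<nu> (xx z) \<bullet> xx z = 0" unfolding outward_normal_def by blast+
  define n where "n = \<nu> (xx z)"
  have cone: "\<exists>d>0. \<forall>y\<in>closure \<Omega> - \<Omega>. norm (y - xx z) < d \<longrightarrow> \<bar>(y - xx z) \<bullet> n\<bar> \<le> e * norm (y - xx z)" if "e > 0" for e
    using on that unfolding outward_normal_def sbd_Omega n_def by blast
  obtain d where d: "d > 0" "\<And>y. cmod (y - z) < d \<Longrightarrow> \<alpha> < Im y \<Longrightarrow> Im y < 2 * pi \<Longrightarrow> y \<in> D"
    "\<And>y. cmod (y - z) < d \<Longrightarrow> y \<notin> closure N" using line_fill[OF z(1,3)] by blast
  have "\<bar>xs z \<bullet> n\<bar> \<le> e * (norm (xs z) + 2)" if e: "e > 0" "e \<le> 1" for e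
  proof -
    obtain r where r: "r > 0" "\<And>y. y \<in> closure \<Omega> - \<Omega> \<Longrightarrow> norm (y - xx z) < r \<Longrightarrow> \<bar>(y - xx z) \<bullet> n\<bar> \<le> e * norm (y - xx z)"
      using cone[OF e(1)] by blast
    obtain d2 where d2: "d2 > 0" "\<And>y. norm (y - z) < d2 \<Longrightarrow>
       norm (xx y - xx z - (Re (y - z) *\<^sub>R xs z + Im (y - z) *\<^sub>R xt z)) \<le> e * norm (y - z)"
      using der_xx[of z] e(1) unfolding has_derivative_at_alt by blast
    define k where "k = norm (xs z) + 1"
    have k: "k > 0" by (simp add: k_def add_nonneg_pos)
    define l where "l = r / k"
    have l: "l > 0" using r(1) k by (simp add: l_def)
    define h where "h = min d (min d2 l) / 2"
    have h: "h > 0" "h < d" "h < d2" "h < l" using d(1) d2(1) l by (auto simp: h_def min_def)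
    define y where "y = Complex (Re z + h) (Im z)"
    have yz: "norm (y - z) = h" using h(1) by (simp add: y_def cmod_def)
    define v where "v = xx y - xx z - h *\<^sub>R xs z"
    have v: "norm v \<le> e * h" using d2(2)[of y] yz h by (simp add: v_def y_def)
    have "y \<in> closure D" unfolding y_def
      by (rule line_in_closure[OF d(1,2) z(2)]) (use h in auto)
    then have yb: "xx y \<in> closure \<Omega> - \<Omega>" by (rule line_closure_Omega) (use z(2) in \<open>simp add: y_def\<close>)
    have split: "xx y - xx z = v + h *\<^sub>R xs z" by (simp add: v_def)
    have "norm (xx y - xx z) \<le> norm v + h * norm (xs z)"
      unfolding split using norm_triangle_ineq[of v "h *\<^sub>R xs z"] h by simp
    also have "\<dots> \<le> 1 * h + h * norm (xs z)" using v e h by (intro add_mono order.trans[OF v] mult_right_mono) auto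
    finally have nxy: "norm (xx y - xx z) \<le> k * h" by (simp add: k_def algebra_simps)
    also have "k * h < r" using h(4) k by (simp add: l_def field_simps)
    finally have "\<bar>(xx y - xx z) \<bullet> n\<bar> \<le> e * norm (xx y - xx z)" by (rule r(2)[OF yb])
    also have "\<dots> \<le> e * (k * h)" using nxy e by (intro mult_left_mono) auto
    finally have 1: "\<bar>(xx y - xx z) \<bullet> n\<bar> \<le> e * (k * h)" .
    have n1: "norm n = 1" using on unfolding outward_normal_def n_def by blast
    have 2: "\<bar>v \<bullet> n\<bar> \<le> e * h" using Cauchy_Schwarz_ineq2[of v n] v n1 by simp
    have "h * \<bar>xs z \<bullet> n\<bar> = \<bar>(xx y - xx z) \<bullet> n - v \<bullet> n\<bar>"
      using h(1) by (simp add: v_def inner_diff_left abs_mult)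
    also have "\<dots> \<le> e * (k * h) + e * h" using 1 2 by linarith
    also have "\<dots> = h * (e * (norm (xs z) + 2))" by (simp add: k_def algebra_simps)
    finally show ?thesis using h(1) by simp
  qed
  note small = this
  have "\<bar>xs z \<bullet> n\<bar> \<le> 0 + e" if e: "e > 0" for e
  proof -
    define k where "k = norm (xs z) + 2"
    have k: "k > 0" by (simp add: k_def add_nonneg_pos)
    define e' where "e' = min 1 (e / k)"
    have "e' > 0" "e' \<le> 1" using e k by (auto simp: e'_def)
    from small[OF this] have "\<bar>xs z \<bullet> n\<bar> \<le> e' * k" by (simp add: k_def)
    also have "\<dots> \<le> e / k * k" using k by (intro mult_right_mono) (auto simp: e'_def)
    finally show ?thesis using k by simp
  qed
  then have "\<bar>xs z \<bullet> n\<bar> \<le> 0" by (rule field_le_epsilon)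
  then show "\<nu> (xx z) \<bullet> xs z = 0" by (simp add: n_def inner_commute)
qed

lemma corner_isolated:
  assumes z: "z \<in> closure N" "Im z = \<alpha> \<or> Im z = 2 * pi"
  shows "\<exists>d>0. \<forall>y\<in>closure N. (Im y = \<alpha> \<or> Im y = 2 * pi) \<longrightarrow> cmod (y - z) < d \<longrightarrow> y = z"
proof -
  have E: "xx y \<in> closure G0 - G0" if "y \<in> closure N" "Im y = \<alpha> \<or> Im y = 2 * pi" for y
    using xx_closure_N[OF that(1)] xx_line[OF that(2)] strip_ext by (intro corner_set) auto
  obtain e where e: "e > 0" "\<And>y. y \<in> closure G0 - G0 \<Longrightarrow> dist y (xx z) < e \<Longrightarrow> y = xx z"
    using adm' E[OF z] unfolding smooth_0_manifold_def by blast
  obtain d where d: "d > 0" "\<And>y. dist y z < d \<Longrightarrow> dist (xx y) (xx z) < e"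
    using cont_frame(1)[of UNIV] e(1) unfolding continuous_on_iff by (metis UNIV_I)
  have "y = z" if "y \<in> closure N" "Im y = \<alpha> \<or> Im y = 2 * pi" "cmod (y - z) < d" for y
  proof -
    have "dist (xx y) (xx z) < e" by (rule d(2)) (use that(3) in \<open>simp add: dist_norm\<close>)
    then have "xx y = xx z" by (rule e(2)[OF E[OF that(1,2)]])
    moreover have "\<alpha> \<le> Im y" "Im y \<le> 2 * pi" "\<alpha> \<le> Im z" "Im z \<le> 2 * pi" using that(2) z(2) alpha_lt by linarith+
    ultimately show ?thesis by (intro strip_inj)
  qed
  then show ?thesis using d(1) by blast
qed

text \<open>Otherwise the domain would fill the exterior of the cone near \<open>- p\<close>, and by
  \<open>D_down\<close> every column entirely, which leaves no room for \<open>N\<close>.\<close>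

lemma antipode:
  assumes "- p \<in> closure \<Omega>" shows "- p \<in> closure G0"
proof (rule ccontr)
  assume n: "- p \<notin> closure G0"
  obtain d where d: "d > 0" "\<And>x. dist x (- p) < d \<Longrightarrow> x \<notin> closure G0"
    using n closed_closure[of G0] unfolding closed_def open_dist by (metis ComplD ComplI)
  have "((\<lambda>s::real. 2 - 2 * tanh s) \<longlongrightarrow> 2 - 2 * 1) at_top" by (intro tendsto_intros tanh_real_at_top)
  then have "((\<lambda>s::real. 2 - 2 * tanh s) \<longlongrightarrow> (0::real)) at_top" by simp
  then have "\<forall>\<^sub>F s::real in at_top. 2 - 2 * tanh s < d^2" using d(1) by (intro order_tendstoD) auto
  then obtain S where S: "2 - 2 * tanh S < d^2" unfolding eventually_at_top_linorder by blast
  have near: "dist (xx z) (- p) < d" if "Re z > S" for z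
  proof -
    have "tanh S < tanh (Re z)" using that by simp
    then have "2 - 2 * tanh (Re z) < d^2" using S by linarith
    then have "(dist (xx z) (- p))^2 < d^2" by (simp only: dist_pole)
    then show ?thesis by (rule power2_less_imp_less) (use d(1) in simp)
  qed
  have cN: "z \<notin> closure N" if "Re z > S" for z using d(2)[OF near[OF that]] xx_closure_N[of z] by blast
  define V where "V = {z. Re z > S} \<inter> ({z. Im z > \<alpha>} \<inter> {z. Im z < 2 * pi})"
  have "V \<subseteq> D"
  proof (rule fill)
    show "connected V" unfolding V_def
      by (intro convex_connected convex_Int convex_halfspace_Re_gt convex_halfspace_Im_gt convex_halfspace_Im_lt)
    show "V \<inter> N = {}" using cN closure_subset[of N] by (auto simp: V_def)
    show "\<alpha> < Im z \<and> Im z < 2 * pi" if "z \<in> V" for z using that by (simp add: V_def)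
    have "2 - 2 * tanh S > 0" using tanh_real_lt_1[of S] by linarith
    then have "sqrt (2 - 2 * tanh S) > 0" by simp
    then obtain y where y: "y \<in> \<Omega>" "dist y (- p) < sqrt (2 - 2 * tanh S)"
      using assms unfolding closure_approachable by blast
    then obtain z where z: "z \<in> strip" "y = xx z" using Omega_sub by blast
    have "(dist y (- p))^2 < 2 - 2 * tanh S"
      using y(2) \<open>2 - 2 * tanh S > 0\<close> by (metis real_less_rsqrt real_sqrt_less_iff real_sqrt_abs abs_of_nonneg zero_le_dist)
    then have "tanh S < tanh (Re z)" unfolding z(2) dist_pole by linarith
    then have "Re z > S" by simp
    then have "z \<in> V \<inter> D" using z y by (auto simp: V_def D_def strip_def)
    then show "V \<inter> D \<noteq> {}" by blast
  qed
  obtain z where z: "z \<in> N" using N_nonempty by blast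
  define s where "s = max S (Re z) + 1"
  have "Complex s (Im z) \<in> V" using N_strip[OF z] by (auto simp: V_def s_def)
  then have "Complex s (Im z) \<in> D" using \<open>V \<subseteq> D\<close> by blast
  then have "Complex (Re z) (Im z) \<in> D" by (rule D_down) (simp add: s_def)
  then show False using z DN by auto
qed

end

section \<open>The boundary value problem on the sphere and its planar form\<close>

locale cone_solution = cone_domain p e1 e2 \<alpha> \<Omega> \<nu> for p e1 e2 \<alpha> \<Omega> \<nu> +
  fixes u :: "real^3 \<Rightarrow> real" and Du :: "real^3 \<Rightarrow> real^3" and D2u :: "real^3 \<Rightarrow> real^3^3" and c :: real
  assumes D1: "x \<noteq> 0 \<Longrightarrow> x /\<^sub>R norm x \<in> \<Omega> \<Longrightarrow> ((\<lambda>y. u (y /\<^sub>R norm y)) has_derivative (\<lambda>h. Du x \<bullet> h)) (at x)"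
    and D2: "x \<noteq> 0 \<Longrightarrow> x /\<^sub>R norm x \<in> \<Omega> \<Longrightarrow> (Du has_derivative (\<lambda>h. D2u x *v h)) (at x)"
    and cont_u: "continuous_on (closure \<Omega>) u" and cont_Du: "continuous_on (closure \<Omega>) Du"
    and cont_D2u: "continuous_on (closure \<Omega>) D2u"
    and pde_Omega: "x \<in> \<Omega> \<Longrightarrow> (\<Sum>i\<in>UNIV. D2u x $ i $ i) + 2 * u x = -2"
    and bc0: "x \<in> Gamma0 (scone p (tarc e1 e2 \<alpha>)) \<Omega> \<Longrightarrow> u x = 0 \<and> Du x \<bullet> \<nu> x = c"
    and bc1: "x \<in> Gamma1 (scone p (tarc e1 e2 \<alpha>)) \<Omega> - {p} \<Longrightarrow> Du x \<bullet> \<nu> x = 0"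
begin

lemma Omega_unit: "x \<in> closure \<Omega> \<Longrightarrow> norm x = 1"
  using closure_Omega_S2 by (auto simp: S2_def)

lemma Omega_W: assumes "x \<in> \<Omega>" shows "x \<noteq> 0" "x /\<^sub>R norm x \<in> \<Omega>"
  using Omega_unit[of x] assms closure_subset[of \<Omega>] by auto

lemma ray: assumes "x \<in> \<Omega>" "r > 0" shows "r *\<^sub>R x \<noteq> 0" "(r *\<^sub>R x) /\<^sub>R norm (r *\<^sub>R x) = x"
  using Omega_unit[of x] assms closure_subset[of \<Omega>] by auto

lemma Du_ray: assumes x: "x \<in> \<Omega>" and r: "r > 0" shows "Du (r *\<^sub>R x) \<bullet> x = 0"
proof -
  have "((\<lambda>r. r *\<^sub>R x) has_derivative (\<lambda>h. h *\<^sub>R x)) (at r)" by (auto intro!: derivative_eq_intros)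
  from has_derivative_compose[OF this D1[of "r *\<^sub>R x"]] ray[OF assms] x
  have "((\<lambda>r. u ((r *\<^sub>R x) /\<^sub>R norm (r *\<^sub>R x))) has_derivative (\<lambda>h. Du (r *\<^sub>R x) \<bullet> (h *\<^sub>R x))) (at r)" by metis
  moreover have "((\<lambda>r. u ((r *\<^sub>R x) /\<^sub>R norm (r *\<^sub>R x))) has_derivative (\<lambda>h. 0)) (at r)"
    by (rule has_derivative_transform_within_open[OF has_derivative_const[of "u x"] open_greaterThan[of 0]])
      (use r ray(2)[OF x] in \<open>simp_all only: greaterThan_iff\<close>)
  ultimately have "(\<lambda>h. Du (r *\<^sub>R x) \<bullet> (h *\<^sub>R x)) = (\<lambda>h. 0)" by (rule has_derivative_unique)
  from fun_cong[OF this, of 1] show ?thesis by simp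
qed

text \<open>The extension of \<open>u\<close> is constant on rays, so its gradient has no radial
  component; differentiating this along the ray gives the claim. The Euclidean trace in the equation
  thus reduces to the tangential one.\<close>

lemma D2u_radial: assumes x: "x \<in> \<Omega>" shows "x \<bullet> (D2u x *v x) = 0"
proof -
  have "((\<lambda>r. r *\<^sub>R x) has_derivative (\<lambda>h. h *\<^sub>R x)) (at 1)" by (auto intro!: derivative_eq_intros)
  moreover have "(Du has_derivative (\<lambda>h. D2u x *v h)) (at (1 *\<^sub>R x))" using D2[OF Omega_W[OF x]] by simp
  ultimately have "((\<lambda>r. Du (r *\<^sub>R x)) has_derivative (\<lambda>h. D2u x *v (h *\<^sub>R x))) (at 1)"
    by (rule has_derivative_compose)
  then have "((\<lambda>r. Du (r *\<^sub>R x) \<bullet> x) has_derivative (\<lambda>h. (D2u x *v (h *\<^sub>R x)) \<bullet> x)) (at 1)"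
    by (rule has_derivative_inner_left)
  moreover have "((\<lambda>r. Du (r *\<^sub>R x) \<bullet> x) has_derivative (\<lambda>h. 0)) (at 1)"
    by (rule has_derivative_transform_within_open[OF has_derivative_const[of 0] open_greaterThan[of 0]])
      (use Du_ray[OF x] in simp_all)
  ultimately have "(\<lambda>h. (D2u x *v (h *\<^sub>R x)) \<bullet> x) = (\<lambda>h. 0)" by (rule has_derivative_unique)
  from fun_cong[OF this, of 1] show ?thesis by (simp add: inner_commute)
qed

lemma cont_mult_vec:
  fixes H :: "'a::topological_space \<Rightarrow> real^3^3"
  assumes "continuous_on X H" "continuous_on X f" shows "continuous_on X (\<lambda>x. H x *v f x)"
  unfolding matrix_vector_mult_def by (intro continuous_intros assms)

lemma closure_zero: "continuous_on (closure \<Omega>) f \<Longrightarrow> (\<And>x. x \<in> \<Omega> \<Longrightarrow> f x = k) \<Longrightarrow> x \<in> closure \<Omega> \<Longrightarrow> f x = (k::real)"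
  using continuous_constant_on_closure[of \<Omega> f k] by blast

lemma Du_tangent: "x \<in> closure \<Omega> \<Longrightarrow> Du x \<bullet> x = 0"
  by (rule closure_zero[of "\<lambda>x. Du x \<bullet> x"]) (use Du_ray[of _ 1] in \<open>auto intro!: continuous_intros cont_Du\<close>)

lemma D2u_radial_closure: "x \<in> closure \<Omega> \<Longrightarrow> x \<bullet> (D2u x *v x) = 0"
  by (rule closure_zero[of "\<lambda>x. x \<bullet> (D2u x *v x)"]) (use D2u_radial in \<open>auto intro!: continuous_intros cont_mult_vec cont_D2u\<close>)

lemma trace_closure: "x \<in> closure \<Omega> \<Longrightarrow> (\<Sum>i\<in>UNIV. D2u x $ i $ i) + 2 * u x = -2"
  by (rule closure_zero[of "\<lambda>x. (\<Sum>i\<in>UNIV. D2u x $ i $ i) + 2 * u x"])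
    (use pde_Omega in \<open>auto intro!: continuous_intros cont_D2u cont_u\<close>)

text \<open>The shift by \<open>1\<close> makes the equation homogeneous. The functions after it are
  the chart derivatives of \<open>w\<close> given by the chain rule; \<open>wst\<close> and
  \<open>wts\<close> are kept apart until \<open>mixed\<close> identifies them.\<close>

definition "w z = u (xx z) + 1"
definition "ws z = Du (xx z) \<bullet> xs z"
definition "wt z = Du (xx z) \<bullet> xt z"
definition "wss z = xs z \<bullet> (D2u (xx z) *v xs z) + Du (xx z) \<bullet> xss z"
definition "wst z = xt z \<bullet> (D2u (xx z) *v xs z) + Du (xx z) \<bullet> xst z"
definition "wts z = xs z \<bullet> (D2u (xx z) *v xt z) + Du (xx z) \<bullet> xst z"
definition "wtt z = xt z \<bullet> (D2u (xx z) *v xt z) + Du (xx z) \<bullet> xtt z"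

lemma comp_xx: "continuous_on (closure \<Omega>) f \<Longrightarrow> continuous_on (closure D) (\<lambda>z. f (xx z))"
  by (rule continuous_on_compose2[of "closure \<Omega>" f]) (use xx_closure_D in \<open>auto intro!: cont_frame\<close>)

lemma cont_data: "continuous_on (closure D) w" "continuous_on (closure D) ws" "continuous_on (closure D) wt"
  "continuous_on (closure D) wss" "continuous_on (closure D) wst" "continuous_on (closure D) wts" "continuous_on (closure D) wtt"
  unfolding w_def ws_def wt_def wss_def wst_def wts_def wtt_def
  by (intro continuous_intros cont_mult_vec comp_xx cont_u cont_Du cont_D2u cont_frame)+

lemma D_W: assumes "z \<in> D" shows "xx z \<noteq> 0" "xx z /\<^sub>R norm (xx z) \<in> \<Omega>" "xx z \<in> \<Omega>"
  using assms Omega_W[of "xx z"] by (auto simp: D_def)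

lemma der_w: assumes "z \<in> D" shows "(w has_derivative (\<lambda>h. ws z * Re h + wt z * Im h)) (at z)"
proof -
  have "((\<lambda>y. u (xx y /\<^sub>R norm (xx y))) has_derivative (\<lambda>h. Du (xx z) \<bullet> (Re h *\<^sub>R xs z + Im h *\<^sub>R xt z))) (at z)"
    by (rule has_derivative_compose[OF der_xx D1[OF D_W(1,2)[OF assms]]])
  then have "((\<lambda>y. u (xx y) + 1) has_derivative (\<lambda>h. Du (xx z) \<bullet> (Re h *\<^sub>R xs z + Im h *\<^sub>R xt z) + 0)) (at z)"
    by (intro has_derivative_add has_derivative_const) simp
  then show ?thesis unfolding w_def[abs_def] ws_def wt_def by (simp add: inner_add_right mult.commute)
qed

lemma der_Du: assumes "z \<in> D" shows "((\<lambda>y. Du (xx y)) has_derivative (\<lambda>h. Re h *\<^sub>R (D2u (xx z) *v xs z) + Im h *\<^sub>R (D2u (xx z) *v xt z))) (at z)"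
  by (rule has_derivative_eq_rhs[OF has_derivative_compose[OF der_xx D2[OF D_W(1,2)[OF assms]]]])
    (simp add: matrix_vector_right_distrib matrix_vector_mult_scaleR)

lemma der_ws': assumes "z \<in> D" shows "(ws has_derivative (\<lambda>h. wss z * Re h + wts z * Im h)) (at z)"
  unfolding ws_def[abs_def]
  by (rule has_derivative_eq_rhs[OF has_derivative_inner[OF der_Du[OF assms] der_xs]])
    (auto simp: wss_def wts_def inner_add_left inner_add_right inner_commute algebra_simps)

lemma der_wt: assumes "z \<in> D" shows "(wt has_derivative (\<lambda>h. wst z * Re h + wtt z * Im h)) (at z)"
  unfolding wt_def[abs_def]
  by (rule has_derivative_eq_rhs[OF has_derivative_inner[OF der_Du[OF assms] der_xt]])
    (auto simp: wst_def wtt_def inner_add_left inner_add_right inner_commute algebra_simps)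

lemma mixed: assumes z: "z \<in> D" shows "wts z = wst z"
proof (rule mixed_partials_eq[OF D_open z der_w der_ws' der_wt])
  have "continuous_on D wts" "continuous_on D wst"
    by (rule continuous_on_subset[OF cont_data(6) closure_subset], rule continuous_on_subset[OF cont_data(5) closure_subset])
  then show "continuous (at z) wts" "continuous (at z) wst"
    using z unfolding continuous_on_eq_continuous_at[OF D_open] by auto
qed

lemma der_ws: assumes "z \<in> D" shows "(ws has_derivative (\<lambda>h. wss z * Re h + wst z * Im h)) (at z)"
  using der_ws'[OF assms] mixed[OF assms] by simp

lemma pde_plane: assumes "z \<in> closure D" shows "wss z + wtt z + 2 * (sech (Re z))^2 * w z = 0"
proof -
  have x: "xx z \<in> closure \<Omega>" by (rule xx_closure_D[OF assms])
  define H where "H = D2u (xx z)"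
  have "(\<Sum>i\<in>UNIV. H $ i $ i) = xx z \<bullet> (H *v xx z) + (cosh (Re z))^2 * (xs z \<bullet> (H *v xs z) + xt z \<bullet> (H *v xt z))"
    using trace_orthonormal[OF tangent_frame, of H z]
    by (simp add: matrix_vector_mult_scaleR power2_eq_square distrib_left mult.assoc)
  then have "(cosh (Re z))^2 * (xs z \<bullet> (H *v xs z) + xt z \<bullet> (H *v xt z)) = - 2 - 2 * u (xx z)"
    using D2u_radial_closure[OF x] trace_closure[OF x] by (simp add: H_def)
  then have "(sech (Re z))^2 * ((cosh (Re z))^2 * (xs z \<bullet> (H *v xs z) + xt z \<bullet> (H *v xt z))) = (sech (Re z))^2 * (- 2 - 2 * u (xx z))"
    by simp
  then have 1: "xs z \<bullet> (H *v xs z) + xt z \<bullet> (H *v xt z) = (sech (Re z))^2 * (- 2 - 2 * u (xx z))"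
    by (simp only: sech_cosh_cancel)
  have "Du (xx z) \<bullet> xss z + Du (xx z) \<bullet> xtt z = Du (xx z) \<bullet> (xss z + xtt z)" by (simp add: inner_add_right)
  also have "\<dots> = 0" unfolding xss_xtt using Du_tangent[OF x] by simp
  finally have 2: "Du (xx z) \<bullet> xss z + Du (xx z) \<bullet> xtt z = 0" .
  have "wss z + wtt z = (sech (Re z))^2 * (- 2 - 2 * u (xx z))" using 1 2 by (simp add: wss_def wtt_def H_def)
  then show ?thesis by (simp add: w_def algebra_simps)
qed

text \<open>The \<open>tanh\<close> term is the Christoffel correction. It leaves the form
  \<open>E\<close> evaluated on \<open>xs\<close>, whose size is at most a constant times
  \<open>|xs|\<^sup>2 = sech\<^sup>2 s\<close>.\<close>

lemma phi_formula: assumes "z \<in> closure D"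
  shows "wss z + tanh (Re z) * ws z + (sech (Re z))^2 * w z = xs z \<bullet> (D2u (xx z) *v xs z) + (sech (Re z))^2 * (u (xx z) + 1)"
proof -
  have "Du (xx z) \<bullet> xss z + tanh (Re z) * (Du (xx z) \<bullet> xs z) = Du (xx z) \<bullet> (xss z + tanh (Re z) *\<^sub>R xs z)" by (simp add: inner_add_right)
  also have "\<dots> = 0" unfolding xss_xs using Du_tangent[OF xx_closure_D[OF assms]] by simp
  finally show ?thesis by (simp add: wss_def ws_def w_def)
qed

lemma psi_formula: "wst z + tanh (Re z) * wt z = xt z \<bullet> (D2u (xx z) *v xs z)"
proof -
  have "Du (xx z) \<bullet> xst z + tanh (Re z) * (Du (xx z) \<bullet> xt z) = Du (xx z) \<bullet> (xst z + tanh (Re z) *\<^sub>R xt z)" by (simp add: inner_add_right)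
  also have "\<dots> = 0" unfolding xst_xt by simp
  finally show ?thesis by (simp add: wst_def wt_def)
qed

definition "Qx x = (u x + 1)^2 + Du x \<bullet> Du x"

lemma Q_formula: assumes "z \<in> closure D"
  shows "(w z)^2 + (cosh (Re z))^2 * ((ws z)^2 + (wt z)^2) = Qx (xx z)"
  using tangent_inner[OF Du_tangent[OF xx_closure_D[OF assms]], of "Du (xx z)"]
  by (simp add: Qx_def w_def ws_def wt_def power2_eq_square)

lemma cont_Qx: "continuous_on (closure \<Omega>) Qx"
  unfolding Qx_def by (intro continuous_intros cont_u cont_Du)

lemma compact_Omega: "compact (closure \<Omega>)"
  using Omega_unit by (auto simp: compact_eq_bounded_closed intro!: boundedI[of _ 1])

lemma bounded_on_Omega: assumes "continuous_on (closure \<Omega>) f" obtains k where "k \<ge> 0" "\<And>x. x \<in> closure \<Omega> \<Longrightarrow> \<bar>f x :: real\<bar> \<le> k"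
proof -
  have "bounded (f ` closure \<Omega>)" by (intro compact_imp_bounded compact_continuous_image assms compact_Omega)
  then obtain k where k: "\<And>x. x \<in> closure \<Omega> \<Longrightarrow> \<bar>f x\<bar> \<le> k" unfolding bounded_iff by auto
  then show thesis using that[of "\<bar>k\<bar>"] by force
qed

lemma norm_xs: "norm (xs z) = sech (Re z)" "norm (xt z) = sech (Re z)"
  by (simp_all add: norm_eq_sqrt_inner xx_inner less_imp_le)

lemma bounds_exist: "\<exists>M. \<forall>z\<in>closure D.
    \<bar>wss z + tanh (Re z) * ws z + (sech (Re z))^2 * w z\<bar> \<le> M * (sech (Re z))^2 \<and>
    \<bar>wst z + tanh (Re z) * wt z\<bar> \<le> M * (sech (Re z))^2 \<and>
    (w z)^2 + (cosh (Re z))^2 * ((ws z)^2 + (wt z)^2) \<le> M"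
proof -
  obtain h where h: "h \<ge> 0" "\<And>x. x \<in> closure \<Omega> \<Longrightarrow> \<bar>norm (D2u x)\<bar> \<le> h"
    using bounded_on_Omega[OF continuous_on_norm[OF cont_D2u]] by blast
  obtain k where k: "k \<ge> 0" "\<And>x. x \<in> closure \<Omega> \<Longrightarrow> \<bar>u x + 1\<bar> \<le> k"
    using bounded_on_Omega[OF continuous_on_add[OF cont_u continuous_on_const]] by blast
  obtain q where q: "q \<ge> 0" "\<And>x. x \<in> closure \<Omega> \<Longrightarrow> \<bar>Qx x\<bar> \<le> q" using bounded_on_Omega[OF cont_Qx] by blast
  define M where "M = 3 * h + k + q"
  have H: "\<bar>a \<bullet> (D2u (xx z) *v b)\<bar> \<le> 3 * h * (sech (Re z))^2"
    if "z \<in> closure D" "norm a = sech (Re z)" "norm b = sech (Re z)" for z a b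
  proof -
    have "\<bar>a \<bullet> (D2u (xx z) *v b)\<bar> \<le> norm a * norm (D2u (xx z) *v b)" by (rule Cauchy_Schwarz_ineq2)
    also have "\<dots> \<le> norm a * (3 * (norm (D2u (xx z)) * norm b))" by (intro mult_left_mono norm_matrix_vector_le) simp
    also have "\<dots> = norm (D2u (xx z)) * (3 * (sech (Re z))^2)" unfolding that(2,3) by (simp add: power2_eq_square)
    also have "\<dots> \<le> h * (3 * (sech (Re z))^2)" using h(2)[OF xx_closure_D[OF that(1)]] by (intro mult_right_mono) auto
    finally show ?thesis by (simp add: mult_ac)
  qed
  have "\<bar>wss z + tanh (Re z) * ws z + (sech (Re z))^2 * w z\<bar> \<le> M * (sech (Re z))^2 \<and>
    \<bar>wst z + tanh (Re z) * wt z\<bar> \<le> M * (sech (Re z))^2 \<and>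
    (w z)^2 + (cosh (Re z))^2 * ((ws z)^2 + (wt z)^2) \<le> M" if z: "z \<in> closure D" for z
  proof (intro conjI)
    have x: "xx z \<in> closure \<Omega>" by (rule xx_closure_D[OF z])
    have le: "3 * h * (sech (Re z))^2 + k * (sech (Re z))^2 \<le> M * (sech (Re z))^2" "3 * h * (sech (Re z))^2 \<le> M * (sech (Re z))^2"
      unfolding distrib_right[symmetric] M_def using h k q by (auto intro!: mult_right_mono)
    have "\<bar>(sech (Re z))^2 * (u (xx z) + 1)\<bar> \<le> k * (sech (Re z))^2"
      using k(2)[OF x] by (simp add: abs_mult mult.commute mult_right_mono)
    then show "\<bar>wss z + tanh (Re z) * ws z + (sech (Re z))^2 * w z\<bar> \<le> M * (sech (Re z))^2"
      unfolding phi_formula[OF z] using H[OF z norm_xs(1) norm_xs(1)] le(1) by linarith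
    show "\<bar>wst z + tanh (Re z) * wt z\<bar> \<le> M * (sech (Re z))^2"
      unfolding psi_formula using H[OF z norm_xs(2) norm_xs(1)] le(2) by linarith
    show "(w z)^2 + (cosh (Re z))^2 * ((ws z)^2 + (wt z)^2) \<le> M"
      unfolding Q_formula[OF z] using q(2)[OF x] h k by (simp add: M_def)
  qed
  then show ?thesis by blast
qed

definition "M = (SOME M. \<forall>z\<in>closure D.
    \<bar>wss z + tanh (Re z) * ws z + (sech (Re z))^2 * w z\<bar> \<le> M * (sech (Re z))^2 \<and>
    \<bar>wst z + tanh (Re z) * wt z\<bar> \<le> M * (sech (Re z))^2 \<and>
    (w z)^2 + (cosh (Re z))^2 * ((ws z)^2 + (wt z)^2) \<le> M)"

lemmas M_bounds = someI_ex[OF bounds_exist, folded M_def, rule_format]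

lemma normal_pairing:
  assumes "z \<in> N" shows "(ns z)^2 + (nt z)^2 = (sech (Re z))^2" "ns z * ws z + nt z * wt z = c * (sech (Re z))^2"
proof -
  have n: "\<nu> (xx z) \<bullet> xx z = 0" "\<nu> (xx z) \<bullet> \<nu> (xx z) = 1" using normal_G0(1,2)[OF assms] by (simp_all add: norm_eq_1)
  have "1 = (cosh (Re z))^2 * ((ns z)^2 + (nt z)^2)"
    using tangent_inner[OF n(1), of "\<nu> (xx z)"] n(2) by (simp add: ns_def nt_def power2_eq_square)
  then show "(ns z)^2 + (nt z)^2 = (sech (Re z))^2" using sech_cosh_cancel[of "Re z" "(ns z)^2 + (nt z)^2"] by simp
  have "Du (xx z) \<bullet> \<nu> (xx z) = c" using bc0[folded C_def] assms by (auto simp: N_def G0_def)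
  then have "c = (cosh (Re z))^2 * (ns z * ws z + nt z * wt z)"
    using tangent_inner[OF n(1), of "Du (xx z)"] by (simp add: ns_def nt_def ws_def wt_def inner_commute)
  then show "ns z * ws z + nt z * wt z = c * (sech (Re z))^2" using sech_cosh_cancel[of "Re z" "ns z * ws z + nt z * wt z"] by (simp add: mult.commute)
qed

lemma neumann_line:
  assumes z: "z \<in> closure D" "Im z = \<alpha> \<or> Im z = 2 * pi" "z \<notin> closure N" shows "wt z = 0"
proof -
  note n = line_normal[OF z]
  have "\<nu> (xx z) \<bullet> \<nu> (xx z) = (cosh (Re z))^2 * ((\<nu> (xx z) \<bullet> xt z) * (\<nu> (xx z) \<bullet> xt z))"
    using tangent_inner[OF n(3), of "\<nu> (xx z)"] n(4) by simp
  then have "\<nu> (xx z) \<bullet> xt z \<noteq> 0" using n(2) by (auto simp: norm_eq_1)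
  moreover have "0 = (cosh (Re z))^2 * ((\<nu> (xx z) \<bullet> xt z) * wt z)"
    using tangent_inner[OF n(3), of "Du (xx z)"] n(4) bc1[folded C_def, OF n(1)] by (simp add: wt_def inner_commute)
  ultimately show ?thesis by simp
qed

end

context cone_solution
begin

lemma w_G0: assumes "z \<in> N" shows "w z = 1"
  using bc0[folded C_def] assms by (auto simp: N_def G0_def w_def)

lemma planar: "planar_problem \<alpha> (2 * pi) L D N ns nt w ws wt wss wst wtt c M"
proof (unfold_locales, goal_cases)
  case 1 show ?case using alpha by simp
next
  case (2 z) then show ?case by (rule der_w)
next
  case (3 z) then show ?case by (rule der_ws)
next
  case (4 z) then show ?case by (rule der_wt)
next
  case 5 show ?case by (rule cont_data)
next
  case 6 show ?case by (rule cont_data)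
next
  case 7 show ?case by (rule cont_data)
next
  case 8 show ?case by (rule cont_data)
next
  case 9 show ?case by (rule cont_data)
next
  case 10 show ?case by (rule cont_data)
next
  case (11 z) then show ?case by (rule pde_plane)
next
  case (12 z) then show ?case using M_bounds by blast
next
  case (13 z) then show ?case using M_bounds by blast
next
  case (14 z) then show ?case using M_bounds by blast
next
  case (15 z) then show ?case by (rule w_G0)
next
  case (16 z) then show ?case by (rule normal_pairing)
next
  case (17 z) then show ?case by (rule normal_pairing)
next
  case (18 z) then show ?case by (rule neumann_line)
next
  case (19 z) then show ?case by (rule corner_isolated)
next
  case 20 show ?case by (rule N_nonempty)
qed

lemma Qx_G0: assumes "x \<in> closure G0" shows "Qx x = 1 + c^2"
proof -
  have on: "Qx x = 1 + c^2" if x: "x \<in> G0" for x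
  proof -
    obtain z where zx: "z \<in> strip" "x = xx z" using x G0_eq by blast
    then have zN: "z \<in> N" using x by (simp add: N_def)
    have "z \<in> closure N" "z \<in> closure D" using zN closure_subset[of N] N_closure by blast+
    from planar_problem.Q_N[OF planar this(1)] Q_formula[OF this(2)] show ?thesis
      by (simp add: planar_problem.Q_def[OF planar] zx)
  qed
  have "continuous_on (closure G0) Qx" by (rule continuous_on_subset[OF cont_Qx]) (use G0_closure in blast)
  from continuous_constant_on_closure[OF this on assms] show ?thesis .
qed

text \<open>If \<open>- p\<close> is a limit of the domain, it is one of Gamma_0 by
  \<open>antipode\<close>, and there \<open>Qx\<close> has its boundary value by continuity. If not,
  no points of \<Omega> are near \<open>- p\<close>.\<close>

lemma far: assumes e: "e > 0" shows "\<exists>S. \<forall>z\<in>D. Re z > S \<longrightarrow> planar_problem.Q w ws wt z < 1 + c^2 + e"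
proof -
  have "\<exists>d>0. \<forall>x\<in>\<Omega>. dist x (- p) < d \<longrightarrow> Qx x < 1 + c^2 + e"
  proof (cases "- p \<in> closure \<Omega>")
    case True
    then obtain d where d: "d > 0" "\<And>x. x \<in> closure \<Omega> \<Longrightarrow> dist x (- p) < d \<Longrightarrow> dist (Qx x) (Qx (- p)) < e"
      using cont_Qx e unfolding continuous_on_iff by metis
    have "Qx (- p) = 1 + c^2" by (rule Qx_G0[OF antipode[OF True]])
    then have "Qx x < 1 + c^2 + e" if "x \<in> \<Omega>" "dist x (- p) < d" for x
      using d(2)[of x] that closure_subset[of \<Omega>] by (auto simp: dist_real_def abs_less_iff)
    then show ?thesis using d(1) by blast
  next
    case False
    then show ?thesis unfolding closure_approachable by blast
  qed
  then obtain d where d: "d > 0" "\<And>x. x \<in> \<Omega> \<Longrightarrow> dist x (- p) < d \<Longrightarrow> Qx x < 1 + c^2 + e" by blast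
  have "((\<lambda>s::real. 2 - 2 * tanh s) \<longlongrightarrow> 2 - 2 * 1) at_top" by (intro tendsto_intros tanh_real_at_top)
  then have "((\<lambda>s::real. 2 - 2 * tanh s) \<longlongrightarrow> (0::real)) at_top" by simp
  then have "\<forall>\<^sub>F s::real in at_top. 2 - 2 * tanh s < d^2" using d(1) by (intro order_tendstoD) auto
  then obtain S where S: "2 - 2 * tanh S < d^2" unfolding eventually_at_top_linorder by blast
  have "planar_problem.Q w ws wt z < 1 + c^2 + e" if z: "z \<in> D" "Re z > S" for z
  proof -
    have "tanh S < tanh (Re z)" using z by simp
    then have "2 - 2 * tanh (Re z) < d^2" using S by linarith
    then have "(dist (xx z) (- p))^2 < d^2" by (simp only: dist_pole)
    then have "dist (xx z) (- p) < d" by (rule power2_less_imp_less) (use d(1) in simp)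
    then have "Qx (xx z) < 1 + c^2 + e" by (rule d(2)[OF D_W(3)[OF z(1)]])
    moreover have "z \<in> closure D" using z(1) closure_subset[of D] by blast
    from Q_formula[OF this] have "planar_problem.Q w ws wt z = Qx (xx z)" by (simp only: planar_problem.Q_def[OF planar])
    ultimately show ?thesis by simp
  qed
  then show ?thesis by blast
qed

lemma overdetermined: "planar_overdetermined \<alpha> (2 * pi) L D N ns nt w ws wt wss wst wtt c M"
  by (intro planar_overdetermined.intro planar planar_overdetermined_axioms.intro far)

lemmas w_linear = planar_overdetermined.w_linear[OF overdetermined]
  and c_nonzero = planar_overdetermined.c_nonzero[OF overdetermined]
  and gradient_N = planar_problem.gradient_N[OF planar]

end

section \<open>Linearity of the solution and shape of the domain\<close>

context cone_solution
begin

definition "conclusion \<longleftrightarrow> (\<exists>p0 R. p0 \<in> S2 \<and> R > 0 \<and> \<Omega> = sball p0 R - closure C \<and>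
           (\<forall>x\<in>closure \<Omega>. u x = (1 / cos R) * (cos (sdist p0 x) - cos R)) \<and>
           (p0 = p \<or> (p0 \<in> sbd C \<and> totally_geodesic (sbd \<Omega> \<inter> sbd C))))"

lemma u_linear: "\<exists>a. \<forall>x\<in>closure \<Omega>. u x + 1 = a \<bullet> x"
proof -
  obtain a1 a2 a3 where a: "\<And>z. z \<in> D \<Longrightarrow> w z = sech (Re z) * (a1 * cos (Im z) + a2 * sin (Im z)) - a3 * tanh (Re z)"
    using w_linear by blast
  define a where "a = a1 *\<^sub>R e1 + a2 *\<^sub>R e2 + a3 *\<^sub>R p"
  have "u x + 1 - a \<bullet> x = 0" if x: "x \<in> closure \<Omega>" for x
  proof (rule closure_zero[OF _ _ x])
    show "continuous_on (closure \<Omega>) (\<lambda>x. u x + 1 - a \<bullet> x)" by (intro continuous_intros cont_u)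
    fix y assume y: "y \<in> \<Omega>"
    then obtain z where z: "z \<in> strip" "y = xx z" using Omega_sub by blast
    then have "w z = a \<bullet> xx z"
      using a[of z] y by (simp add: D_def a_def inner_add_left inner_commute[of _ "xx z"] xx_inner algebra_simps)
    then show "u y + 1 - a \<bullet> y = 0" by (simp add: w_def z)
  qed
  then show ?thesis by (intro exI[of _ a]) auto
qed

lemma Omega_nonempty: "\<Omega> \<noteq> {}" using p_not_G0(1) by auto

text \<open>\<open>r\<close> plays the role of \<open>cos R\<close>; negative values describe balls
  larger than a hemisphere.\<close>

lemma ball_form:
  assumes p0: "p0 \<in> S2" and r: "\<bar>r\<bar> \<le> 1" "r \<noteq> 0"
    and Om: "\<Omega> = {x \<in> S2 - closure C. p0 \<bullet> x > r}"
    and lin: "\<And>x. x \<in> closure \<Omega> \<Longrightarrow> u x + 1 = (p0 \<bullet> x) / r"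
    and alt: "p0 = p \<or> (p0 \<in> sbd C \<and> totally_geodesic (sbd \<Omega> \<inter> sbd C))"
  shows conclusion
proof -
  have le: "\<bar>p0 \<bullet> x\<bar> \<le> 1" if "x \<in> S2" for x
    using Cauchy_Schwarz_ineq2[of p0 x] that p0 by (simp add: S2_def)
  define R where "R = arccos r"
  have cR: "cos R = r" using r by (simp add: R_def cos_arccos_abs)
  have iff: "sdist p0 x < R \<longleftrightarrow> p0 \<bullet> x > r" if "x \<in> S2" for x
    unfolding sdist_def R_def using le[OF that] r(1) by (intro arccos_less_mono) auto
  have eq: "\<Omega> = sball p0 R - closure C" using iff unfolding sball_def Om by blast
  obtain x where x: "x \<in> \<Omega>" using Omega_nonempty by blast
  then have "x \<in> S2" "sdist p0 x < R" using eq by (auto simp: sball_def)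
  moreover have "0 \<le> sdist p0 x" unfolding sdist_def using le[OF \<open>x \<in> S2\<close>] by (intro arccos_lbound) auto
  ultimately have "R > 0" by linarith
  moreover have "u x = (1 / cos R) * (cos (sdist p0 x) - cos R)" if x: "x \<in> closure \<Omega>" for x
  proof -
    have "cos (sdist p0 x) = p0 \<bullet> x" unfolding sdist_def using le[of x] closure_Omega_S2 x by (intro cos_arccos_abs) auto
    moreover have "u x = (p0 \<bullet> x) / r - 1" using lin[OF x] by simp
    ultimately show ?thesis using r(2) by (simp add: cR field_simps)
  qed
  ultimately show ?thesis unfolding conclusion_def using p0 eq alt by blast
qed

lemma gradient_linear:
  assumes a: "\<And>x. x \<in> closure \<Omega> \<Longrightarrow> u x + 1 = a \<bullet> x" and z: "z \<in> closure D"
  shows "ws z = a \<bullet> xs z" "wt z = a \<bullet> xt z"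
proof -
  have "ws y - a \<bullet> xs y = 0" "wt y - a \<bullet> xt y = 0" if y: "y \<in> D" for y
  proof -
    have "((\<lambda>z. a \<bullet> xx z) has_derivative (\<lambda>h. a \<bullet> (Re h *\<^sub>R xs y + Im h *\<^sub>R xt y))) (at y)"
      by (rule has_derivative_inner_right[OF der_xx])
    then have "(w has_derivative (\<lambda>h. a \<bullet> (Re h *\<^sub>R xs y + Im h *\<^sub>R xt y))) (at y)"
      by (rule has_derivative_transform_within_open[OF _ D_open y])
        (use a D_W(3) closure_subset[of \<Omega>] in \<open>force simp: w_def\<close>)
    from has_derivative_unique[OF der_w[OF y] this]
    have e: "(\<lambda>h. ws y * Re h + wt y * Im h) = (\<lambda>h. a \<bullet> (Re h *\<^sub>R xs y + Im h *\<^sub>R xt y))" .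
    from fun_cong[OF e, of 1] fun_cong[OF e, of \<i>] show "ws y - a \<bullet> xs y = 0" "wt y - a \<bullet> xt y = 0" by simp_all
  qed
  note on = this
  have "continuous_on (closure D) (\<lambda>z. ws z - a \<bullet> xs z)" by (intro continuous_intros cont_data cont_frame)
  from continuous_constant_on_closure[OF this on(1) z] show "ws z = a \<bullet> xs z" by simp
  have "continuous_on (closure D) (\<lambda>z. wt z - a \<bullet> xt z)" by (intro continuous_intros cont_data cont_frame)
  from continuous_constant_on_closure[OF this on(2) z] show "wt z = a \<bullet> xt z" by simp
qed

text \<open>The Neumann condition puts \<open>a\<close> into the planes of both faces. These planes
  meet only in the axis of \<open>p\<close> when \<alpha> is less than \<open>pi\<close>, and
  coincide when it equals \<open>pi\<close>; this is the origin of the two alternatives of the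
  theorem.\<close>

lemma axis_conditions:
  assumes a: "\<And>x. x \<in> closure \<Omega> \<Longrightarrow> u x + 1 = a \<bullet> x"
  shows "a \<bullet> e2 = 0" "sin \<alpha> * (a \<bullet> e1) = 0"
proof -
  have 0: "a \<bullet> circ' t = 0" if t: "t = \<alpha> \<or> t = 2 * pi" for t
  proof -
    \<comment> \<open>At \<open>Re z = L - 1\<close> the domain fills the strip and
      \<open>closure N\<close> is absent, so both lines carry the Neumann condition.\<close>
    define z where "z = Complex (L - 1) t"
    have zl: "Im z = \<alpha> \<or> Im z = 2 * pi" using t by (simp add: z_def)
    have "y \<in> D" if "cmod (y - z) < 1" "\<alpha> < Im y" "Im y < 2 * pi" for y
      using L(1)[of y] that abs_Re_le_cmod[of "y - z"] by (auto simp: z_def strip_def)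
    from line_in_closure[OF zero_less_one this zl, of "Re z"] have zD: "z \<in> closure D" by simp
    have "z \<notin> closure N" by (rule L(2)) (simp add: z_def)
    then have "a \<bullet> xt z = 0" using neumann_line[OF zD zl] gradient_linear(2)[OF a zD] by simp
    then show ?thesis by (simp add: xt_def z_def)
  qed
  show e2: "a \<bullet> e2 = 0" using 0[of "2 * pi"] by (simp add: circ'_def)
  show "sin \<alpha> * (a \<bullet> e1) = 0" using 0[of \<alpha>] e2 by (simp add: circ'_def inner_diff_right inner_add_right)
qed

lemma G0_level: assumes a: "\<And>x. x \<in> closure \<Omega> \<Longrightarrow> u x + 1 = a \<bullet> x" and x: "x \<in> G0" shows "a \<bullet> x = 1"
proof -
  have "u x = 0" using bc0[folded C_def] x by (simp add: G0_def)
  moreover have "x \<in> closure \<Omega>" using x G0_eq by blast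
  ultimately show ?thesis using a[of x] by simp
qed

text \<open>Now \<open>a\<close> is a multiple of \<open>p\<close>, so the level set
  \<open>a \<bullet> x = 1\<close> containing Gamma_0 is the circle \<open>Re z = s0\<close> about
  \<open>p\<close>. The domain fills the strip on its near side, and a point of \<open>D\<close> on
  or beyond the circle would make it fill the far side too, against \<open>N_up\<close>.\<close>

lemma case_lune:
  assumes a: "\<And>x. x \<in> closure \<Omega> \<Longrightarrow> u x + 1 = a \<bullet> x" and al: "\<alpha> < pi"
  shows conclusion
proof -
  have "sin \<alpha> > 0" using alpha al by (intro sin_gt_zero) auto
  then have ae: "a \<bullet> e1 = 0" "a \<bullet> e2 = 0" using axis_conditions[OF a] by auto
  define k where "k = a \<bullet> p"
  have ak: "a \<bullet> x = k * (p \<bullet> x)" for x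
    using orthonormal_inner[of e1 e2 p a x] ae frame by (simp add: k_def inner_commute[of x p])
  have lev: "- k * tanh (Re z) = 1" if "z \<in> N" for z
    using G0_level[OF a, of "xx z"] that by (simp add: N_def ak xx_inner)
  obtain z0 where z0: "z0 \<in> N" using N_nonempty by blast
  define s0 where "s0 = Re z0"
  have k0: "k \<noteq> 0" using lev[OF z0] by auto
  have same: "Re z = s0" if "z \<in> N" for z
  proof -
    have "k * tanh (Re z) = k * tanh s0" using lev[OF that] lev[OF z0] by (simp add: s0_def)
    then show ?thesis using k0 by simp
  qed
  have below: "z \<in> D" if z: "z \<in> strip" "Re z < s0" for z
  proof -
    define V where "V = {z. Re z < s0} \<inter> ({z. Im z > \<alpha>} \<inter> {z. Im z < 2 * pi})"
    have "V \<subseteq> D"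
    proof (rule fill)
      show "connected V" unfolding V_def
        by (intro convex_connected convex_Int convex_halfspace_Re_lt convex_halfspace_Im_gt convex_halfspace_Im_lt)
      show "V \<inter> N = {}" using same by (auto simp: V_def)
      have "Complex (s0 - 1) (Im z0) \<in> V \<inter> D" using down[of z0 "s0 - 1"] z0 N_strip[OF z0] by (simp add: V_def s0_def)
      then show "V \<inter> D \<noteq> {}" by blast
    qed (simp add: V_def)
    then show ?thesis using z by (auto simp: V_def strip_def)
  qed
  have above: "Re z < s0" if z: "z \<in> D" for z
  proof (rule ccontr)
    assume n: "\<not> Re z < s0"
    obtain d where d: "d > 0" "\<And>y. cmod (y - z) < d \<Longrightarrow> y \<in> D" using D_near[OF z] by blast
    define y where "y = Complex (Re z + d / 2) (Im z)"
    have y: "y \<in> D" "Re y > s0" using n d(1) by (auto intro!: d(2) simp: y_def cmod_def)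
    define V where "V = {z. Re z > s0} \<inter> ({z. Im z > \<alpha>} \<inter> {z. Im z < 2 * pi})"
    have "V \<subseteq> D"
    proof (rule fill)
      show "connected V" unfolding V_def
        by (intro convex_connected convex_Int convex_halfspace_Re_gt convex_halfspace_Im_gt convex_halfspace_Im_lt)
      show "V \<inter> N = {}" using same by (auto simp: V_def)
      have "y \<in> V \<inter> D" using y D_strip[OF y(1)] by (simp add: V_def)
      then show "V \<inter> D \<noteq> {}" by blast
    qed (simp add: V_def)
    obtain e where e: "e > 0" "\<And>h. 0 < h \<Longrightarrow> h < e \<Longrightarrow> Complex (Re z0 + h) (Im z0) \<notin> closure D" using N_up[OF z0] by blast
    have "Complex (Re z0 + e / 2) (Im z0) \<in> V" using e(1) N_strip[OF z0] by (simp add: V_def s0_def)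
    then show False using \<open>V \<subseteq> D\<close> e(2)[of "e / 2"] e(1) closure_subset[of D] by auto
  qed
  define r where "r = - tanh s0"
  have r: "\<bar>r\<bar> \<le> 1" using tanh_real_bounds[of s0] by (auto simp: r_def)
  have kr: "k * r = 1" using lev[OF z0] by (simp add: r_def s0_def)
  have r0: "r \<noteq> 0" using kr by auto
  have Om: "\<Omega> = {x \<in> S2 - closure C. p \<bullet> x > r}"
  proof -
    have "xx z \<in> \<Omega> \<longleftrightarrow> p \<bullet> xx z > r" if "z \<in> strip" for z
      using below[OF that] above[of z] that by (auto simp: r_def xx_inner D_def)
    then show ?thesis unfolding exterior using Omega_sub by blast
  qed
  have "u x + 1 = (p \<bullet> x) / r" if "x \<in> closure \<Omega>" for x
    using a[OF that] ak[of x] kr r0 by (simp add: field_simps)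
  then show ?thesis using r r0 Om frame(1) by (intro ball_form[of p r]) (auto simp: S2_def norm_eq_1)
qed

lemma sphere_fill:
  assumes "connected V" "V \<subseteq> xx ` strip" "V \<inter> G0 = {}" "V \<inter> \<Omega> \<noteq> {}" shows "V \<subseteq> \<Omega>"
proof -
  obtain T where T: "open T" "\<Omega> = S2 \<inter> T" by (rule Omega_open)
  have VS: "V \<subseteq> S2" using assms(2) xx_S2 by blast
  have "V \<subseteq> T"
  proof (rule connected_fill[OF assms(1) T(1)])
    fix x assume x: "x \<in> V" "x \<in> closure (V \<inter> T)"
    have "V \<inter> T \<subseteq> \<Omega>" using VS T by blast
    then have "x \<in> closure \<Omega>" using x(2) closure_mono by blast
    then have "x \<in> \<Omega>" using x(1) assms(2,3) G0_eq by blast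
    then show "x \<in> T" using T by blast
  qed (use assms(4) T in blast)
  then show ?thesis using VS T by blast
qed

text \<open>The boundary \<open>\<Gamma>\<^sub>0\<close> is relatively open in the level circle \<open>a \<bullet> x = 1\<close>, because the radial derivative of
  \<open>a \<bullet> x\<close> does not vanish on it.\<close>

lemma level_isolated:
  assumes a: "\<And>x. x \<in> closure \<Omega> \<Longrightarrow> u x + 1 = a \<bullet> x" and x0: "x0 \<in> G0"
  shows "x0 \<notin> closure ({x \<in> xx ` strip. a \<bullet> x = 1} - G0)"
proof
  define X where "X = {x \<in> xx ` strip. a \<bullet> x = 1} - G0"
  assume "x0 \<in> closure ({x \<in> xx ` strip. a \<bullet> x = 1} - G0)"
  then have xc: "x0 \<in> closure X" by (simp add: X_def)
  obtain z0 where z0s: "z0 \<in> strip" "x0 = xx z0" using x0 G0_eq by blast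
  then have z0: "z0 \<in> N" using x0 by (simp add: N_def)
  have np: "x0 \<noteq> p" "x0 \<noteq> - p" using z0s(2) xx_not_pole by auto
  have "X \<subseteq> xx ` strip" by (auto simp: X_def)
  then obtain z where z: "z \<in> closure {z \<in> strip. xx z \<in> X}" "xx z = x0" "\<alpha> \<le> Im z" "Im z \<le> 2 * pi"
    using lift_closure[OF xc np, of strip \<alpha> "2 * pi"] by (auto simp: strip_def)
  have "z = z0" by (rule strip_inj) (use z z0s in \<open>auto simp: strip_def\<close>)
  define m where "m = a \<bullet> xs z0"
  have m: "\<bar>m\<bar> > 0"
  proof -
    have "z0 \<in> closure D" using z0 N_closure by blast
    then have "m = c * ns z0" using gradient_linear(1)[OF a] gradient_N(1)[OF z0] by (simp add: m_def)
    then show ?thesis using c_nonzero ns_pos[OF z0] by simp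
  qed
  have "continuous_on UNIV (\<lambda>z. a \<bullet> xs z)" by (intro continuous_intros cont_frame)
  then obtain r where r: "r > 0" "\<And>y. dist y z0 < r \<Longrightarrow> \<bar>a \<bullet> xs y - m\<bar> < \<bar>m\<bar>"
    using m unfolding continuous_on_iff m_def dist_real_def by (metis UNIV_I)
  have "min r 1 > 0" using r(1) by simp
  then obtain d where d: "d > 0" "\<And>t. \<bar>t - Im z0\<bar> < d \<Longrightarrow> \<alpha> < t \<and> t < 2 * pi \<and> cmod (Complex (top (Re z0 + 1) t) t - z0) < min r 1"
    using top_near_N[OF z0, of "Re z0 + 1" "min r 1"] by auto
  have "min r d > 0" using r(1) d(1) by simp
  then obtain y where y: "y \<in> strip" "xx y \<in> X" "dist y z0 < min r d"
    using z(1) \<open>z = z0\<close> unfolding closure_approachable by blast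
  define t where "t = Im y"
  define s1 where "s1 = top (Re z0 + 1) t"
  have "\<bar>t - Im z0\<bar> < d" using y(3) abs_Im_le_cmod[of "y - z0"] by (simp add: t_def dist_norm)
  from d(2)[OF this] have t: "\<alpha> < t" "t < 2 * pi" "cmod (Complex s1 t - z0) < min r 1" by (simp_all add: s1_def)
  have "\<bar>s1 - Re z0\<bar> < 1" using t(3) abs_Re_le_cmod[of "Complex s1 t - z0"] by simp
  then have y1: "Complex s1 t \<in> N" using top_cases[OF t(1,2), of "Re z0 + 1"] by (auto simp: s1_def)
  have lv: "a \<bullet> xx (Complex s1 t) = 1" "a \<bullet> xx (Complex (Re y) t) = 1"
    using G0_level[OF a, of "xx (Complex s1 t)"] y1 y(2) by (simp_all add: N_def X_def t_def)
  have near: "dist (Complex s t) z0 < r" if "\<bar>s - Re z0\<bar> \<le> \<bar>Re y - Re z0\<bar> \<or> \<bar>s - Re z0\<bar> \<le> \<bar>s1 - Re z0\<bar>" for s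
  proof -
    have "cmod (Complex s t - z0) \<le> cmod (y - z0) \<or> cmod (Complex s t - z0) \<le> cmod (Complex s1 t - z0)"
      using that unfolding cmod_def t_def by (auto simp: abs_le_square_iff)
    then show ?thesis using y(3) t(3) by (auto simp: dist_norm)
  qed
  have dl: "((\<lambda>s. a \<bullet> xx (Complex s t)) has_real_derivative a \<bullet> xs (Complex s t)) (at s)" for s
  proof -
    have "((\<lambda>z. a \<bullet> xx z) has_derivative (\<lambda>h. a \<bullet> (Re h *\<^sub>R xs (Complex s t) + Im h *\<^sub>R xt (Complex s t)))) (at (Complex s t))"
      by (rule has_derivative_inner_right[OF der_xx])
    then have "((\<lambda>z. a \<bullet> xx z) has_derivative (\<lambda>h. (a \<bullet> xs (Complex s t)) * Re h + (a \<bullet> xt (Complex s t)) * Im h)) (at (Complex s t))"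
      by (simp add: inner_add_right mult.commute)
    then show ?thesis by (rule has_derivative_Re_line)
  qed
  \<comment> \<open>Rolle's theorem on a column near \<open>z0\<close>, where the radial derivative
    of \<open>a \<bullet> x\<close> keeps its sign: such a column carries at most one point of the
    level set.\<close>
  have no: False if l: "l < h" "a \<bullet> xx (Complex l t) = a \<bullet> xx (Complex h t)" and nr: "\<And>s. l < s \<Longrightarrow> s < h \<Longrightarrow> dist (Complex s t) z0 < r" for l h
  proof -
    obtain s where s: "l < s" "s < h" "a \<bullet> xx (Complex h t) - a \<bullet> xx (Complex l t) = (h - l) * (a \<bullet> xs (Complex s t))"
      using MVT2[OF l(1), of "\<lambda>s. a \<bullet> xx (Complex s t)" "\<lambda>s. a \<bullet> xs (Complex s t)"] dl by blast
    then have "a \<bullet> xs (Complex s t) = 0" using l by simp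
    then show False using r(2)[OF nr[OF s(1,2)]] by simp
  qed
  have "Re y = s1"
  proof (rule ccontr)
    assume "Re y \<noteq> s1"
    then consider "Re y < s1" | "s1 < Re y" by linarith
    then show False
    proof cases
      case 1 then show ?thesis by (rule no) (use lv in \<open>auto intro!: near\<close>)
    next
      case 2 then show ?thesis by (rule no) (use lv in \<open>auto intro!: near\<close>)
    qed
  qed
  then have "y = Complex s1 t" by (simp add: complex_eq_iff t_def)
  then show False using y1 y(2) by (simp add: X_def N_def)
qed

text \<open>The exterior of the cone is the open hemisphere \<open>x \<bullet> e2 < 0\<close>, and
  \<open>a\<close> lies in the plane of its boundary. The level set \<open>K\<close> is an open
  half-circle in which Gamma_0 is both open and closed, so Gamma_0 is all of \<open>K\<close> and
  \<Omega> is one of its two sides, a half-ball about \<open>b\<close> or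
  \<open>- b\<close>.\<close>

lemma case_hemisphere:
  assumes a: "\<And>x. x \<in> closure \<Omega> \<Longrightarrow> u x + 1 = a \<bullet> x" and al: "\<alpha> = pi"
  shows conclusion
proof -
  have ae2: "a \<bullet> e2 = 0" by (rule axis_conditions(1)[OF a])
  have ext: "xx ` strip = {x \<in> S2. x \<bullet> e2 < 0}"
  proof (intro equalityI subsetI)
    fix x assume "x \<in> xx ` strip"
    then obtain z where z: "pi < Im z" "Im z < 2 * pi" "x = xx z" unfolding strip_def using al by auto
    then have "sin (Im z) < 0" by (intro sin_lt_zero) auto
    then show "x \<in> {x \<in> S2. x \<bullet> e2 < 0}" using xx_S2 z by (simp add: xx_inner mult_less_0_iff)
  next
    fix x assume x: "x \<in> {x \<in> S2. x \<bullet> e2 < 0}"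
    then have "norm x = 1" "x \<noteq> p" "x \<noteq> - p" using frame by (auto simp: S2_def)
    then obtain z where z: "xx z = x" "0 \<le> Im z" "Im z < 2 * pi" using xx_surj by blast
    have "\<not> Im z \<le> pi"
    proof
      assume "Im z \<le> pi"
      then have "sin (Im z) \<ge> 0" using z by (intro sin_ge_zero) auto
      then have "xx z \<bullet> e2 \<ge> 0" unfolding xx_inner by (intro mult_nonneg_nonneg) (auto simp: less_imp_le)
      then show False using x z by simp
    qed
    then have "z \<in> strip" unfolding strip_def using z al by auto
    then show "x \<in> xx ` strip" using z by blast
  qed
  define n where "n = norm a"
  obtain x1 where x1: "x1 \<in> G0" using N_nonempty by (auto simp: N_def)
  have lv: "a \<bullet> x = 1" if "x \<in> G0" for x by (rule G0_level[OF a that])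
  have n1: "n \<ge> 1"
  proof -
    have "x1 \<in> S2" using x1 G0_eq ext by blast
    then show ?thesis using norm_cauchy_schwarz[of a x1] lv[OF x1] by (simp add: n_def S2_def)
  qed
  then have n0: "n > 0" by simp
  define b where "b = (1 / n) *\<^sub>R a"
  \<comment> \<open>The vector \<open>b\<close> turned by a right angle in the plane of
    \<open>e1\<close> and \<open>p\<close>; \<open>b\<close>, \<open>f\<close> and \<open>e2\<close>
    form an orthonormal frame.\<close>
  define f where "f = (1 / n) *\<^sub>R ((a \<bullet> e1) *\<^sub>R p - (a \<bullet> p) *\<^sub>R e1)"
  have nn: "n^2 = (a \<bullet> e1)^2 + (a \<bullet> p)^2"
    using unit_expand[of a] ae2 by (simp add: n_def power2_norm_eq_inner)
  have bb: "b \<bullet> b = 1" "f \<bullet> f = 1" "b \<bullet> f = 0" "b \<bullet> e2 = 0" "f \<bullet> e2 = 0"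
  proof -
    show "b \<bullet> b = 1" using n0 by (simp add: b_def n_def power2_norm_eq_inner[symmetric] power2_eq_square)
    have "f \<bullet> f = (1 / n) * ((1 / n) * ((a \<bullet> e1)^2 + (a \<bullet> p)^2))"
      by (simp add: f_def inner_diff_left inner_diff_right frame power2_eq_square add_divide_distrib)
    then show "f \<bullet> f = 1" using n0 unfolding nn[symmetric] by (simp add: power2_eq_square)
    show "b \<bullet> f = 0" by (simp add: b_def f_def inner_diff_right)
    show "b \<bullet> e2 = 0" "f \<bullet> e2 = 0" by (simp_all add: b_def f_def ae2 inner_diff_left frame)
  qed
  have an: "a = n *\<^sub>R b" using n0 by (simp add: b_def)
  define \<rho> where "\<rho> = 1 - (1 / n)^2"
  define K where "K = {x \<in> xx ` strip. a \<bullet> x = 1}"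
  \<comment> \<open>Parametrises the half-circle by its \<open>f\<close>-coordinate; \<rho> is the
    squared radius of the circle.\<close>
  define h where "h = (\<lambda>t. (1 / n) *\<^sub>R b + t *\<^sub>R f - sqrt (\<rho> - t^2) *\<^sub>R e2)"
  have K: "K = h ` {- sqrt \<rho><..<sqrt \<rho>}"
  proof (intro equalityI subsetI)
    fix x assume "x \<in> K"
    then have x: "x \<in> S2" "x \<bullet> e2 < 0" "a \<bullet> x = 1" by (auto simp: K_def ext)
    define t where "t = x \<bullet> f"
    have xb: "x \<bullet> b = 1 / n" using x(3) n0 by (simp add: b_def inner_commute)
    have "x \<bullet> x = (x \<bullet> b) * (x \<bullet> b) + (x \<bullet> f) * (x \<bullet> f) + (x \<bullet> e2) * (x \<bullet> e2)"
      by (rule orthonormal_inner) (simp_all add: bb frame)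
    then have sq: "(- (x \<bullet> e2))^2 = \<rho> - t^2" using x(1) xb by (simp add: S2_def norm_eq_1 \<rho>_def t_def power2_eq_square)
    then have e: "sqrt (\<rho> - t^2) = - (x \<bullet> e2)" using x(2) by (metis less_imp_le neg_0_le_iff_le real_sqrt_unique)
    have "\<rho> - t^2 > 0" using sq x(2) by (metis neg_0_less_iff_less zero_less_power)
    then have "t^2 < \<rho>" by simp
    from real_sqrt_less_mono[OF this] have "\<bar>t\<bar> < sqrt \<rho>" by (simp only: real_sqrt_abs)
    moreover have "x = h t"
    proof -
      have "x = (x \<bullet> b) *\<^sub>R b + (x \<bullet> f) *\<^sub>R f + (x \<bullet> e2) *\<^sub>R e2" by (rule orthonormal_expand) (simp_all add: bb frame)
      then show ?thesis unfolding h_def e unfolding xb t_def by simp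
    qed
    ultimately show "x \<in> h ` {- sqrt \<rho><..<sqrt \<rho>}" by (auto simp: abs_less_iff)
  next
    fix x assume "x \<in> h ` {- sqrt \<rho><..<sqrt \<rho>}"
    then obtain t where t': "- sqrt \<rho> < t" "t < sqrt \<rho>" and x: "x = h t" by auto
    have t: "\<bar>t\<bar> < sqrt \<rho>" "x = h t" using t' x by auto
    have "\<rho> > 0" using t(1) abs_ge_zero[of t] by (metis le_less_trans real_sqrt_gt_0_iff)
    have "\<bar>t\<bar>^2 < (sqrt \<rho>)^2" using t(1) by (intro power_strict_mono) auto
    then have p: "\<rho> - t^2 > 0" using \<open>\<rho> > 0\<close> by simp
    have comm: "f \<bullet> b = 0" "e2 \<bullet> b = 0" "e2 \<bullet> f = 0" using bb by (simp_all add: inner_commute)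
    have "x \<bullet> x = (1 / n)^2 + t^2 + (sqrt (\<rho> - t^2))^2"
      unfolding t(2) h_def by (simp add: inner_add_left inner_add_right inner_diff_left inner_diff_right bb comm frame power2_eq_square)
    also have "\<dots> = 1" using p by (simp add: \<rho>_def)
    finally have "x \<in> S2" by (simp add: S2_def norm_eq_1)
    moreover have "x \<bullet> e2 < 0" using p by (simp add: t(2) h_def inner_add_left inner_diff_left bb frame)
    moreover have "a \<bullet> x = 1" unfolding an t(2) h_def using n0 by (simp add: inner_add_right inner_diff_right bb comm)
    ultimately show "x \<in> K" by (simp add: K_def ext)
  qed
  have connK: "connected K" unfolding K
    by (intro connected_continuous_image) (auto simp: h_def intro!: continuous_intros)
  have KG: "K \<subseteq> G0"
  proof -
    have sub: "G0 \<subseteq> K" using lv G0_eq by (auto simp: K_def)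
    \<comment> \<open>By \<open>level_isolated\<close>, Gamma_0 is open in \<open>K\<close>: it is
      cut out by an open set.\<close>
    have KT: "K \<inter> - closure (K - G0) = G0"
      using level_isolated[OF a] sub closure_subset[of "K - G0"] unfolding K_def[symmetric] by blast
    have "K \<subseteq> - closure (K - G0)"
    proof (rule connected_fill[OF connK])
      fix x assume x: "x \<in> K" "x \<in> closure (K \<inter> - closure (K - G0))"
      then have "x \<in> closure \<Omega> - \<Omega>" using G0_closure unfolding KT by blast
      then have "x \<in> G0" using x(1) by (auto simp: K_def G0_eq)
      then show "x \<in> - closure (K - G0)" using KT by blast
    next
      show "K \<inter> - closure (K - G0) \<noteq> {}" unfolding KT using x1 by blast
    qed auto
    then show ?thesis using KT by blast
  qed
  define Hp where "Hp = {x \<in> xx ` strip. a \<bullet> x > 1}"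
  define Hm where "Hm = {x \<in> xx ` strip. a \<bullet> x < 1}"
  have nz: "(1 / norm v) *\<^sub>R v \<in> S2" if "v \<noteq> 0" for v :: "real^3" using that by (simp add: S2_def)
  have connHp: "connected Hp"
  proof -
    \<comment> \<open>\<open>Hp\<close> is the radial projection of this convex cone.\<close>
    define V where "V = {v. v \<bullet> e2 < 0 \<and> norm v < a \<bullet> v}"
    have "convex V"
    proof (rule convexI)
      fix x y s t assume xy: "x \<in> V" "y \<in> V" "0 \<le> s" "0 \<le> t" "s + t = (1::real)"
      have "norm (s *\<^sub>R x + t *\<^sub>R y) \<le> s * norm x + t * norm y"
        using norm_triangle_ineq[of "s *\<^sub>R x" "t *\<^sub>R y"] xy by simp
      also have "\<dots> < s * (a \<bullet> x) + t * (a \<bullet> y)"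
        using xy by (cases "s = 0") (auto simp: V_def intro!: add_less_le_mono mult_left_mono)
      finally have 1: "norm (s *\<^sub>R x + t *\<^sub>R y) < a \<bullet> (s *\<^sub>R x + t *\<^sub>R y)" by (simp add: inner_add_right)
      have "s * (x \<bullet> e2) + t * (y \<bullet> e2) < 0"
        using xy by (cases "s = 0") (auto simp: V_def mult_neg_pos intro!: add_neg_nonpos mult_pos_neg mult_nonneg_nonpos)
      then show "s *\<^sub>R x + t *\<^sub>R y \<in> V" using 1 by (simp add: V_def inner_add_left)
    qed
    moreover have "Hp = (\<lambda>v. (1 / norm v) *\<^sub>R v) ` V"
    proof (intro equalityI subsetI)
      fix x assume "x \<in> Hp"
      then show "x \<in> (\<lambda>v. (1 / norm v) *\<^sub>R v) ` V"
        by (intro image_eqI[of _ _ x]) (auto simp: Hp_def ext V_def S2_def)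
    next
      fix x assume "x \<in> (\<lambda>v. (1 / norm v) *\<^sub>R v) ` V"
      then obtain v where v: "v \<bullet> e2 < 0" "norm v < a \<bullet> v" "x = (1 / norm v) *\<^sub>R v" by (auto simp: V_def)
      then have "v \<noteq> 0" by auto
      then show "x \<in> Hp" using v nz[of v] by (simp add: Hp_def ext divide_neg_pos)
    qed
    moreover have "continuous_on V (\<lambda>v. (1 / norm v) *\<^sub>R v)"
      by (intro continuous_intros) (auto simp: V_def)
    ultimately show ?thesis by (metis convex_connected connected_continuous_image)
  qed
  have e2Hm: "- e2 \<in> Hm" using ae2 frame by (simp add: Hm_def ext S2_def norm_eq_1)
  have connHm: "connected Hm"
  proof -
    \<comment> \<open>\<open>a \<bullet> v < norm v\<close> is not a convex condition, so
      \<open>Hm\<close> is connected instead through \<open>- e2\<close>: the segment from a point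
      of \<open>Hm\<close> to \<open>- e2\<close> projects into \<open>Hm\<close>.\<close>
    define P where "P = (\<lambda>x. (\<lambda>t. (1 / norm ((1 - t) *\<^sub>R x + t *\<^sub>R (- e2))) *\<^sub>R ((1 - t) *\<^sub>R x + t *\<^sub>R (- e2))) ` {0..1::real})"
    have P: "connected (P x) \<and> P x \<subseteq> Hm \<and> x \<in> P x \<and> - e2 \<in> P x" if x: "x \<in> Hm" for x
    proof -
      have x': "x \<bullet> x = 1" "x \<bullet> e2 < 0" "a \<bullet> x < 1" using x by (auto simp: Hm_def ext S2_def norm_eq_1)
      define v where "v = (\<lambda>t. (1 - t) *\<^sub>R x + t *\<^sub>R (- e2))"
      have ve: "v t \<bullet> e2 < 0" if "0 \<le> t" "t \<le> 1" for t
      proof -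
        have "(1 - t) * (x \<bullet> e2) - t < 0"
        proof (cases "t = 0")
          case False
          have "(1 - t) * (x \<bullet> e2) \<le> 0" using x' that by (intro mult_nonneg_nonpos) auto
          then show ?thesis using False that by linarith
        qed (use x' in simp)
        then show ?thesis by (simp add: v_def inner_diff_left frame)
      qed
      then have v0: "v t \<noteq> 0" if "0 \<le> t" "t \<le> 1" for t using that by fastforce
      have va: "a \<bullet> v t < norm (v t)" if t: "0 \<le> t" "t \<le> 1" for t
      proof (cases "t = 1")
        case True then show ?thesis using ae2 frame by (simp add: v_def norm_eq_sqrt_inner)
      next
        case False
        then have "(1 - t) * (a \<bullet> x) < (1 - t) * 1" using x'(3) t by (intro mult_strict_left_mono) auto
        moreover have "(1 - t)^2 \<le> (norm (v t))^2"
        proof -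
          have "(norm (v t))^2 = (1 - t)^2 + t^2 + 2 * t * (1 - t) * (- (x \<bullet> e2))"
            unfolding power2_norm_eq_inner v_def
            by (simp add: inner_diff_left inner_diff_right x' frame inner_commute[of e2 x] power2_eq_square algebra_simps)
          moreover have "2 * t * (1 - t) * (- (x \<bullet> e2)) \<ge> 0" using t x'(2) by (intro mult_nonneg_nonneg) auto
          moreover have "t^2 \<ge> 0" by simp
          ultimately show ?thesis by linarith
        qed
        then have "1 - t \<le> norm (v t)" by (rule power2_le_imp_le) simp
        ultimately show ?thesis using ae2 by (simp add: v_def inner_diff_right)
      qed
      have Pv: "P x = (\<lambda>t. (1 / norm (v t)) *\<^sub>R v t) ` {0..1}" by (simp add: P_def v_def)
      have "continuous_on {0..1} (\<lambda>t. (1 / norm (v t)) *\<^sub>R v t)"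
        unfolding v_def by (intro continuous_intros) (use v0 in \<open>auto simp: v_def\<close>)
      then have "connected (P x)" unfolding Pv by (intro connected_continuous_image) auto
      moreover have "P x \<subseteq> Hm"
      proof
        fix y assume "y \<in> P x"
        then obtain t where t: "0 \<le> t" "t \<le> 1" "y = (1 / norm (v t)) *\<^sub>R v t" unfolding Pv by auto
        have "norm (v t) > 0" using v0[OF t(1,2)] by simp
        then show "y \<in> Hm" using ve[OF t(1,2)] va[OF t(1,2)] nz[OF v0[OF t(1,2)]] t(3)
          by (simp add: Hm_def ext divide_neg_pos)
      qed
      moreover have "x \<in> P x" unfolding Pv by (rule image_eqI[of _ _ 0]) (use x' in \<open>auto simp: v_def norm_eq_sqrt_inner\<close>)
      moreover have "- e2 \<in> P x" unfolding Pv by (rule image_eqI[of _ _ 1]) (use frame in \<open>auto simp: v_def norm_eq_sqrt_inner\<close>)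
      ultimately show ?thesis by blast
    qed
    have "connected (\<Union>(P ` Hm))"
      by (rule connected_Union) (use P e2Hm in auto)
    moreover have "\<Union>(P ` Hm) = Hm" using P by blast
    ultimately show ?thesis by simp
  qed
  have fillp: "Hp \<subseteq> \<Omega>" if "Hp \<inter> \<Omega> \<noteq> {}"
    by (rule sphere_fill[OF connHp _ _ that]) (use lv in \<open>auto simp: Hp_def\<close>)
  have fillm: "Hm \<subseteq> \<Omega>" if "Hm \<inter> \<Omega> \<noteq> {}"
    by (rule sphere_fill[OF connHm _ _ that]) (use lv in \<open>auto simp: Hm_def\<close>)
  have cover: "x \<in> Hp \<or> x \<in> Hm" if "x \<in> xx ` strip" "x \<notin> G0" for x
    using that KG by (auto simp: K_def Hp_def Hm_def)
  have OG: "\<Omega> \<inter> G0 = {}" using G0_eq by blast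
  have notboth: "\<not> (Hp \<subseteq> \<Omega> \<and> Hm \<subseteq> \<Omega>)"
  proof
    assume both: "Hp \<subseteq> \<Omega> \<and> Hm \<subseteq> \<Omega>"
    obtain z0 where z0: "z0 \<in> N" using N_nonempty by blast
    obtain e where e: "e > 0" "\<And>h. 0 < h \<Longrightarrow> h < e \<Longrightarrow> Complex (Re z0 + h) (Im z0) \<notin> closure D" using N_up[OF z0] by blast
    define y where "y = Complex (Re z0 + e / 2) (Im z0)"
    have y: "y \<notin> closure D" "y \<in> strip" using e N_strip[OF z0] by (auto simp: y_def strip_def)
    have "xx y \<notin> G0" using y N_closure by (auto simp: N_def)
    then have "xx y \<in> \<Omega>" using cover[of "xx y"] y(2) both by blast
    then have "y \<in> D" using y(2) by (simp add: D_def)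
    then show False using y(1) closure_subset[of D] by blast
  qed
  have S2e: "x \<in> S2 - closure C \<longleftrightarrow> x \<in> xx ` strip" for x using exterior by blast
  have alt: "q \<in> S2 \<Longrightarrow> q \<bullet> e2 = 0 \<Longrightarrow> q \<in> sbd C \<and> totally_geodesic (sbd \<Omega> \<inter> sbd C)" for q
  proof
    assume q: "q \<in> S2" "q \<bullet> e2 = 0"
    have "q \<in> closure C" using S2e[of q] q by (auto simp: ext)
    moreover have "q \<notin> s_interior C"
    proof
      assume "q \<in> s_interior C"
      then obtain e where e: "e > 0" "\<And>y. y \<in> S2 \<Longrightarrow> dist y q < e \<Longrightarrow> y \<in> C" unfolding s_interior_def by blast
      \<comment> \<open>Turns \<open>q\<close> by a small angle out of the plane of the face into
        the exterior of the cone, showing that \<open>q\<close> is not interior to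
        \<open>C\<close>.\<close>
      define k where "k = (\<lambda>t::real. cos t *\<^sub>R q - sin t *\<^sub>R e2)"
      have "continuous_on UNIV k" unfolding k_def by (intro continuous_intros)
      then obtain d where d: "d > 0" "\<And>t. dist t 0 < d \<Longrightarrow> dist (k t) (k 0) < e"
        using e(1) unfolding continuous_on_iff by (metis UNIV_I)
      define t where "t = min (d / 2) 1"
      have t: "0 < t" "t < d" "t \<le> 1" using d(1) by (auto simp: t_def)
      have "k t \<bullet> k t = (cos t)^2 + (sin t)^2"
        using q frame by (simp add: k_def inner_diff_left inner_diff_right inner_commute[of e2 q] S2_def norm_eq_1 power2_eq_square)
      then have kS: "k t \<in> S2" by (simp add: S2_def norm_eq_1)
      have "sin t > 0" using t pi_gt3 by (intro sin_gt_zero) auto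
      then have "k t \<bullet> e2 < 0" using q frame by (simp add: k_def inner_diff_left)
      then have ks: "k t \<in> xx ` strip" using kS by (simp add: ext)
      have "dist (k t) q < e" using d(2)[of t] t by (simp add: k_def)
      then have "k t \<in> closure C" using e(2)[OF kS] closure_subset[of C] by blast
      then show False using ks exterior by blast
    qed
    ultimately show "q \<in> sbd C" by (simp add: sbd_def)
    have "x \<bullet> e2 = 0" if x: "x \<in> sbd \<Omega>" "x \<in> sbd C" for x
    proof -
      have xc: "x \<in> closure \<Omega>" "x \<in> closure C" using x by (auto simp: sbd_def)
      have "\<Omega> \<subseteq> {x. x \<bullet> e2 \<le> 0}" using Omega_sub by (auto simp: ext)
      moreover have "closed {x. x \<bullet> e2 \<le> 0}" by (intro closed_Collect_le continuous_intros)
      ultimately have "x \<bullet> e2 \<le> 0" using closure_minimal xc(1) by blast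
      moreover have "x \<notin> xx ` strip" using xc(2) exterior by blast
      then have "\<not> x \<bullet> e2 < 0" using xc(1) closure_Omega_S2 by (auto simp: ext)
      ultimately show ?thesis by simp
    qed
    then show "totally_geodesic (sbd \<Omega> \<inter> sbd C)"
      unfolding totally_geodesic_def using frame by (intro exI[of _ e2]) auto
  qed
  have nb: "n * (b \<bullet> x) = a \<bullet> x" for x by (simp add: an)
  show ?thesis
  proof (cases "Hp \<inter> \<Omega> = {}")
    case False
    then have "Hm \<inter> \<Omega> = {}" using fillp fillm notboth by blast
    then have "\<Omega> = Hp" using fillp[OF False] cover Omega_sub OG by blast
    then have "\<Omega> = {x \<in> S2 - closure C. b \<bullet> x > 1 / n}"
      unfolding exterior Hp_def nb[symmetric] using n0 by (auto simp: field_simps)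
    then show ?thesis
    proof (rule ball_form[rotated 3])
      show "u x + 1 = (b \<bullet> x) / (1 / n)" if "x \<in> closure \<Omega>" for x using a[OF that] nb[of x] by (simp add: mult.commute)
      show bS: "b \<in> S2" using bb(1) by (simp add: S2_def norm_eq_1)
      show "b = p \<or> b \<in> sbd C \<and> totally_geodesic (sbd \<Omega> \<inter> sbd C)" using alt[OF bS bb(4)] by simp
    qed (use n1 in auto)
  next
    case True
    then have "\<Omega> \<subseteq> Hm" using cover Omega_sub OG by blast
    then have "Hm \<inter> \<Omega> \<noteq> {}" using Omega_nonempty by blast
    then have "\<Omega> = Hm" using fillm \<open>\<Omega> \<subseteq> Hm\<close> by blast
    \<comment> \<open>The complement of a closed cap about \<open>b\<close> is a ball about
      \<open>- b\<close>, with the negative value \<open>cos R = - (1 / n)\<close>.\<close>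
    then have "\<Omega> = {x \<in> S2 - closure C. (- b) \<bullet> x > - (1 / n)}"
      unfolding exterior Hm_def nb[symmetric] using n0 by (auto simp: field_simps)
    then show ?thesis
    proof (rule ball_form[rotated 3])
      show "u x + 1 = ((- b) \<bullet> x) / (- (1 / n))" if "x \<in> closure \<Omega>" for x using a[OF that] nb[of x] by (simp add: mult.commute)
      show bS: "- b \<in> S2" using bb(1) by (simp add: S2_def norm_eq_1)
      have "- b \<bullet> e2 = 0" using bb(4) by simp
      then show "- b = p \<or> - b \<in> sbd C \<and> totally_geodesic (sbd \<Omega> \<inter> sbd C)" using alt[OF bS] by simp
    qed (use n1 in auto)
  qed
qed

lemma rigidity: conclusion
proof -
  obtain a where "\<And>x. x \<in> closure \<Omega> \<Longrightarrow> u x + 1 = a \<bullet> x" using u_linear by blast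
  then show ?thesis using case_lune case_hemisphere alpha(2) by (cases "\<alpha> = pi") auto
qed

end

theorem theorem3p2:
  fixes p e1 e2 :: "real^3" and \<alpha> c :: real and \<Omega> :: "(real^3) set"
    and u :: "real^3 \<Rightarrow> real" and Du :: "real^3 \<Rightarrow> real^3" and D2u :: "real^3 \<Rightarrow> real^3^3"
    and \<nu> :: "real^3 \<Rightarrow> real^3"
  defines "C \<equiv> scone p (tarc e1 e2 \<alpha>)"
  defines "W \<equiv> {x. x \<noteq> 0 \<and> (x /\<^sub>R norm x) \<in> \<Omega>}"
  assumes arc: "convex_arc p e1 e2 \<alpha>"
    and adm: "admissible_exterior p C \<Omega>"
    and nu: "\<forall>x \<in> Gamma0 C \<Omega> \<union> (Gamma1 C \<Omega> - {p}). outward_normal \<Omega> x (\<nu> x)"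
    and star: "star_shaped_wrt p C \<Omega> \<nu>"
    \<comment> \<open>u is C^2 up to the boundary; derivatives are those of the 0-homogeneous extension
        x \<mapsto> u(x/|x|) to R^3, extended continuously to the closure of Omega\<close>
    and D1: "\<forall>x\<in>W. ((\<lambda>y. u (y /\<^sub>R norm y)) has_derivative (\<lambda>h. Du x \<bullet> h)) (at x)"
    and D2: "\<forall>x\<in>W. (Du has_derivative (\<lambda>h. D2u x *v h)) (at x)"
    and cont: "continuous_on (closure \<Omega>) u" "continuous_on (closure \<Omega>) Du"
      "continuous_on (closure \<Omega>) D2u"
    \<comment> \<open>Laplace-Beltrami equation (trace of the Hessian of the homogeneous extension)\<close>
    and pde: "\<forall>x\<in>\<Omega>. (\<Sum>i\<in>UNIV. D2u x $ i $ i) + 2 * u x = -2"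
    and bc0: "\<forall>x\<in>Gamma0 C \<Omega>. u x = 0 \<and> Du x \<bullet> \<nu> x = c"
    and bc1: "\<forall>x\<in>Gamma1 C \<Omega> - {p}. Du x \<bullet> \<nu> x = 0"
  shows "\<exists>p0 R. p0 \<in> S2 \<and> R > 0 \<and> \<Omega> = sball p0 R - closure C \<and>
           (\<forall>x\<in>closure \<Omega>. u x = (1 / cos R) * (cos (sdist p0 x) - cos R)) \<and>
           (p0 = p \<or> (p0 \<in> sbd C \<and> totally_geodesic (sbd \<Omega> \<inter> sbd C)))"
proof -
  note C_eq = C_def
  interpret cone_solution p e1 e2 \<alpha> \<Omega> \<nu> u Du D2u c
  proof (unfold_locales, goal_cases)
    case 1 show ?case using arc by (simp add: convex_arc_def S2_def norm_eq_1)
  next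
    case 2 show ?case using arc by (simp add: convex_arc_def norm_eq_1)
  next
    case 3 show ?case using arc by (simp add: convex_arc_def norm_eq_1)
  next
    case 4 show ?case using arc by (simp add: convex_arc_def)
  next
    case 5 show ?case using arc by (simp add: convex_arc_def)
  next
    case 6 show ?case using arc by (simp add: convex_arc_def)
  next
    case 7 show ?case using arc by (simp add: convex_arc_def)
  next
    case 8 show ?case using arc by (simp add: convex_arc_def)
  next
    case 9 show ?case using adm by (simp add: C_def)
  next
    case (10 x) then show ?case using nu unfolding C_def by blast
  next
    case 11 show ?case using star by (simp add: C_def)
  next
    case (12 x) then show ?case using D1 unfolding W_def by blast
  next
    case (13 x) then show ?case using D2 unfolding W_def by blast
  next
    case 14 show ?case by (rule cont)
  next
    case 15 show ?case by (rule cont)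
  next
    case 16 show ?case by (rule cont)
  next
    case (17 x) then show ?case using pde by blast
  next
    case (18 x) then show ?case using bc0 unfolding C_def by blast
  next
    case (19 x) then show ?case using bc1 unfolding C_def by blast
  qed
  have "cone_domain.C p e1 e2 \<alpha> = scone p (tarc e1 e2 \<alpha>)" by (simp only: C_def)
  with rigidity show ?thesis unfolding conclusion_def C_eq by simp
qed

end
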